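(* Let $n=2r$, let $R:\mathbb{R}^n\to\mathbb{Z}^n$ be a quantizer, and let $L=\sum_{k=1}^rU_kJ_kV_k\in\mathbb{R}^{n\times n}$, where $U=[U_1\ \cdots\ U_r]\in\mathbb{R}^{n\times n}$ is nonsingular with blocks $U_k\in\mathbb{R}^{n\times2}$, $V_k\in\mathbb{R}^{2\times n}$ are the consecutive row blocks of $U^{-1}$, and $J_k=\begin{bmatrix}\cos\theta_k&-\sin\theta_k\\ \sin\theta_k&\cos\theta_k\end{bmatrix}$ with $\theta_k\in(0,2\pi)$. Suppose $L$ is iteratively nonresonant and has a nondegenerate spectrum. Then, for any $B\in\widetilde{\mathcal{B}}_C$, $$\lim_{N\to+\infty}\mathbf{F}\{x\in\mathbb{Z}^n:\ \widetilde{W}_N(x)\in B\}=\mathcal{W}(B),$$ where $\mathcal{W}$ is the Wiener measure (the law of the $n$-dimensional standard Wiener process) on $(C,\mathcal{B}_C)$.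
   Context: Frequency. For $a\in\mathbb{Z}^n$ and $\ell\in\mathbb{N}^n$ let $P_{a,\ell}=\{x\in\mathbb{Z}^n:\ a_k\le x_k<a_k+\ell_k \text{ for all }1\le k\le n\}$, and for $N\in\mathbb{N}$ let $\mathcal{P}_N=\{P_{a,\ell}:\ a\in\mathbb{Z}^n,\ \ell\in\mathbb{N}^n,\ \min_k\ell_k\ge N\}$. For $A\subset\mathbb{Z}^n$ put $\mathbf{F}_*(A)=\sup_{N\ge1}\inf_{P\in\mathcal{P}_N}\frac{\#(A\cap P)}{\#P}$ and $\mathbf{F}^*(A)=\inf_{N\ge1}\sup_{P\in\mathcal{P}_N}\frac{\#(A\cap P)}{\#P}$. The set $A$ is frequency measurable if $\mathbf{F}_*(A)=\mathbf{F}^*(A)$; the common value is the frequency $\mathbf{F}(A)$. Distributed maps. For a metric space $X$ with Borel $\sigma$-algebra $\mathcal{B}$ and a countably additive probability measure $D$ on $(X,\mathcal{B})$, a map $h:\mathbb{Z}^n\to X$ is $D$-distributed if for every $B\in\mathcal{B}$ with $D(\partial B)=0$ the preimage $h^{-1}(B)$ is frequency measurable and $\mathbf{F}(h^{-1}(B))=D(B)$. There is at most one such $D$. System. A quantizer is a map $R:\mathbb{R}^n\to\mathbb{Z}^n$ such that $R(u+z)=R(u)+z$ for all $u\in\mathbb{R}^n$, $z\in\mathbb{Z}^n$, and the set $R^{-1}(0)$ is Jordan measurable (bounded with boundary of zero Lebesgue measure). Let $T=R\circ L:\mathbb{Z}^n\to\mathbb{Z}^n$, $E(x)=Lx-T(x)$,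 $E_k=E\circ T^{k-1}$ for $k\in\mathbb{N}$, $\mu=\int_{R^{-1}(0)}u\,\mathrm{d}u$, $\Psi=\int_{R^{-1}(0)}(u-\mu)(u-\mu)^{\mathrm{T}}\,\mathrm{d}u$, and $\xi_0=0$, $\xi_N(x)=\sum_{k=1}^NL^{-k}(E_k(x)-\mu)$ for $N\in\mathbb{N}$. Nonresonance and spectrum. $\Lambda\in\mathbb{R}^{m\times n}$ is nonresonant if the rows of $\begin{bmatrix}I_n\\ \Lambda\end{bmatrix}$ are linearly independent over the rationals. A nonsingular $L$ is iteratively nonresonant if every finite submatrix (formed from finitely many rows with distinct indices) of the infinite matrix obtained by stacking all nonzero integer powers $L^k$, $k\in\mathbb{Z}\setminus\{0\}$, is nonresonant. Nondegenerate spectrum means that the $2r$ eigenvalues $e^{\pm i\theta_k}$, $1\le k\le r$, are pairwise different. Normalization. Let $\sigma_k=\sqrt{\mathrm{Tr}(V_k\Psi V_k^{\mathrm{T}})}$, $\Phi=\lim_{N\to\infty}\frac1N\sum_{\ell=1}^NL^{-\ell}\Psi(L^{-\ell})^{\mathrm{T}}=\frac12\sum_{k=1}^r\sigma_k^2U_kU_k^{\mathrm{T}}$, $\sqrt{\Phi}=\frac{1}{\sqrt2}[\sigma_1U_1\ \cdots\ \sigma_rU_r]$ and $\Phi^{-1/2}=(\sqrt{\Phi})^{-1}$. For $N\in\mathbb{N}$ and $t\in[0,1]$ let $$W_{N,t}=\frac{1}{\sqrt N}\Phi^{-1/2}\Big(\xi_{\lfloor Nt\rfloor}+(Nt-\lfloor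 Nt\rfloor)\big(\xi_{\lceil Nt\rceil}-\xi_{\lfloor Nt\rfloor}\big)\Big):\mathbb{Z}^n\to\mathbb{R}^n.$$ $C$ is the space of continuous functions $f:[0,1]\to\mathbb{R}^n$ with $f(0)=0$, with the uniform norm and Borel $\sigma$-algebra $\mathcal{B}_C$. The map $\widetilde{W}_N:\mathbb{Z}^n\to C$ sends $x$ to the function $t\mapsto W_{N,t}(x)$. Under the hypotheses on $L$, for each $N$ the map $\widetilde{W}_N$ is $\widetilde{D}_N$-distributed for a (unique) countably additive probability measure $\widetilde{D}_N$ on $(C,\mathcal{B}_C)$. Finally, $$\widetilde{\mathcal{B}}_C=\{B\in\mathcal{B}_C:\ \mathcal{W}(\partial B)=0\text{ and }\widetilde{D}_N(\partial B)=0\text{ for all sufficiently large }N\in\mathbb{N}\}.$$ *)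

theory Defs
  imports "HOL-Probability.Probability"
begin

definition lattice_box :: "int^'n \<Rightarrow> nat^'n \<Rightarrow> (int^'n) set" where
  "lattice_box a l = {x. \<forall>k. a $ k \<le> x $ k \<and> x $ k < a $ k + int (l $ k)}"

definition lattice_boxes :: "nat \<Rightarrow> (int^'n) set set" where
  "lattice_boxes N = {lattice_box a l | a l. \<forall>k. N \<le> l $ k}"

definition lower_freq :: "(int^'n) set \<Rightarrow> real" where
  "lower_freq A = (SUP N\<in>{1..}. INF P\<in>lattice_boxes N. real (card (A \<inter> P)) / real (card P))"

definition upper_freq :: "(int^'n) set \<Rightarrow> real" where
  "upper_freq A = (INF N\<in>{1..}. SUP P\<in>lattice_boxes N. real (card (A \<inter> P)) / real (card P))"

definition freq_measurable :: "(int^'n) set \<Rightarrow> bool" where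
  "freq_measurable A \<longleftrightarrow> lower_freq A = upper_freq A"

text \<open>Meaningful only for frequency measurable sets; unspecified otherwise.\<close>

definition freq :: "(int^'n) set \<Rightarrow> real" where
  "freq A = (THE p. p = lower_freq A \<and> p = upper_freq A)"

definition freq_distributed :: "'x::metric_space measure \<Rightarrow> (int^'n \<Rightarrow> 'x) \<Rightarrow> bool" where
  "freq_distributed D h \<longleftrightarrow> prob_space D \<and> sets D = sets borel \<and>
     (\<forall>B\<in>sets borel. measure D (frontier B) = 0 \<longrightarrow>
        freq_measurable (h -` B) \<and> freq (h -` B) = measure D B)"

definition freq_law :: "(int^'n \<Rightarrow> 'x::metric_space) \<Rightarrow> 'x measure" where
  "freq_law h = (THE D. freq_distributed D h)"

text \<open>The overloaded product and power on \<open>real^'n^'n\<close> are componentwise,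
  so powers with respect to \<open>**\<close> are introduced here.\<close>

definition matpow :: "real^'n^'n \<Rightarrow> nat \<Rightarrow> real^'n^'n" where
  "matpow A k = (((**) A) ^^ k) (mat 1)"

definition matpowi :: "real^'n^'n \<Rightarrow> int \<Rightarrow> real^'n^'n" where
  "matpowi A k = (if 0 \<le> k then matpow A (nat k) else matpow (matrix_inv A) (nat (- k)))"

text \<open>Linear independence over the rationals of a finite family (repetitions count as dependence).\<close>

definition rat_independent :: "'i set \<Rightarrow> ('i \<Rightarrow> real^'n) \<Rightarrow> bool" where
  "rat_independent I v \<longleftrightarrow>
     (\<forall>c :: 'i \<Rightarrow> rat. (\<Sum>i\<in>I. of_rat (c i) *\<^sub>R v i) = 0 \<longrightarrow> (\<forall>i\<in>I. c i = 0))"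

text \<open>A matrix with finitely many rows is given by its family of rows \<open>v i\<close>, \<open>i \<in> I\<close>;
  the rows of the identity matrix, \<open>axis j 1\<close>, are stacked on top of it.\<close>

definition nonresonant :: "'i set \<Rightarrow> ('i \<Rightarrow> real^'n) \<Rightarrow> bool" where
  "nonresonant I v \<longleftrightarrow> rat_independent ((UNIV :: 'n set) <+> I) (case_sum (\<lambda>j. axis j 1) v)"

text \<open>The pair \<open>(k, i)\<close> indexes row \<open>i\<close> of \<open>L\<^sup>k\<close> in the infinite stacked matrix.\<close>

definition iteratively_nonresonant :: "real^'n^'n \<Rightarrow> bool" where
  "iteratively_nonresonant L \<longleftrightarrow> invertible L \<and>
     (\<forall>I :: (int \<times> 'n) set. finite I \<and> I \<subseteq> (UNIV - {0}) \<times> UNIV \<longrightarrow>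
        nonresonant I (\<lambda>(k, i). row i (matpowi L k)))"

definition of_int_vec :: "int^'n \<Rightarrow> real^'n" where
  "of_int_vec z = (\<chi> i. of_int (z $ i))"

definition jordan_measurable :: "(real^'n) set \<Rightarrow> bool" where
  "jordan_measurable S \<longleftrightarrow> bounded S \<and> frontier S \<in> null_sets lebesgue"

definition quantizer :: "(real^'n \<Rightarrow> int^'n) \<Rightarrow> bool" where
  "quantizer R \<longleftrightarrow> (\<forall>u z. R (u + of_int_vec z) = R u + z) \<and> jordan_measurable (R -` {0})"

definition q_map :: "(real^'n \<Rightarrow> int^'n) \<Rightarrow> real^'n^'n \<Rightarrow> int^'n \<Rightarrow> int^'n" where
  "q_map R L x = R (L *v of_int_vec x)"

definition q_error :: "(real^'n \<Rightarrow> int^'n) \<Rightarrow> real^'n^'n \<Rightarrow> int^'n \<Rightarrow> real^'n" where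
  "q_error R L x = L *v of_int_vec x - of_int_vec (q_map R L x)"

definition q_error_at :: "(real^'n \<Rightarrow> int^'n) \<Rightarrow> real^'n^'n \<Rightarrow> nat \<Rightarrow> int^'n \<Rightarrow> real^'n" where
  "q_error_at R L k = q_error R L \<circ> (q_map R L ^^ (k - 1))"

text \<open>The cell \<open>R -` {0}\<close> need not be Borel, hence integration with respect to \<open>lebesgue\<close>.\<close>

definition q_mean :: "(real^'n \<Rightarrow> int^'n) \<Rightarrow> real^'n" where
  "q_mean R = (LINT u : R -` {0} | lebesgue. u)"

definition q_cov :: "(real^'n \<Rightarrow> int^'n) \<Rightarrow> real^'n^'n" where
  "q_cov R = (\<chi> i j. LINT u : R -` {0} | lebesgue. (u - q_mean R) $ i * (u - q_mean R) $ j)"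

definition q_xi :: "(real^'n \<Rightarrow> int^'n) \<Rightarrow> real^'n^'n \<Rightarrow> int^'n \<Rightarrow> nat \<Rightarrow> real^'n" where
  "q_xi R L x N = (\<Sum>k=1..N. matpowi L (- int k) *v (q_error_at R L k x - q_mean R))"

text \<open>Dimension \<open>n = 2r\<close> is rendered by the coordinate type \<open>'r \<times> 2\<close> with \<open>r = CARD('r)\<close>:
  coordinate \<open>(k, j)\<close> is the \<open>j\<close>-th one (\<open>j = 1, 2\<close>) of the \<open>k\<close>-th consecutive pair.\<close>

definition col_block :: "real^('r::finite \<times> 2)^'m \<Rightarrow> 'r \<Rightarrow> real^2^'m" where
  "col_block A k = (\<chi> i j. A $ i $ (k, j))"

definition row_block :: "real^'m^('r::finite \<times> 2) \<Rightarrow> 'r \<Rightarrow> real^'m^2" where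
  "row_block A k = (\<chi> i j. A $ (k, i) $ j)"

definition rotation2 :: "real \<Rightarrow> real^2^2" where
  "rotation2 \<theta> = vector [vector [cos \<theta>, - sin \<theta>], vector [sin \<theta>, cos \<theta>]]"

definition nondegenerate_spectrum :: "('r \<Rightarrow> real) \<Rightarrow> bool" where
  "nondegenerate_spectrum \<theta> \<longleftrightarrow>
     inj (\<lambda>(k, s :: bool). exp (\<i> * complex_of_real (if s then \<theta> k else - \<theta> k)))"

definition q_sigma ::
  "(real^('r::finite \<times> 2) \<Rightarrow> int^('r \<times> 2)) \<Rightarrow> real^('r \<times> 2)^('r \<times> 2) \<Rightarrow> 'r \<Rightarrow> real" where
  "q_sigma R U k =
     (let V = row_block (matrix_inv U) k in sqrt (trace (V ** q_cov R ** transpose V)))"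

text \<open>This is \<open>(\<sigma>\<^sub>1 U\<^sub>1 ... \<sigma>\<^sub>r U\<^sub>r) / sqrt 2\<close>; in general it is not the symmetric square root.\<close>

definition sqrt_Phi ::
  "(real^('r::finite \<times> 2) \<Rightarrow> int^('r \<times> 2)) \<Rightarrow> real^('r \<times> 2)^('r \<times> 2) \<Rightarrow> real^('r \<times> 2)^('r \<times> 2)" where
  "sqrt_Phi R U = (1 / sqrt 2) *\<^sub>R (\<chi> i p. q_sigma R U (fst p) * col_block U (fst p) $ i $ snd p)"

text \<open>Paths are normalized to vanish outside \<open>{0..1}\<close>, so that equality of elements is
  equality of functions on the unit interval.\<close>

definition path0_set :: "(real \<Rightarrow> 'a::real_normed_vector) set" where
  "path0_set = {f. continuous_on {0..1} f \<and> f 0 = 0 \<and> (\<forall>t. t \<notin> {0..1} \<longrightarrow> f t = 0)}"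

typedef (overloaded) 'a path0 = "path0_set :: (real \<Rightarrow> 'a::real_normed_vector) set"
  morphisms path_fun Path
  by (rule exI[of _ "\<lambda>_. 0"]) (simp add: path0_set_def)

lemma bdd_above_path_dist:
  fixes f g :: "'a::real_normed_vector path0"
  shows "bdd_above ((\<lambda>t. dist (path_fun f t) (path_fun g t)) ` {0..1})"
proof -
  have "continuous_on {0..1} (path_fun f)" "continuous_on {0..1} (path_fun g)"
    using path_fun[of f] path_fun[of g] by (auto simp: path0_set_def)
  then have "compact ((\<lambda>t. dist (path_fun f t) (path_fun g t)) ` {0..1})"
    by (intro compact_continuous_image continuous_intros) auto
  then show ?thesis
    by (intro bounded_imp_bdd_above compact_imp_bounded)
qed

instantiation path0 :: (real_normed_vector) metric_space
begin

definition dist_path0 :: "'a path0 \<Rightarrow> 'a path0 \<Rightarrow> real" where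
  "dist_path0 f g = (SUP t\<in>{0..1}. dist (path_fun f t) (path_fun g t))"

definition uniformity_path0 :: "('a path0 \<times> 'a path0) filter" where
  "uniformity_path0 = (INF e\<in>{0 <..}. principal {(x, y). dist x y < e})"

definition open_path0 :: "'a path0 set \<Rightarrow> bool" where
  "open_path0 S = (\<forall>x\<in>S. \<forall>\<^sub>F (x', y) in uniformity. x' = x \<longrightarrow> y \<in> S)"

instance
proof
  fix f g h :: "'a path0"
  have upper: "dist (path_fun f t) (path_fun g t) \<le> dist f g" if "t \<in> {0..1}" for f g :: "'a path0" and t
    unfolding dist_path0_def using that bdd_above_path_dist by (rule cSUP_upper)
  show "dist f g = 0 \<longleftrightarrow> f = g"
  proof
    assume *: "dist f g = 0"
    have "path_fun f t = path_fun g t" for t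
    proof (cases "t \<in> {0..1}")
      case True
      then show ?thesis using upper[of t f g] * by simp
    next
      case False
      then show ?thesis
        using path_fun[of f] path_fun[of g] by (simp add: path0_set_def)
    qed
    then show "f = g" by (simp add: path_fun_inject[symmetric] fun_eq_iff)
  qed (simp add: dist_path0_def)
  show "dist f g \<le> dist f h + dist g h"
    unfolding dist_path0_def[of f g]
  proof (rule cSUP_least)
    fix t :: real assume "t \<in> {0..1}"
    then show "dist (path_fun f t) (path_fun g t) \<le> dist f h + dist g h"
      using upper[of t f h] upper[of t g h]
        dist_triangle2[of "path_fun f t" "path_fun g t" "path_fun h t"] by linarith
  qed simp
qed (rule open_path0_def uniformity_path0_def)+

end

text \<open>Increments over \<open>[s, t]\<close> have the law with mean zero and covariance \<open>(t - s) I\<close>,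
  given by its product density; \<open>normal_density\<close> takes the standard deviation.\<close>

definition standard_wiener_process :: "'a measure \<Rightarrow> (real \<Rightarrow> 'a \<Rightarrow> real^'n) \<Rightarrow> bool" where
  "standard_wiener_process M X \<longleftrightarrow> prob_space M \<and>
     (\<forall>t\<in>{0..1}. X t \<in> borel_measurable M) \<and>
     (\<forall>\<omega>\<in>space M. X 0 \<omega> = 0 \<and> continuous_on {0..1} (\<lambda>t. X t \<omega>)) \<and>
     (\<forall>s t. 0 \<le> s \<and> s < t \<and> t \<le> 1 \<longrightarrow>
        distributed M lborel (\<lambda>\<omega>. X t \<omega> - X s \<omega>)
          (\<lambda>x. ennreal (\<Prod>i\<in>UNIV. normal_density 0 (sqrt (t - s)) (x $ i)))) \<and>
     (\<forall>m (t :: nat \<Rightarrow> real). (\<forall>i\<le>m. t i \<in> {0..1}) \<and> (\<forall>i<m. t i \<le> t (Suc i)) \<longrightarrow>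
        prob_space.indep_vars M (\<lambda>_. borel) (\<lambda>i \<omega>. X (t (Suc i)) \<omega> - X (t i) \<omega>) {..<m})"

text \<open>A Borel measure on path space is the law of a standard Wiener process iff
  the coordinate process is a standard Wiener process under it.\<close>

definition wiener_measure :: "(real^'n) path0 measure \<Rightarrow> bool" where
  "wiener_measure W \<longleftrightarrow> sets W = sets borel \<and> standard_wiener_process W (\<lambda>t f. path_fun f t)"

definition polygonal :: "(nat \<Rightarrow> 'a::real_vector) \<Rightarrow> real \<Rightarrow> 'a" where
  "polygonal s u = s (nat \<lfloor>u\<rfloor>) + (u - of_int \<lfloor>u\<rfloor>) *\<^sub>R (s (nat \<lceil>u\<rceil>) - s (nat \<lfloor>u\<rfloor>))"

definition W_at ::
  "(real^('r::finite \<times> 2) \<Rightarrow> int^('r \<times> 2)) \<Rightarrow> real^('r \<times> 2)^('r \<times> 2) \<Rightarrow> real^('r \<times> 2)^('r \<times> 2) \<Rightarrow>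
   nat \<Rightarrow> real \<Rightarrow> int^('r \<times> 2) \<Rightarrow> real^('r \<times> 2)" where
  "W_at R L U N t x =
     (1 / sqrt (real N)) *\<^sub>R (matrix_inv (sqrt_Phi R U) *v polygonal (q_xi R L x) (real N * t))"

definition W_path ::
  "(real^('r::finite \<times> 2) \<Rightarrow> int^('r \<times> 2)) \<Rightarrow> real^('r \<times> 2)^('r \<times> 2) \<Rightarrow> real^('r \<times> 2)^('r \<times> 2) \<Rightarrow>
   nat \<Rightarrow> int^('r \<times> 2) \<Rightarrow> (real^('r \<times> 2)) path0" where
  "W_path R L U N x = Path (\<lambda>t. if t \<in> {0..1} then W_at R L U N t x else 0)"

lemma polygonal_eq:
  assumes "u \<in> {real k..real (Suc k)}"
  shows "polygonal s u = s k + (u - real k) *\<^sub>R (s (Suc k) - s k)"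
proof -
  consider "u = real k" | "u = real (Suc k)" | "real k < u" "u < real (Suc k)"
    using assms by fastforce
  then show ?thesis
  proof cases
    case 2
    then show ?thesis
      unfolding polygonal_def 2 floor_of_nat ceiling_of_nat nat_int by simp
  next
    case 3
    then have "\<lfloor>u\<rfloor> = int k" "\<lceil>u\<rceil> = int (Suc k)"
      by (simp_all add: floor_eq_iff ceiling_eq_iff)
    then show ?thesis unfolding polygonal_def by (simp only: nat_int of_int_of_nat_eq)
  qed (simp add: polygonal_def)
qed

lemma continuous_on_polygonal:
  fixes s :: "nat \<Rightarrow> 'a::real_normed_vector"
  shows "continuous_on {0..real N} (polygonal s)"
proof (induction N)
  case (Suc N)
  have "continuous_on {real N..real (Suc N)} (\<lambda>u. s N + (u - real N) *\<^sub>R (s (Suc N) - s N))"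
    by (intro continuous_intros)
  then have "continuous_on {real N..real (Suc N)} (polygonal s)"
    by (rule continuous_on_eq) (simp only: polygonal_eq)
  then have "continuous_on ({0..real N} \<union> {real N..real (Suc N)}) (polygonal s)"
    by (intro continuous_on_closed_Un Suc closed_atLeastAtMost)
  moreover have "{0..real N} \<union> {real N..real (Suc N)} = {0..real (Suc N)}" by auto
  ultimately show ?case by simp
qed simp

lemma path_fun_W_path:
  "path_fun (W_path R L U N x) = (\<lambda>t. if t \<in> {0..1} then W_at R L U N t x else 0)"
proof -
  have "continuous_on {0..1} (\<lambda>t. polygonal (q_xi R L x) (real N * t))"
    by (rule continuous_on_compose2[OF continuous_on_polygonal[of N]])
      (auto intro!: continuous_intros mult_left_le)
  from linear_continuous_on_compose[OF this matrix_vector_mul_linear[of "matrix_inv (sqrt_Phi R U)"]]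
  have "continuous_on {0..1} (\<lambda>t. W_at R L U N t x)"
    unfolding W_at_def by (intro continuous_on_scaleR continuous_on_const)
  then have "continuous_on {0..1} (\<lambda>t. if t \<in> {0..1} then W_at R L U N t x else 0)"
    by (rule continuous_on_eq) simp
  moreover have "W_at R L U N 0 x = 0"
    by (simp add: W_at_def polygonal_def q_xi_def)
  ultimately show ?thesis
    unfolding W_path_def by (subst Path_inverse) (auto simp: path0_set_def)
qed

text \<open>The description in \<open>freq_law\<close> is uniquely satisfied for the maps \<open>W_path R L U N\<close>
  with \<open>N \<ge> 1\<close> under the assumptions on \<open>L\<close> and \<open>R\<close>.\<close>

definition wiener_test_sets ::
  "(real^('r::finite \<times> 2)) path0 measure \<Rightarrow> (real^('r \<times> 2) \<Rightarrow> int^('r \<times> 2)) \<Rightarrow>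
   real^('r \<times> 2)^('r \<times> 2) \<Rightarrow> real^('r \<times> 2)^('r \<times> 2) \<Rightarrow> (real^('r \<times> 2)) path0 set set" where
  "wiener_test_sets W R L U = {B \<in> sets borel. measure W (frontier B) = 0 \<and>
     (\<forall>\<^sub>F N in sequentially. measure (freq_law (W_path R L U N)) (frontier B) = 0)}"

end

theory Submission
  imports Defs
begin

text \<open>By iterative nonresonance and Weyl's argument with geometric sums, the vectors
  \<open>L x, \<dots>, L\<^sup>N x\<close> are jointly equidistributed modulo the lattice over large boxes. Since the cell of the
  quantizer is a fundamental domain, each \<open>E\<^sub>k\<close> is, given the previous errors, a translate of an
  equidistributed torus point, so that in the sense of frequencies the errors are independent and
  uniformly distributed on the cell. Hence the law of the path is that of a polygonal path built from the
  independent bounded increments \<open>L\<^sup>-\<^sup>k (E\<^sub>k - \<mu>)\<close>. The rotations average their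
  covariances out to \<open>\<Phi>\<close>, and Donsker's theorem for such increments yields weak convergence: on a
  fixed grid by characteristic functions, uniformly between the grid points by a fourth moment maximal
  inequality. The portmanteau theorem transfers this to the test sets.\<close>

section \<open>Trigonometric polynomials and convergence of characteristic functions\<close>

text \<open>The two limits are never mixed. For fixed \<open>N\<close> the limit over boxes
  identifies the frequency law exactly as the law of a random path on a product space, and only this
  countably additive measure is sent to the Wiener measure. Frequencies are merely finitely
  additive, so on the lattice itself only uniform averages over finite boxes are used. The obstacle
  in the first limit is that an error is a discontinuous function of the torus point; a cutoff near
  the boundary of the cell restores continuity, and it costs little because this boundary is a null
  set. In the second limit the increments are independent but not identically distributed, and their
  covariances need not converge; only averages of them do. Weak convergence is tested on Lipschitz
  functions with values in \<open>[0, 1]\<close>, so that passing from a path to a polygon with few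
  nodes costs at most the Lipschitz constant times the uniform distance. Fourth moments are used
  because \<open>m\<close> blocks of length \<open>N / m\<close> then contribute
  \<open>m * (1 / m)^2\<close>, which vanishes as \<open>m\<close> grows.\<close>

inductive trig_poly :: "('x \<Rightarrow> real) set \<Rightarrow> ('x \<Rightarrow> complex) \<Rightarrow> bool" for \<Phi> where
  phase: "p \<in> \<Phi> \<Longrightarrow> trig_poly \<Phi> (\<lambda>x. c * iexp (p x))"
| add: "trig_poly \<Phi> f \<Longrightarrow> trig_poly \<Phi> g \<Longrightarrow> trig_poly \<Phi> (\<lambda>x. f x + g x)"

lemma trig_poly_mult:
  assumes "\<And>p q. p \<in> \<Phi> \<Longrightarrow> q \<in> \<Phi> \<Longrightarrow> (\<lambda>x. p x + q x) \<in> \<Phi>"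
    and "trig_poly \<Phi> f" "trig_poly \<Phi> g"
  shows "trig_poly \<Phi> (\<lambda>x. f x * g x)"
  using assms(2)
proof induction
  case (phase p c)
  show ?case
    using assms(3)
  proof induction
    case (phase q d)
    have "trig_poly \<Phi> (\<lambda>x. (c * d) * iexp (p x + q x))"
      by (intro trig_poly.phase assms(1) phase \<open>p \<in> \<Phi>\<close>)
    then show ?case by (simp add: exp_add ring_distribs mult_ac)
  next
    case (add f g)
    then show ?case by (simp add: ring_distribs trig_poly.add)
  qed
next
  case (add f g)
  then show ?case by (simp add: ring_distribs trig_poly.add)
qed

lemma trig_poly_sin:
  assumes "p \<in> \<Phi>" "(\<lambda>x. - p x) \<in> \<Phi>"
  shows "trig_poly \<Phi> (\<lambda>x. of_real (sin (p x)))"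
proof -
  have "trig_poly \<Phi> (\<lambda>x. 1 / (2 * \<i>) * iexp (p x) + (- 1 / (2 * \<i>)) * iexp (- p x))"
    by (intro trig_poly.intros assms)
  also have "(\<lambda>x. 1 / (2 * \<i>) * iexp (p x) + (- 1 / (2 * \<i>)) * iexp (- p x)) = (\<lambda>x. of_real (sin (p x)))"
    by (rule ext, simp only: sin_of_real[symmetric] sin_exp_eq) (simp add: field_simps)
  finally show ?thesis .
qed

lemma trig_poly_cos:
  assumes "p \<in> \<Phi>" "(\<lambda>x. - p x) \<in> \<Phi>"
  shows "trig_poly \<Phi> (\<lambda>x. of_real (cos (p x)))"
proof -
  have "trig_poly \<Phi> (\<lambda>x. 1 / 2 * iexp (p x) + 1 / 2 * iexp (- p x))"
    by (intro trig_poly.intros assms)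
  also have "(\<lambda>x. 1 / 2 * iexp (p x) + 1 / 2 * iexp (- p x)) = (\<lambda>x. of_real (cos (p x)))"
    by (rule ext, simp only: cos_of_real[symmetric] cos_exp_eq) (simp add: add_divide_distrib)
  finally show ?thesis .
qed

text \<open>Real Stone-Weierstrass on the compact set \<open>S\<close>, applied to the ring of
  functions whose pullback along \<open>\<sigma>\<close> is a trigonometric polynomial. The phases
  stay abstract because two cases occur: linear phases on a cube and lattice phases on the
  torus.\<close>

lemma trig_poly_approximation:
  fixes \<sigma> :: "'x \<Rightarrow> 's::t2_space" and G :: "'s \<Rightarrow> real"
  assumes "compact S" and \<sigma>: "\<And>x. \<sigma> x \<in> S"
    and zero: "(\<lambda>x. 0) \<in> \<Phi>" and plus: "\<And>p q. p \<in> \<Phi> \<Longrightarrow> q \<in> \<Phi> \<Longrightarrow> (\<lambda>x. p x + q x) \<in> \<Phi>"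
    and sep: "\<And>s t. s \<in> S \<Longrightarrow> t \<in> S \<Longrightarrow> s \<noteq> t \<Longrightarrow>
      \<exists>h. continuous_on S h \<and> trig_poly \<Phi> (\<lambda>x. of_real (h (\<sigma> x))) \<and> h s \<noteq> h t"
    and G: "continuous_on S G" and "e > 0"
  obtains f where "trig_poly \<Phi> f" "\<And>x. cmod (f x - of_real (G (\<sigma> x))) \<le> e"
proof -
  let ?R = "{h. continuous_on S h \<and> trig_poly \<Phi> (\<lambda>x. of_real (h (\<sigma> x)))}"
  interpret function_ring_on ?R S
  proof
    fix c :: real
    have "trig_poly \<Phi> (\<lambda>x. of_real c)"
      using trig_poly.phase[OF zero, of "of_real c"] by simp
    then show "(\<lambda>_. c) \<in> ?R" by simp
  qed (use \<open>compact S\<close> sep in \<open>auto intro: continuous_intros trig_poly.add trig_poly_mult[OF plus]\<close>)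
  obtain g where g: "g \<in> ?R" "\<forall>s\<in>S. \<bar>G s - g s\<bar> < e"
    using Stone_Weierstrass_basic[OF G \<open>e > 0\<close>] by blast
  show thesis
  proof
    show "trig_poly \<Phi> (\<lambda>x. of_real (g (\<sigma> x)))" using g by simp
    show "cmod (of_real (g (\<sigma> x)) - of_real (G (\<sigma> x))) \<le> e" for x
      using g(2) \<sigma>[of x] by (simp flip: of_real_diff) (metis abs_minus_commute less_imp_le)
  qed
qed

text \<open>Outside the exceptional event \<open>A\<close> the integrands are close; on
  \<open>A\<close> only the crude bounds are available, which costs their sum times the
  probability.\<close>

lemma (in prob_space) integral_approx:
  fixes f h :: "'a \<Rightarrow> 'b::{banach, second_countable_topology}"
  assumes f: "f \<in> borel_measurable M" and h: "h \<in> borel_measurable M"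
    and bd: "\<And>x. norm (f x) \<le> C" "\<And>x. norm (h x) \<le> C'" "C + C' \<le> c"
    and "A \<in> sets M" "prob A \<le> e" "0 \<le> d"
    and app: "\<And>x. x \<in> space M \<Longrightarrow> x \<notin> A \<Longrightarrow> norm (f x - h x) \<le> d"
  shows "norm (expectation f - expectation h) \<le> d + c * e"
proof -
  have c0: "0 \<le> c" using bd norm_ge_zero[of "f undefined"] norm_ge_zero[of "h undefined"]
    by (meson add_nonneg_nonneg order_trans)
  have [simp]: "integrable M f" "integrable M h"
    using integrable_const_bound[of f C] integrable_const_bound[of h C'] bd f h by auto
  have "expectation f - expectation h = expectation (\<lambda>x. f x - h x)" by simp
  also have "norm \<dots> \<le> expectation (\<lambda>x. norm (f x - h x))" by (rule integral_norm_bound)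
  also have "\<dots> \<le> expectation (\<lambda>x. d + c * indicator A x)"
  proof (rule integral_mono)
    show "integrable M (\<lambda>x. d + c * indicat_real A x)"
      using \<open>A \<in> sets M\<close> by (intro Bochner_Integration.integrable_add integrable_mult_right integrable_real_indicator)
        (auto simp: emeasure_eq_measure)
    show "norm (f x - h x) \<le> d + c * indicat_real A x" if "x \<in> space M" for x
    proof (cases "x \<in> A")
      case True
      have "norm (f x - h x) \<le> norm (f x) + norm (h x)" by (rule norm_triangle_ineq4)
      also have "\<dots> \<le> c" using bd(1,2)[of x] bd(3) by linarith
      finally show ?thesis using True \<open>0 \<le> d\<close> by simp
    qed (use app that in simp)
  qed simp
  also have "\<dots> = d + c * prob A"
    using \<open>A \<in> sets M\<close>
    by (subst Bochner_Integration.integral_add) (auto simp: prob_space emeasure_eq_measure intro!: integrable_mult_right integrable_real_indicator)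
  also have "\<dots> \<le> d + c * e" using \<open>prob A \<le> e\<close> c0 by (simp add: mult_left_mono)
  finally show ?thesis .
qed

text \<open>Tychonoff's theorem, with the coordinates outside \<open>J\<close> pinned to zero so
  that a cube of finite dimension is compact in the full function space.\<close>

lemma compact_finite_cube:
  "compact {s::'j \<Rightarrow> real. (\<forall>j\<in>J. s j \<in> {-1..1}) \<and> (\<forall>j. j \<notin> J \<longrightarrow> s j = 0)}" (is "compact ?S")
proof -
  have "?S = PiE UNIV (\<lambda>j. if j \<in> J then {-1..1} else {0})"
    by (auto simp: PiE_def Pi_def split: if_splits)
  moreover have "compactin (product_topology (\<lambda>_. euclidean) UNIV) (PiE UNIV (\<lambda>j. if j \<in> J then {-1..1::real} else {0}))"
    by (subst compactin_PiE) auto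
  ultimately show ?thesis
    by (simp add: euclidean_product_topology flip: compactin_euclidean_iff)
qed

text \<open>A continuous function on a cube extends to a periodic one through \<open>arcsin \<circ> sin\<close>, hence
  is a uniform limit on the cube of trigonometric polynomials that stay bounded outside of it.\<close>

lemma tendsto_integral_of_tendsto_char:
  fixes M :: "'i \<Rightarrow> 'a measure" and X :: "'i \<Rightarrow> 'a \<Rightarrow> 'j::countable \<Rightarrow> real"
    and N :: "'b measure" and Z :: "'b \<Rightarrow> 'j \<Rightarrow> real" and F :: "'i filter"
  assumes M: "\<And>i. prob_space (M i)" and N: "prob_space N" and J: "finite J"
    and X: "\<And>i j. j \<in> J \<Longrightarrow> (\<lambda>\<omega>. X i \<omega> j) \<in> borel_measurable (M i)"
    and Z: "\<And>j. j \<in> J \<Longrightarrow> (\<lambda>\<omega>. Z \<omega> j) \<in> borel_measurable N"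
    and char: "\<And>a. ((\<lambda>i. LINT \<omega>|M i. iexp (\<Sum>j\<in>J. a j * X i \<omega> j)) \<longlongrightarrow> (LINT \<omega>|N. iexp (\<Sum>j\<in>J. a j * Z \<omega> j))) F"
    and tight: "\<And>e. 0 < e \<Longrightarrow> \<exists>K>0. \<forall>\<^sub>F i in F. measure (M i) {\<omega>\<in>space (M i). \<exists>j\<in>J. \<bar>X i \<omega> j\<bar> > K} \<le> e"
    and g: "continuous_on UNIV g" and bd: "\<And>x. \<bar>g x\<bar> \<le> C" and dep: "\<And>x. g x = g (\<lambda>j. if j \<in> J then x j else 0)"
    and gX: "\<And>i. (\<lambda>\<omega>. g (X i \<omega>)) \<in> borel_measurable (M i)" and gZ: "(\<lambda>\<omega>. g (Z \<omega>)) \<in> borel_measurable N"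
  shows "((\<lambda>i. LINT \<omega>|M i. g (X i \<omega>)) \<longlongrightarrow> (LINT \<omega>|N. (g (Z \<omega>) :: real))) F"
proof (rule tendstoI)
  fix e :: real assume "e > 0"
  interpret N: prob_space N by fact
  have C0: "C \<ge> 0" using bd[of undefined] by linarith
  \<comment> \<open>The final estimate spends at most \<open>8 * d + 6 * C * d\<close>, which this
    choice keeps below \<open>e\<close>.\<close>
  define d where "d = e / (12 * C + 12)"
  have "d > 0" using C0 \<open>e > 0\<close> by (simp add: d_def)
  moreover have "e = 12 * d + 12 * (C * d)" using C0 by (simp add: d_def divide_simps) (simp add: algebra_simps)
  moreover have "C * d \<ge> 0" using C0 \<open>d > 0\<close> by simp
  ultimately have d: "d > 0" "2 * (d + 3 * (C + 1) * d) < e" by (auto simp: algebra_simps)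
  \<comment> \<open>The bound by 1 keeps the trigonometric polynomial below \<open>C + 1\<close>
    everywhere, also outside the cube.\<close>
  define d' where "d' = min 1 d"
  have d': "0 < d'" "d' \<le> 1" "d' \<le> d" using d by (auto simp: d'_def)
  obtain K0 where K0: "K0 > 0" "\<forall>\<^sub>F i in F. measure (M i) {\<omega>\<in>space (M i). \<exists>j\<in>J. \<bar>X i \<omega> j\<bar> > K0} \<le> d"
    using tight[OF d(1)] by auto
  \<comment> \<open>A single finite random vector is tight: its tail events decrease to the empty
    set.\<close>
  have "(\<lambda>n. measure N {\<omega>\<in>space N. \<exists>j\<in>J. \<bar>Z \<omega> j\<bar> > real n}) \<longlonglongrightarrow> measure N (\<Inter>n. {\<omega>\<in>space N. \<exists>j\<in>J. \<bar>Z \<omega> j\<bar> > real n})"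
  proof (rule N.finite_Lim_measure_decseq)
    show "range (\<lambda>n. {\<omega>\<in>space N. \<exists>j\<in>J. \<bar>Z \<omega> j\<bar> > real n}) \<subseteq> sets N"
      using Z J by (auto intro!: sets.sets_Collect_finite_Ex)
    show "decseq (\<lambda>n. {\<omega>\<in>space N. \<exists>j\<in>J. \<bar>Z \<omega> j\<bar> > real n})"
      by (auto simp: decseq_def) (meson le_less_trans of_nat_le_iff)
  qed
  also have "(\<Inter>n. {\<omega>\<in>space N. \<exists>j\<in>J. \<bar>Z \<omega> j\<bar> > real n}) = {}"
  proof -
    have "\<exists>n. \<forall>j\<in>J. \<bar>Z \<omega> j\<bar> \<le> real n" for \<omega>
    proof -
      obtain n where "(\<Sum>j\<in>J. \<bar>Z \<omega> j\<bar>) \<le> real n" using real_arch_simple by blast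
      then show ?thesis
        by (meson J abs_ge_zero member_le_sum order_trans)
    qed
    then show ?thesis by (auto simp: not_less) (meson not_less)
  qed
  finally have "(\<lambda>n. measure N {\<omega>\<in>space N. \<exists>j\<in>J. \<bar>Z \<omega> j\<bar> > real n}) \<longlonglongrightarrow> 0" by simp
  then have "\<forall>\<^sub>F n in sequentially. measure N {\<omega>\<in>space N. \<exists>j\<in>J. \<bar>Z \<omega> j\<bar> > real n} < d"
    by (rule order_tendstoD(2)) (rule d(1))
  then obtain n0 where n0: "\<And>n. n \<ge> n0 \<Longrightarrow> measure N {\<omega>\<in>space N. \<exists>j\<in>J. \<bar>Z \<omega> j\<bar> > real n} < d"
    unfolding eventually_sequentially by blast
  define K where "K = max K0 (real n0)"
  have K: "K > 0" "K0 \<le> K" "real n0 \<le> K" using K0 by (auto simp: K_def)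
  let ?S = "{s::'j \<Rightarrow> real. (\<forall>j\<in>J. s j \<in> {-1..1}) \<and> (\<forall>j. j \<notin> J \<longrightarrow> s j = 0)}"
  \<comment> \<open>The scaling carries \<open>[-K, K]\<close> onto \<open>[-pi/2, pi/2]\<close>,
    where \<open>arcsin\<close> inverts \<open>sin\<close>; on the cube \<open>E\<close> therefore
    recovers the point from \<open>\<sigma>\<close>.\<close>
  define \<sigma> :: "('j \<Rightarrow> real) \<Rightarrow> 'j \<Rightarrow> real" where "\<sigma> x j = (if j \<in> J then sin (pi / (2 * K) * x j) else 0)" for x j
  define E :: "('j \<Rightarrow> real) \<Rightarrow> 'j \<Rightarrow> real" where "E s j = (if j \<in> J then 2 * K / pi * arcsin (s j) else 0)" for s j
  define \<Phi> where "\<Phi> = {\<lambda>x::'j \<Rightarrow> real. \<Sum>j\<in>J. a j * x j | a. True}"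
  have ph: "(\<lambda>x. c * x j) \<in> \<Phi>" if "j \<in> J" for c j
  proof -
    have "(\<Sum>i\<in>J. (if i = j then c else 0) * x i) = c * x j" for x :: "'j \<Rightarrow> real"
      using that J by (simp add: if_distrib[of "\<lambda>u. u * _"] cong: if_cong)
    then show ?thesis unfolding \<Phi>_def by (intro CollectI exI[of _ "\<lambda>i. if i = j then c else 0"]) simp
  qed
  obtain f where f: "trig_poly \<Phi> f" "\<And>x. cmod (f x - of_real (g (E (\<sigma> x)))) \<le> d'"
  proof (rule trig_poly_approximation[of ?S \<sigma> \<Phi> "g \<circ> E" d'])
    show "compact ?S" by (rule compact_finite_cube)
    show "\<sigma> x \<in> ?S" for x by (auto simp: \<sigma>_def)
    show "(\<lambda>x. 0) \<in> \<Phi>" by (auto simp: \<Phi>_def intro!: exI[of _ "\<lambda>_. 0"])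
    show "(\<lambda>x. p x + q x) \<in> \<Phi>" if pq: "p \<in> \<Phi>" "q \<in> \<Phi>" for p q
    proof -
      obtain a b where "p = (\<lambda>x. \<Sum>j\<in>J. a j * x j)" "q = (\<lambda>x. \<Sum>j\<in>J. b j * x j)"
        using pq by (auto simp: \<Phi>_def)
      then show ?thesis unfolding \<Phi>_def
        by (intro CollectI exI[of _ "\<lambda>j. a j + b j"]) (auto simp: sum.distrib algebra_simps)
    qed
    show "\<exists>h. continuous_on ?S h \<and> trig_poly \<Phi> (\<lambda>x. of_real (h (\<sigma> x))) \<and> h s \<noteq> h t"
      if st: "s \<in> ?S" "t \<in> ?S" "s \<noteq> t" for s t
    proof -
      obtain j where j: "j \<in> J" "s j \<noteq> t j" using st by fastforce
      have "trig_poly \<Phi> (\<lambda>x. of_real (sin (pi / (2 * K) * x j)))"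
        using ph[OF j(1), of "pi / (2 * K)"] ph[OF j(1), of "- (pi / (2 * K))"] by (intro trig_poly_sin) simp_all
      then show ?thesis using j
        by (intro exI[of _ "\<lambda>s. s j"]) (auto simp: \<sigma>_def intro!: continuous_on_product_coordinates continuous_on_subset[OF continuous_on_product_coordinates])
    qed
    have "continuous_on ?S E"
    proof (rule continuous_on_coordinatewise_then_product)
      fix j
      show "continuous_on ?S (\<lambda>s. E s j)"
      proof (cases "j \<in> J")
        case True
        have "continuous_on ?S (\<lambda>s. s j)" by (rule continuous_on_subset[OF continuous_on_product_coordinates]) simp
        then have "continuous_on ?S (\<lambda>s. 2 * K / pi * arcsin (s j))"
          using True by (intro continuous_intros continuous_on_arcsin) auto
        then show ?thesis using True by (simp add: E_def)
      qed (simp add: E_def)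
    qed
    then show "continuous_on ?S (g \<circ> E)"
      by (intro continuous_on_compose continuous_on_subset[OF g]) auto
    show "d' > 0" by (rule d')
  qed simp
  have E\<sigma>: "g (E (\<sigma> x)) = g x" if "\<forall>j\<in>J. \<bar>x j\<bar> \<le> K" for x
  proof -
    have "E (\<sigma> x) j = x j" if "j \<in> J" for j
    proof -
      have "\<bar>pi / (2 * K) * x j\<bar> \<le> pi / 2"
        using that \<open>\<forall>j\<in>J. \<bar>x j\<bar> \<le> K\<close> K by (auto simp: abs_mult field_simps)
      then have "arcsin (sin (pi / (2 * K) * x j)) = pi / (2 * K) * x j"
        unfolding abs_le_iff by (intro arcsin_sin) linarith+
      then show ?thesis using that K by (simp add: E_def \<sigma>_def)
    qed
    then have "(\<lambda>j. if j \<in> J then E (\<sigma> x) j else 0) = (\<lambda>j. if j \<in> J then x j else 0)" by auto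
    then show ?thesis by (metis dep)
  qed
  have fbd: "cmod (f x) \<le> C + 1" for x
  proof -
    have "cmod (f x) \<le> cmod (f x - of_real (g (E (\<sigma> x)))) + cmod (of_real (g (E (\<sigma> x))))"
      by (metis diff_add_cancel norm_triangle_ineq)
    then show ?thesis using f(2)[of x] bd[of "E (\<sigma> x)"] d' by simp
  qed
  have meas: "(\<lambda>\<omega>. f (Y \<omega>)) \<in> borel_measurable M'"
    if "\<And>j. j \<in> J \<Longrightarrow> (\<lambda>\<omega>. Y \<omega> j) \<in> borel_measurable M'" for Y :: "'c \<Rightarrow> 'j \<Rightarrow> real" and M' :: "'c measure"
    using f(1)
  proof induction
    case (phase p c)
    then obtain a where "p = (\<lambda>x. \<Sum>j\<in>J. a j * x j)" by (auto simp: \<Phi>_def)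
    then have "(\<lambda>\<omega>. p (Y \<omega>)) \<in> borel_measurable M'" using that by simp
    then show ?case by measurable
  qed auto
  \<comment> \<open>\<open>f\<close> approximates the periodic extension everywhere but
    \<open>g\<close> itself only on the cube; the rare event of leaving the cube is charged the
    crude bound \<open>C + (C + 1)\<close>.\<close>
  have est: "cmod ((LINT \<omega>|M'. complex_of_real (g (Y \<omega>))) - (LINT \<omega>|M'. f (Y \<omega>))) \<le> d' + (2 * C + 1) * d"
    if "prob_space M'" and Y: "\<And>j. j \<in> J \<Longrightarrow> (\<lambda>\<omega>. Y \<omega> j) \<in> borel_measurable M'" 
      and gY: "(\<lambda>\<omega>. g (Y \<omega>)) \<in> borel_measurable M'"
      and "measure M' {\<omega>\<in>space M'. \<exists>j\<in>J. \<bar>Y \<omega> j\<bar> > K} \<le> d" for Y :: "'c \<Rightarrow> 'j \<Rightarrow> real" and M' :: "'c measure"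
  proof -
    interpret prob_space M' by fact
    have "{\<omega>\<in>space M'. \<exists>j\<in>J. \<bar>Y \<omega> j\<bar> > K} \<in> sets M'"
      using Y J by (auto intro!: sets.sets_Collect_finite_Ex)
    then show ?thesis
    proof (intro integral_approx[where C = C and C' = "C + 1"])
      fix x assume "x \<in> space M'" "x \<notin> {\<omega> \<in> space M'. \<exists>j\<in>J. K < \<bar>Y \<omega> j\<bar>}"
      then have "\<forall>j\<in>J. \<bar>Y x j\<bar> \<le> K" by (auto simp: not_less)
      from E\<sigma>[OF this] show "cmod (complex_of_real (g (Y x)) - f (Y x)) \<le> d'"
        using f(2)[of "Y x"] by (simp add: norm_minus_commute)
    qed (use that d' bd fbd meas[OF Y] in auto)
  qed
  have cont: "((\<lambda>i. LINT \<omega>|M i. f (X i \<omega>)) \<longlongrightarrow> (LINT \<omega>|N. f (Z \<omega>))) F \<and>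
     (\<forall>i. integrable (M i) (\<lambda>\<omega>. f (X i \<omega>))) \<and> integrable N (\<lambda>\<omega>. f (Z \<omega>))"
    using f(1)
  proof induction
    case (phase p c)
    then obtain a where p: "p = (\<lambda>x. \<Sum>j\<in>J. a j * x j)" by (auto simp: \<Phi>_def)
    have "integrable (M i) (\<lambda>\<omega>. iexp (\<Sum>j\<in>J. a j * X i \<omega> j))" for i
    proof -
      interpret prob_space "M i" by fact
      show ?thesis using X by (intro integrable_const_bound[of _ 1]) auto
    qed
    moreover have "integrable N (\<lambda>\<omega>. iexp (\<Sum>j\<in>J. a j * Z \<omega> j))"
      using Z by (intro N.integrable_const_bound[of _ 1]) auto
    ultimately show ?case unfolding p using char[of a] by (auto intro!: tendsto_mult_left)
  next
    case (add f g)
    then show ?case by (auto intro!: tendsto_add)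
  qed
  have "\<forall>\<^sub>F i in F. dist (LINT \<omega>|M i. f (X i \<omega>)) (LINT \<omega>|N. f (Z \<omega>)) < d"
    using cont d(1) by (auto dest: tendstoD)
  with K0(2) show "\<forall>\<^sub>F i in F. dist (LINT \<omega>|M i. g (X i \<omega>)) (LINT \<omega>|N. g (Z \<omega>)) < e"
  proof eventually_elim
    case (elim i)
    interpret prob_space "M i" by fact
    have "measure (M i) {\<omega>\<in>space (M i). \<exists>j\<in>J. \<bar>X i \<omega> j\<bar> > K} \<le> measure (M i) {\<omega>\<in>space (M i). \<exists>j\<in>J. \<bar>X i \<omega> j\<bar> > K0}"
      using X J K by (intro finite_measure_mono) (auto intro!: sets.sets_Collect_finite_Ex intro: le_less_trans)
    then have 1: "cmod ((LINT \<omega>|M i. complex_of_real (g (X i \<omega>))) - (LINT \<omega>|M i. f (X i \<omega>))) \<le> d' + (2 * C + 1) * d"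
      using elim by (intro est M X gX) auto
    have "measure N {\<omega>\<in>space N. \<exists>j\<in>J. \<bar>Z \<omega> j\<bar> > K} \<le> measure N {\<omega>\<in>space N. \<exists>j\<in>J. \<bar>Z \<omega> j\<bar> > real n0}"
      using Z J K by (intro N.finite_measure_mono) (auto intro!: sets.sets_Collect_finite_Ex intro: le_less_trans)
    then have 2: "cmod ((LINT \<omega>|N. complex_of_real (g (Z \<omega>))) - (LINT \<omega>|N. f (Z \<omega>))) \<le> d' + (2 * C + 1) * d"
      using n0[of n0] by (intro est N Z gZ) auto
    have "dist (LINT \<omega>|M i. complex_of_real (g (X i \<omega>))) (LINT \<omega>|N. complex_of_real (g (Z \<omega>)))
       \<le> (d' + (2 * C + 1) * d) + d + (d' + (2 * C + 1) * d)"
      using 1 2 elim(2) unfolding dist_norm by norm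
    also have "\<dots> \<le> 2 * (d + 3 * (C + 1) * d)"
      using d(1) d' mult_nonneg_nonneg[OF C0 less_imp_le[OF d(1)]] by (simp add: algebra_simps)
    also have "\<dots> < e" by fact
    finally show ?case by (simp add: dist_norm flip: of_real_diff)
  qed
qed

section \<open>Portmanteau theorem and uniqueness of distributions\<close>

definition closed_bump :: "'x::metric_space set \<Rightarrow> real \<Rightarrow> 'x \<Rightarrow> real" where
  "closed_bump C d x = max 0 (1 - infdist x C / d)"

lemma closed_bump_bounds: "0 < d \<Longrightarrow> 0 \<le> closed_bump C d x \<and> closed_bump C d x \<le> 1"
  by (simp add: closed_bump_def infdist_nonneg)

lemma lipschitz_closed_bump:
  assumes "d > 0"
  shows "\<bar>closed_bump C d x - closed_bump C d y\<bar> \<le> 1 / d * dist x y"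
proof -
  have "\<bar>closed_bump C d x - closed_bump C d y\<bar> \<le> \<bar>infdist x C / d - infdist y C / d\<bar>"
    unfolding closed_bump_def by linarith
  also have "\<dots> = \<bar>infdist x C - infdist y C\<bar> / d"
    using assms by (simp flip: diff_divide_distrib)
  also have "\<dots> \<le> dist x y / d"
    using assms infdist_triangle_abs[of x C y] by (intro divide_right_mono) auto
  finally show ?thesis by simp
qed

lemma lipschitz_imp_continuous_on:
  fixes f :: "'x::metric_space \<Rightarrow> 'y::metric_space"
  assumes "\<And>x y. dist (f x) (f y) \<le> L * dist x y"
  shows "continuous_on S f"
proof (rule continuous_on_subset[OF lipschitz_on_continuous_on])
  have "dist (f x) (f y) \<le> max L 0 * dist x y" for x y
    by (rule order_trans[OF assms]) (simp add: mult_right_mono)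
  then show "(max L 0)-lipschitz_on UNIV f" by (auto simp: lipschitz_on_def)
qed simp

text \<open>The bumps converge pointwise to the indicator of a closed set. The empty set is excluded
  because \<open>infdist\<close> to it is 0, which would make every bump equal to 1.\<close>

lemma integral_closed_bump_tendsto:
  fixes D :: "'x::metric_space measure"
  assumes "prob_space D" and [measurable_cong]: "sets D = sets borel" and "closed C" "C \<noteq> {}"
  shows "(\<lambda>n. LINT x|D. closed_bump C (1 / real (Suc n)) x) \<longlonglongrightarrow> measure D C"
proof -
  interpret prob_space D by fact
  have [measurable]: "C \<in> sets D" using assms by auto
  have "(\<lambda>n. LINT x|D. closed_bump C (1 / real (Suc n)) x) \<longlonglongrightarrow> (LINT x|D. indicat_real C x)"
  proof (rule integral_dominated_convergence[where w = "\<lambda>_. 1"])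
    show "AE x in D. (\<lambda>n. closed_bump C (1 / real (Suc n)) x) \<longlonglongrightarrow> indicat_real C x"
    proof (rule AE_I2)
      fix x
      show "(\<lambda>n. closed_bump C (1 / real (Suc n)) x) \<longlonglongrightarrow> indicat_real C x"
      proof (cases "x \<in> C")
        case False
        then have "infdist x C > 0"
          using assms in_closed_iff_infdist_zero infdist_nonneg by (metis less_le)
        then obtain k where k: "1 / infdist x C < real k" using reals_Archimedean2 by blast
        have "closed_bump C (1 / real (Suc n)) x = 0" if "n \<ge> k" for n
        proof -
          have "1 / infdist x C < real (Suc n)" using k that by linarith
          then have "1 < real (Suc n) * infdist x C"
            using \<open>infdist x C > 0\<close> by (simp add: divide_less_eq)
          then show ?thesis by (simp add: closed_bump_def mult.commute)
        qed
        then have "eventually (\<lambda>n. closed_bump C (1 / real (Suc n)) x = indicat_real C x) sequentially"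
          using False by (auto simp: eventually_sequentially)
        then show ?thesis by (rule tendsto_eventually)
      qed (simp add: closed_bump_def)
    qed
    show "AE x in D. norm (closed_bump C (1 / real (Suc n)) x) \<le> 1" for n
      using closed_bump_bounds[of "1 / real (Suc n)" C] by auto
    have "continuous_on UNIV (closed_bump C (1 / real (Suc n)))" for n
      by (rule lipschitz_imp_continuous_on[where L = "real (Suc n)"])
        (use lipschitz_closed_bump[of "1 / real (Suc n)" C] in \<open>simp add: dist_real_def\<close>)
    then show "closed_bump C (1 / real (Suc n)) \<in> borel_measurable D" for n
      using assms(2) by (simp add: borel_measurable_continuous_onI cong: measurable_cong_sets)
  qed auto
  then show ?thesis by simp
qed

text \<open>The indicator of \<open>C\<close> lies below a Lipschitz bump whose integral under
  \<open>D\<close> exceeds the mass of \<open>C\<close> by less than \<open>e\<close>.\<close>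

lemma eventually_prob_closed_le:
  fixes M :: "'i \<Rightarrow> 'a measure" and X :: "'i \<Rightarrow> 'a \<Rightarrow> 'x::metric_space" and D :: "'x measure"
  assumes M: "\<And>i. prob_space (M i)" and X: "\<And>i. X i \<in> borel_measurable (M i)"
    and D: "prob_space D" "sets D = sets borel"
    and conv: "\<And>g L. (\<And>x. 0 \<le> g x \<and> g x \<le> 1) \<Longrightarrow> (\<And>x y. \<bar>g x - g y\<bar> \<le> L * dist x y) \<Longrightarrow>
      ((\<lambda>i. LINT \<omega>|M i. g (X i \<omega>)) \<longlongrightarrow> (LINT x|D. (g x :: real))) F"
    and "closed C" "e > 0"
  shows "\<forall>\<^sub>F i in F. measure (M i) {\<omega>\<in>space (M i). X i \<omega> \<in> C} < measure D C + e"
proof (cases "C = {}")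
  case False
  have "eventually (\<lambda>n. (LINT x|D. closed_bump C (1 / real (Suc n)) x) < measure D C + e) sequentially"
    using integral_closed_bump_tendsto[OF D \<open>closed C\<close> False] \<open>e > 0\<close> by (intro order_tendstoD(2)) auto
  then obtain n where n: "(LINT x|D. closed_bump C (1 / real (Suc n)) x) < measure D C + e"
    by (auto simp: eventually_sequentially)
  let ?g = "closed_bump C (1 / real (Suc n))"
  have "((\<lambda>i. LINT \<omega>|M i. ?g (X i \<omega>)) \<longlongrightarrow> (LINT x|D. ?g x)) F"
    using closed_bump_bounds[of "1 / real (Suc n)" C] lipschitz_closed_bump[of "1 / real (Suc n)" C]
    by (intro conv) auto
  then have "\<forall>\<^sub>F i in F. (LINT \<omega>|M i. ?g (X i \<omega>)) < measure D C + e"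
    using n by (rule order_tendstoD)
  then show ?thesis
  proof eventually_elim
    case (elim i)
    interpret prob_space "M i" by fact
    note [measurable] = X[of i]
    have [measurable]: "C \<in> sets borel" using \<open>closed C\<close> by auto
    have "continuous_on UNIV ?g"
      by (rule lipschitz_imp_continuous_on[where L = "real (Suc n)"])
        (use lipschitz_closed_bump[of "1 / real (Suc n)" C] in \<open>simp add: dist_real_def\<close>)
    then have [measurable]: "?g \<in> borel_measurable borel" by (rule borel_measurable_continuous_onI)
    have "measure (M i) {\<omega>\<in>space (M i). X i \<omega> \<in> C} = (LINT \<omega>|M i. indicat_real {\<omega>\<in>space (M i). X i \<omega> \<in> C} \<omega>)"
      by simp
    also have "\<dots> \<le> (LINT \<omega>|M i. ?g (X i \<omega>))"
    proof (rule integral_mono)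
      show "integrable (M i) (indicat_real {\<omega> \<in> space (M i). X i \<omega> \<in> C})"
        by (intro integrable_real_indicator) (auto simp: emeasure_eq_measure)
      have "(\<lambda>\<omega>. ?g (X i \<omega>)) \<in> borel_measurable (M i)" by measurable
      then show "integrable (M i) (\<lambda>\<omega>. ?g (X i \<omega>))"
        using closed_bump_bounds[of "1 / real (Suc n)" C] by (intro integrable_const_bound[of _ 1]) simp_all
      show "indicat_real {\<omega> \<in> space (M i). X i \<omega> \<in> C} \<omega> \<le> ?g (X i \<omega>)" if "\<omega> \<in> space (M i)" for \<omega>
        using that closed_bump_bounds[of "1 / real (Suc n)" C] by (auto simp: indicator_def closed_bump_def)
    qed
    also note elim
    finally show ?case .
  qed
qed (use \<open>e > 0\<close> in simp)

text \<open>The one-sided estimate for closed sets is applied to the closures of \<open>B\<close>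
  and of its complement; as the frontier is null, both bounds meet at the mass of \<open>B\<close>.
  The filter is arbitrary because the result serves both for growing boxes and for \<open>N\<close>
  tending to infinity.\<close>

proposition portmanteau:
  fixes M :: "'i \<Rightarrow> 'a measure" and X :: "'i \<Rightarrow> 'a \<Rightarrow> 'x::metric_space" and D :: "'x measure"
  assumes M: "\<And>i. prob_space (M i)" and X: "\<And>i. X i \<in> borel_measurable (M i)"
    and D: "prob_space D" "sets D = sets borel"
    and conv: "\<And>g L. (\<And>x. 0 \<le> g x \<and> g x \<le> 1) \<Longrightarrow> (\<And>x y. \<bar>g x - g y\<bar> \<le> L * dist x y) \<Longrightarrow>
      ((\<lambda>i. LINT \<omega>|M i. g (X i \<omega>)) \<longlongrightarrow> (LINT x|D. (g x :: real))) F"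
    and B: "B \<in> sets borel" "measure D (frontier B) = 0"
  shows "((\<lambda>i. measure (M i) {\<omega>\<in>space (M i). X i \<omega> \<in> B}) \<longlongrightarrow> measure D B) F"
proof (rule tendstoI)
  fix e :: real assume "e > 0"
  interpret D: prob_space D by fact
  have meas: "S \<in> sets D" if "S \<in> sets borel" for S using that D by simp
  have "measure D (interior B \<union> frontier B) = measure D (interior B)"
    using B meas by (subst measure_Un_null_set) (auto simp: null_sets_def D.emeasure_eq_measure intro: borel_closed)
  moreover have "interior B \<union> frontier B = closure B"
    using interior_subset closure_subset by (auto simp: frontier_def)
  ultimately have eq: "measure D (closure B) = measure D (interior B)" by simp
  have "measure D (interior B) \<le> measure D B" "measure D B \<le> measure D (closure B)"
    using B meas by (auto intro!: D.finite_measure_mono interior_subset closure_subset)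
  with eq have eq': "measure D (closure B) = measure D B" "measure D (interior B) = measure D B" by auto
  have compl: "measure D (closure (- B)) = 1 - measure D B"
  proof -
    have "closure (- B) = space D - interior B" using sets_eq_imp_space_eq[OF D(2)] by (auto simp: closure_complement)
    then show ?thesis using D.prob_compl[of "interior B"] meas eq' by auto
  qed
  have "\<forall>\<^sub>F i in F. measure (M i) {\<omega>\<in>space (M i). X i \<omega> \<in> closure (- B)} < measure D (closure (- B)) + e"
    by (rule eventually_prob_closed_le[OF M X D conv]) (use \<open>e > 0\<close> in auto)
  moreover have "\<forall>\<^sub>F i in F. measure (M i) {\<omega>\<in>space (M i). X i \<omega> \<in> closure B} < measure D (closure B) + e"
    by (rule eventually_prob_closed_le[OF M X D conv]) (use \<open>e > 0\<close> in auto)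
  ultimately show "\<forall>\<^sub>F i in F. dist (measure (M i) {\<omega>\<in>space (M i). X i \<omega> \<in> B}) (measure D B) < e"
  proof eventually_elim
    case (elim i)
    interpret prob_space "M i" by fact
    have m: "{\<omega>\<in>space (M i). X i \<omega> \<in> S} \<in> sets (M i)" if "S \<in> sets borel" for S
      using measurable_sets[OF X that, of i] by (simp add: vimage_def Int_def conj_commute)
    have "measure (M i) {\<omega>\<in>space (M i). X i \<omega> \<in> B} \<le> measure (M i) {\<omega>\<in>space (M i). X i \<omega> \<in> closure B}"
      using closure_subset by (intro finite_measure_mono m) auto
    moreover have "measure (M i) (space (M i) - {\<omega>\<in>space (M i). X i \<omega> \<in> B}) \<le> measure (M i) {\<omega>\<in>space (M i). X i \<omega> \<in> closure (- B)}"
      using closure_subset[of "- B"] by (intro finite_measure_mono m) auto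
    ultimately show ?case
      using elim compl prob_compl[OF m[OF B(1)]] eq' by (auto simp: dist_real_def)
  qed
qed

text \<open>The frontiers of the closed neighbourhoods \<open>{x. infdist x C \<le> d}\<close> of a closed set \<open>C\<close>
  are disjoint for different \<open>d\<close>, so almost all of them are null sets of both measures.\<close>

lemma borel_prob_eqI:
  fixes D D' :: "'x::metric_space measure"
  assumes D: "prob_space D" "sets D = sets borel" and D': "prob_space D'" "sets D' = sets borel"
    and eq: "\<And>B. B \<in> sets borel \<Longrightarrow> measure D (frontier B) = 0 \<Longrightarrow> measure D' (frontier B) = 0 \<Longrightarrow>
      measure D B = measure D' B"
  shows "D = D'"
proof -
  interpret D: prob_space D by fact
  interpret D': prob_space D' by fact
  have closed_eq: "measure D C = measure D' C" if C: "closed C" "C \<noteq> {}" for C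
  proof -
    let ?N = "\<lambda>d. {x. infdist x C \<le> d}"
    have cl: "closed (?N d)" for d
      by (intro closed_Collect_le continuous_intros)
    have fr: "frontier (?N d) \<subseteq> {x. infdist x C = d}" for d
    proof -
      have "open {x. infdist x C < d}" by (intro open_Collect_less continuous_intros)
      then have "{x. infdist x C < d} \<subseteq> interior (?N d)" by (intro interior_maximal) auto
      moreover have "closure (?N d) = ?N d" using cl by simp
      ultimately show ?thesis by (force simp: frontier_def)
    qed
    have sl: "{x. infdist x C = d} \<in> sets borel" for d
      by (intro borel_closed closed_Collect_eq continuous_intros)
    have count: "countable {d. measure E {x. infdist x C = d} \<noteq> 0}"
      if "prob_space E" "sets E = sets borel" for E :: "'x measure"
    proof -
      interpret prob_space E by fact
      have m: "(\<lambda>x. infdist x C) \<in> borel_measurable E"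
        unfolding measurable_cong_sets[OF that(2) refl]
        by (intro borel_measurable_continuous_onI continuous_intros)
      interpret R: prob_space "distr E borel (\<lambda>x. infdist x C)" by (rule prob_space_distr[OF m])
      have "countable {d. measure (distr E borel (\<lambda>x. infdist x C)) {d} \<noteq> 0}"
        by (rule R.countable_support)
      also have "(\<lambda>d. measure (distr E borel (\<lambda>x. infdist x C)) {d}) = (\<lambda>d. measure E {x. infdist x C = d})"
        using sets_eq_imp_space_eq[OF that(2)] by (auto simp: measure_distr[OF m] vimage_def)
      finally show ?thesis .
    qed
    let ?bad = "{d. measure D {x. infdist x C = d} \<noteq> 0} \<union> {d. measure D' {x. infdist x C = d} \<noteq> 0}"
    have "countable ?bad" using count[OF D] count[OF D'] by simp
    have "\<exists>d. 0 < d \<and> d < 1 / real (Suc n) \<and> d \<notin> ?bad" for n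
    proof -
      have "uncountable {0<..<1 / real (Suc n)}" by (simp add: uncountable_open_interval)
      then have "\<not> {0<..<1 / real (Suc n)} \<subseteq> ?bad" using \<open>countable ?bad\<close> countable_subset by blast
      then show ?thesis by auto
    qed
    then obtain d where d: "\<And>n. 0 < d n \<and> d n < 1 / real (Suc n) \<and> d n \<notin> ?bad" by metis
    have d0: "d \<longlonglongrightarrow> 0"
      by (rule tendsto_sandwich[OF _ _ tendsto_const LIMSEQ_inverse_real_of_nat])
        (use d in \<open>auto intro!: always_eventually less_imp_le simp: inverse_eq_divide\<close>)
    have same: "measure D (?N (d n)) = measure D' (?N (d n))" for n
    proof (rule eq)
      have "measure D (frontier (?N (d n))) \<le> measure D {x. infdist x C = d n}"
        using sl D by (intro D.finite_measure_mono fr) auto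
      then show "measure D (frontier (?N (d n))) = 0" using d[of n] measure_nonneg[of D] by (auto intro: antisym)
      have "measure D' (frontier (?N (d n))) \<le> measure D' {x. infdist x C = d n}"
        using sl D' by (intro D'.finite_measure_mono fr) auto
      then show "measure D' (frontier (?N (d n))) = 0" using d[of n] measure_nonneg[of D'] by (auto intro: antisym)
    qed (use cl in auto)
    have lim: "(\<lambda>n. measure E (?N (d n))) \<longlonglongrightarrow> measure E C" if "prob_space E" "sets E = sets borel" for E :: "'x measure"
    proof -
      interpret prob_space E by fact
      have "(\<lambda>n. LINT x|E. indicat_real (?N (d n)) x) \<longlonglongrightarrow> (LINT x|E. indicat_real C x)"
      proof (rule integral_dominated_convergence[where w = "\<lambda>_. 1"])
        show "AE x in E. (\<lambda>n. indicat_real (?N (d n)) x) \<longlonglongrightarrow> indicat_real C x"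
        proof (rule AE_I2)
          fix x
          show "(\<lambda>n. indicat_real (?N (d n)) x) \<longlonglongrightarrow> indicat_real C x"
          proof (cases "x \<in> C")
            case True
            then have "x \<in> ?N (d n)" for n using d[of n] by simp
            then show ?thesis using True by simp
          next
            case False
            then have "infdist x C > 0"
              using C in_closed_iff_infdist_zero infdist_nonneg by (metis less_le)
            then have "\<forall>\<^sub>F n in sequentially. d n < infdist x C" using d0 by (rule order_tendstoD(2)[rotated])
            then have "\<forall>\<^sub>F n in sequentially. indicat_real (?N (d n)) x = indicat_real C x"
              by eventually_elim (use False in auto)
            then show ?thesis by (rule tendsto_eventually)
          qed
        qed
        show "indicat_real C \<in> borel_measurable E" "\<And>n. indicat_real (?N (d n)) \<in> borel_measurable E"
          using cl C that(2) by (auto intro!: borel_measurable_indicator)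
      qed (auto simp: indicator_def)
      then show ?thesis using sets_eq_imp_space_eq[OF that(2)] by simp
    qed
    show ?thesis using lim[OF D] lim[OF D'] same by (simp add: LIMSEQ_unique)
  qed
  show ?thesis
  proof (rule measure_eqI_generator_eq[where E = "Collect closed" and \<Omega> = UNIV and A = "\<lambda>_. UNIV"])
    show "emeasure D X = emeasure D' X" if "X \<in> Collect closed" for X
      using that closed_eq[of X] by (cases "X = {}") (auto simp: D.emeasure_eq_measure D'.emeasure_eq_measure)
    show "sets D = sigma_sets UNIV (Collect closed)" "sets D' = sigma_sets UNIV (Collect closed)"
      using D D' by (simp_all add: borel_eq_closed)
  qed (auto intro: Int_stableI)
qed

section \<open>Frequencies as limits of averages over boxes\<close>

text \<open>Lower and upper frequency are the limits inferior and superior of box densities along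
  this filter, so a frequency can be computed by ordinary limit rules.\<close>

definition boxes_at_top :: "(int^'n) set filter" where
  "boxes_at_top = (INF N. principal (lattice_boxes N))"

definition box_avg :: "(int^'n) set \<Rightarrow> (int^'n \<Rightarrow> 'b::real_normed_vector) \<Rightarrow> 'b" where
  "box_avg P f = (\<Sum>x\<in>P. f x) /\<^sub>R real (card P)"

text \<open>Requiring \<open>N \<ge> 1\<close> excludes empty boxes, whose density would be a
  quotient by zero.\<close>

lemma eventually_boxes_at_top:
  "eventually Q (boxes_at_top :: (int^'n) set filter) \<longleftrightarrow> (\<exists>N\<ge>1. \<forall>P\<in>lattice_boxes N. Q P)"
proof -
  have "eventually Q (boxes_at_top :: (int^'n) set filter) \<longleftrightarrow> (\<exists>N. eventually Q (principal (lattice_boxes N)))"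
    unfolding boxes_at_top_def
  proof (subst eventually_INF_base)
    fix a b :: nat
    have "lattice_boxes (max a b) \<subseteq> (lattice_boxes a \<inter> lattice_boxes b :: (int^'n) set set)"
      by (fastforce simp: lattice_boxes_def)
    then show "\<exists>x\<in>UNIV. principal (lattice_boxes x :: (int^'n) set set) \<le> inf (principal (lattice_boxes a)) (principal (lattice_boxes b))"
      by auto
  qed simp_all
  also have "\<dots> \<longleftrightarrow> (\<exists>N\<ge>1. \<forall>P\<in>lattice_boxes N. Q P)"
  proof safe
    fix N assume "eventually Q (principal (lattice_boxes N))"
    moreover have "lattice_boxes (max 1 N) \<subseteq> (lattice_boxes N :: (int^'n) set set)"
      by (fastforce simp: lattice_boxes_def)
    ultimately show "\<exists>N\<ge>1. \<forall>P\<in>lattice_boxes N. Q P"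
      by (intro exI[of _ "max 1 N"]) (auto simp: eventually_principal)
  qed (auto simp: eventually_principal)
  finally show ?thesis .
qed

lemma lattice_boxes_nonempty: "lattice_boxes N \<noteq> {}"
proof -
  have "lattice_box 0 (\<chi> k. N) \<in> lattice_boxes N" unfolding lattice_boxes_def by force
  then show ?thesis by blast
qed

lemma lattice_box_bij:
  "bij_betw vec_lambda (PiE UNIV (\<lambda>k. {a $ k..<a $ k + int (l $ k)})) (lattice_box a l)"
proof (rule bij_betwI)
  show "vec_lambda \<in> PiE UNIV (\<lambda>k. {a $ k..<a $ k + int (l $ k)}) \<rightarrow> lattice_box a l"
    by (auto simp: lattice_box_def PiE_def Pi_def)
  show "vec_nth \<in> lattice_box a l \<rightarrow> PiE UNIV (\<lambda>k. {a $ k..<a $ k + int (l $ k)})"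
    by (auto simp: lattice_box_def)
qed auto

lemma card_lattice_box: "card (lattice_box a l) = (\<Prod>k\<in>UNIV. l $ k)"
  unfolding bij_betw_same_card[OF lattice_box_bij, symmetric] by (simp add: card_PiE)

lemma lattice_boxes_finite_nonempty:
  assumes "P \<in> lattice_boxes N" "N \<ge> 1"
  shows "finite P" "P \<noteq> {}" "card P > 0"
proof -
  obtain a l where P: "P = lattice_box a l" "\<forall>k. N \<le> l $ k" using assms by (auto simp: lattice_boxes_def)
  then have "\<forall>k. 0 < l $ k" using assms(2) by (meson less_le_trans zero_less_one)
  then have "card P > 0" using P by (simp add: card_lattice_box prod_pos)
  then show "finite P" "P \<noteq> {}" "card P > 0" using card_gt_0_iff by blast+
qed

text \<open>If all large boxes have density within \<open>e\<close> of \<open>p\<close>, so do the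
  infimum and supremum over them. For the opposite inequalities, each family
  \<open>lattice_boxes N\<close> contains boxes as large as desired.\<close>

lemma freq_of_tendsto:
  assumes "((\<lambda>P. real (card (A \<inter> P)) / real (card P)) \<longlongrightarrow> p) boxes_at_top"
  shows "freq_measurable A" "freq A = p"
proof -
  let ?f = "\<lambda>P. real (card (A \<inter> P)) / real (card P)"
  have f01: "0 \<le> ?f P \<and> ?f P \<le> 1" if "P \<in> lattice_boxes N" "N \<ge> 1" for P N
    using lattice_boxes_finite_nonempty[OF that] by (auto intro!: divide_le_eq_1[THEN iffD2] card_mono)
  have bdd: "bdd_below (?f ` lattice_boxes N)" "bdd_above (?f ` lattice_boxes N)" if "N \<ge> 1" for N
    using f01[OF _ that] by (auto intro!: bdd_belowI2[where m = 0] bdd_aboveI2[where M = 1])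
  have I01: "(INF P\<in>lattice_boxes N. ?f P) \<le> 1" "0 \<le> (SUP P\<in>lattice_boxes N. ?f P)"
    "(INF P\<in>lattice_boxes N. ?f P) \<le> (SUP P\<in>lattice_boxes N. ?f P)" if "N \<ge> 1" for N
  proof -
    obtain P where P: "P \<in> (lattice_boxes N :: (int^'a) set set)" using lattice_boxes_nonempty by blast
    have "(INF P\<in>lattice_boxes N. ?f P) \<le> ?f P" "?f P \<le> (SUP P\<in>lattice_boxes N. ?f P)"
      using bdd[OF that] P by (auto intro: cINF_lower cSUP_upper)
    then show "(INF P\<in>lattice_boxes N. ?f P) \<le> 1" "0 \<le> (SUP P\<in>lattice_boxes N. ?f P)"
      "(INF P\<in>lattice_boxes N. ?f P) \<le> (SUP P\<in>lattice_boxes N. ?f P)" using f01[OF P that] by linarith+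
  qed
  have near: "\<exists>N\<ge>1. \<forall>P\<in>lattice_boxes N. \<bar>?f P - p\<bar> < e" if "e > 0" for e
    using tendstoD[OF assms that] by (simp add: eventually_boxes_at_top dist_real_def)
  have le: "p - e \<le> lower_freq A" "upper_freq A \<le> p + e" if e: "e > 0" for e
  proof -
    obtain N where N: "N \<ge> 1" "\<forall>P\<in>lattice_boxes N. \<bar>?f P - p\<bar> < e" using near[OF e] by auto
    have "p - e \<le> (INF P\<in>lattice_boxes N. ?f P)"
      using N(2) by (intro cINF_greatest lattice_boxes_nonempty) (auto simp: abs_less_iff less_imp_le)
    also have "\<dots> \<le> lower_freq A" unfolding lower_freq_def
      using N I01 by (intro cSUP_upper) (auto intro!: bdd_aboveI2[where M = 1])
    finally show "p - e \<le> lower_freq A" .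
    have "upper_freq A \<le> (SUP P\<in>lattice_boxes N. ?f P)" unfolding upper_freq_def
      using N I01 by (intro cINF_lower) (auto intro!: bdd_belowI2[where m = 0])
    also have "\<dots> \<le> p + e"
    proof (rule cSUP_least[OF lattice_boxes_nonempty])
      fix P assume "P \<in> (lattice_boxes N :: (int^'a) set set)"
      then have "\<bar>?f P - p\<bar> < e" using N(2) by blast
      then show "?f P \<le> p + e" by linarith
    qed
    finally show "upper_freq A \<le> p + e" .
  qed
  have ge: "lower_freq A \<le> p" 
    unfolding lower_freq_def
  proof (rule cSUP_least)
    fix N :: nat assume "N \<in> {1..}"
    then have "1 \<le> N" by simp
    show "(INF P\<in>lattice_boxes N. ?f P) \<le> p"
    proof (rule field_le_epsilon)
      fix e :: real assume "e > 0"
      obtain M where M: "M \<ge> 1" "\<forall>P\<in>lattice_boxes M. \<bar>?f P - p\<bar> < e" using near[OF \<open>e > 0\<close>] by auto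
      obtain P where P: "P \<in> (lattice_boxes (max M N) :: (int^'a) set set)" using lattice_boxes_nonempty by blast
      then have "P \<in> lattice_boxes M" "P \<in> lattice_boxes N" by (fastforce simp: lattice_boxes_def)+
      then have "(INF P\<in>lattice_boxes N. ?f P) \<le> ?f P" "\<bar>?f P - p\<bar> < e"
        using bdd[OF \<open>1 \<le> N\<close>] M by (auto intro: cINF_lower)
      then show "(INF P\<in>lattice_boxes N. ?f P) \<le> p + e" by linarith
    qed
  qed auto
  have ge': "p \<le> upper_freq A"
    unfolding upper_freq_def
  proof (rule cINF_greatest)
    fix N :: nat assume "N \<in> {1..}"
    then have "1 \<le> N" by simp
    show "p \<le> (SUP P\<in>lattice_boxes N. ?f P)"
    proof (rule field_le_epsilon)
      fix e :: real assume "e > 0"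
      obtain M where M: "M \<ge> 1" "\<forall>P\<in>lattice_boxes M. \<bar>?f P - p\<bar> < e" using near[OF \<open>e > 0\<close>] by auto
      obtain P where P: "P \<in> (lattice_boxes (max M N) :: (int^'a) set set)" using lattice_boxes_nonempty by blast
      then have "P \<in> lattice_boxes M" "P \<in> lattice_boxes N" by (fastforce simp: lattice_boxes_def)+
      then have "?f P \<le> (SUP P\<in>lattice_boxes N. ?f P)" "\<bar>?f P - p\<bar> < e"
        using bdd[OF \<open>1 \<le> N\<close>] M by (auto intro: cSUP_upper)
      then show "p \<le> (SUP P\<in>lattice_boxes N. ?f P) + e" by linarith
    qed
  qed auto
  have "p \<le> lower_freq A" "upper_freq A \<le> p"
    using le by (meson field_le_epsilon diff_le_eq)+
  with ge ge' have "lower_freq A = p" "upper_freq A = p" by auto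
  then show "freq_measurable A" "freq A = p" by (auto simp: freq_measurable_def freq_def)
qed

text \<open>Box averages become expectations under the uniform distribution on the box, so that
  results about probability spaces apply along the filter of boxes.\<close>

lemma integral_pmf_of_box:
  fixes f :: "int^'n \<Rightarrow> 'b::{banach, second_countable_topology}"
  assumes "finite P" "P \<noteq> {}"
  shows "(LINT x|measure_pmf (pmf_of_set P). f x) = box_avg P f"
proof -
  have "(LINT x|measure_pmf (pmf_of_set P). f x) = (\<Sum>x\<in>P. pmf (pmf_of_set P) x *\<^sub>R f x)"
    using assms by (intro integral_measure_pmf) auto
  then show ?thesis using assms by (simp add: box_avg_def scaleR_sum_right divide_inverse)
qed

lemma eventually_box_finite_nonempty: "\<forall>\<^sub>F P in boxes_at_top. finite P \<and> P \<noteq> {}"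
  unfolding eventually_boxes_at_top using lattice_boxes_finite_nonempty by (intro exI[of _ 1]) blast

text \<open>The portmanteau theorem for uniform distributions on growing boxes turns convergence of
  averages of Lipschitz functions into frequencies of sets.\<close>

proposition freq_distributedI:
  fixes h :: "int^'n \<Rightarrow> 'x::metric_space"
  assumes D: "prob_space D" "sets D = sets borel"
    and conv: "\<And>g L. (\<And>x. 0 \<le> g x \<and> g x \<le> 1) \<Longrightarrow> (\<And>x y. \<bar>g x - g y\<bar> \<le> L * dist x y) \<Longrightarrow>
      ((\<lambda>P. box_avg P (\<lambda>x. g (h x))) \<longlongrightarrow> (LINT x|D. (g x :: real))) boxes_at_top"
  shows "freq_distributed D h"
  unfolding freq_distributed_def
proof (intro conjI ballI impI D)
  fix B :: "'x set" assume B: "B \<in> sets borel" "measure D (frontier B) = 0"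
  have *: "((\<lambda>P. measure (measure_pmf (pmf_of_set P)) {x\<in>space (measure_pmf (pmf_of_set P)). h x \<in> B}) \<longlongrightarrow> measure D B) boxes_at_top"
  proof (rule portmanteau[OF _ _ D _ B])
    fix g :: "'x \<Rightarrow> real" and L
    assume "\<And>x. 0 \<le> g x \<and> g x \<le> 1" "\<And>x y. \<bar>g x - g y\<bar> \<le> L * dist x y"
    from conv[OF this] show "((\<lambda>P. LINT x|measure_pmf (pmf_of_set P). g (h x)) \<longlongrightarrow> (LINT x|D. g x)) boxes_at_top"
      by (rule Lim_transform_eventually)
        (use eventually_box_finite_nonempty in eventually_elim, simp add: integral_pmf_of_box)
  qed (auto intro: measure_pmf.prob_space_axioms)
  have "((\<lambda>P. real (card (h -` B \<inter> P)) / real (card P)) \<longlongrightarrow> measure D B) boxes_at_top"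
    using * by (rule Lim_transform_eventually)
      (use eventually_box_finite_nonempty in eventually_elim, simp add: measure_pmf_of_set vimage_def Int_commute)
  from freq_of_tendsto[OF this] show "freq_measurable (h -` B)" "freq (h -` B) = measure D B" .
qed

text \<open>Two laws of the same map agree on all Borel sets whose frontier is null for both, which
  already forces them to be equal; hence \<open>THE\<close> picks the given law.\<close>

lemma freq_law_eq:
  assumes "freq_distributed D h"
  shows "freq_law h = D"
  unfolding freq_law_def
proof (rule the_equality[where P = "\<lambda>D. freq_distributed D h", OF assms])
  fix D' assume "freq_distributed D' h"
  with assms show "D' = D"
    by (intro borel_prob_eqI) (auto simp: freq_distributed_def)
qed

section \<open>The quantization cell as a fundamental domain\<close>

lemma of_int_vec_simps [simp]:
  "of_int_vec (a + b) = of_int_vec a + of_int_vec b" "of_int_vec (a - b) = of_int_vec a - of_int_vec b"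
  "of_int_vec (- a) = - of_int_vec a" "of_int_vec 0 = 0" "of_int_vec a $ i = of_int (a $ i)"
  by (simp_all add: of_int_vec_def vec_eq_iff)

lemma inner_of_int_vec_Ints: "of_int_vec a \<bullet> of_int_vec b \<in> \<int>"
  unfolding inner_vec_def by (auto intro!: Ints_sum)

lemma iexp_add_2pi_Ints:
  assumes "k \<in> \<int>"
  shows "iexp (x + 2 * pi * k) = iexp x"
proof -
  obtain n where "k = of_int n" using assms by (auto elim: Ints_cases)
  then have "iexp (2 * pi * k) = 1"
    using exp_integer_2pi[of "of_int n"] by (simp add: mult_ac)
  then show ?thesis by (simp add: distrib_left exp_add)
qed

definition periodic :: "(real^'n \<Rightarrow> 'b) \<Rightarrow> bool" where
  "periodic f \<longleftrightarrow> (\<forall>u z. f (u + of_int_vec z) = f u)"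

text \<open>Uniqueness of the translate is required only almost everywhere, so that the interior of
  the cell qualifies although it misses the boundary.\<close>

definition fundamental_set :: "(real^'n) set \<Rightarrow> bool" where
  "fundamental_set A \<longleftrightarrow> A \<in> sets borel \<and> (AE u in lborel. \<exists>!z. u + of_int_vec z \<in> A)"

lemma nn_integral_lborel_shift:
  fixes f :: "'a::euclidean_space \<Rightarrow> ennreal"
  assumes [measurable]: "f \<in> borel_measurable borel"
  shows "(\<integral>\<^sup>+u. f (u + h) \<partial>lborel) = (\<integral>\<^sup>+u. f u \<partial>lborel)"
proof -
  have "(\<integral>\<^sup>+u. f u \<partial>lborel) = (\<integral>\<^sup>+u. f u \<partial>distr lborel borel ((+) h))" by (simp add: lborel_distr_plus)
  also have "\<dots> = (\<integral>\<^sup>+u. f (u + h) \<partial>lborel)" by (subst nn_integral_distr) (auto simp: add.commute)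
  finally show ?thesis by simp
qed

lemma AE_lborel_shift:
  assumes "AE u in lborel. P u"
  shows "AE u in lborel. P (u + h :: 'a::euclidean_space)"
proof -
  have "AE u in distr lborel borel ((+) h). P u" unfolding lborel_distr_plus by (rule assms)
  then have "AE u in lborel. P (h + u)" by (rule AE_distrD[rotated]) simp
  then show ?thesis by (simp add: add.commute)
qed

text \<open>The unfolding argument: insert the sum over \<open>z\<close> of the indicators of
  \<open>B - z\<close>, which is 1 almost everywhere, interchange, and shift each term by
  \<open>z\<close>; periodicity of \<open>f\<close> moves the sum onto \<open>A\<close>.\<close>

lemma nn_integral_fundamental_set_eq:
  fixes f :: "real^'n \<Rightarrow> ennreal"
  assumes A: "fundamental_set A" and B: "fundamental_set B"
    and [measurable]: "f \<in> borel_measurable borel" and f: "periodic f"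
  shows "(\<integral>\<^sup>+u. f u * indicator A u \<partial>lborel) = (\<integral>\<^sup>+u. f u * indicator B u \<partial>lborel)"
proof -
  have [measurable]: "A \<in> sets borel" "B \<in> sets borel" using A B by (auto simp: fundamental_set_def)
  have one: "AE u in lborel. (\<integral>\<^sup>+z. indicator S (u + of_int_vec z) \<partial>count_space UNIV) = (1::ennreal)"
    if S: "fundamental_set S" for S :: "(real^'n) set"
    using S unfolding fundamental_set_def
  proof (elim conjE AE_mp, intro AE_I2 impI)
    fix u :: "real^'n" assume "\<exists>!z. u + of_int_vec z \<in> S"
    then obtain z where z: "u + of_int_vec z \<in> S" "\<And>z'. u + of_int_vec z' \<in> S \<Longrightarrow> z' = z" by blast
    have "(\<integral>\<^sup>+z. indicator S (u + of_int_vec z) \<partial>count_space UNIV) = (\<integral>\<^sup>+z'. indicator {z} z' \<partial>count_space UNIV)"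
    proof (rule nn_integral_cong)
      fix z' show "indicator S (u + of_int_vec z') = (indicator {z} z' :: ennreal)"
      proof (cases "u + of_int_vec z' \<in> S")
        case False
        then have "z' \<noteq> z" using z(1) by blast
        with False show ?thesis by simp
      qed (use z(2)[of z'] in simp)
    qed
    then show "(\<integral>\<^sup>+z. indicator S (u + of_int_vec z) \<partial>count_space UNIV) = (1::ennreal)" by simp
  qed
  have per: "f (u + of_int_vec z) = f u" for u z using f by (simp add: periodic_def)
  have "(\<integral>\<^sup>+u. f u * indicator A u \<partial>lborel) =
      (\<integral>\<^sup>+u. f u * indicator A u * (\<integral>\<^sup>+z. indicator B (u + of_int_vec z) \<partial>count_space UNIV) \<partial>lborel)"
    using one[OF B] by (intro nn_integral_cong_AE) auto
  also have "\<dots> = (\<integral>\<^sup>+u. (\<integral>\<^sup>+z. f u * indicator A u * indicator B (u + of_int_vec z) \<partial>count_space UNIV) \<partial>lborel)"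
    by (simp add: nn_integral_cmult)
  also have "\<dots> = (\<integral>\<^sup>+z. (\<integral>\<^sup>+u. f u * indicator A u * indicator B (u + of_int_vec z) \<partial>lborel) \<partial>count_space UNIV)"
    by (intro nn_integral_count_space_nn_integral) auto
  also have "\<dots> = (\<integral>\<^sup>+z. (\<integral>\<^sup>+u. f u * indicator A (u - of_int_vec z) * indicator B u \<partial>lborel) \<partial>count_space UNIV)"
  proof (rule nn_integral_cong)
    fix z :: "int^'n"
    have [measurable]: "(\<lambda>u. u - of_int_vec z :: real^'n) \<in> borel_measurable borel" by simp
    show "(\<integral>\<^sup>+u. f u * indicator A u * indicator B (u + of_int_vec z) \<partial>lborel) = (\<integral>\<^sup>+u. f u * indicator A (u - of_int_vec z) * indicator B u \<partial>lborel)"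
      by (subst nn_integral_lborel_shift[where h = "of_int_vec z", symmetric]) (simp_all add: per)
  qed
  also have "\<dots> = (\<integral>\<^sup>+z. (\<integral>\<^sup>+u. f u * indicator A (u + of_int_vec z) * indicator B u \<partial>lborel) \<partial>count_space UNIV)"
    by (subst nn_integral_bij_count_space[of uminus UNIV UNIV, symmetric]) (auto simp: bij_uminus)
  also have "\<dots> = (\<integral>\<^sup>+u. (\<integral>\<^sup>+z. f u * indicator A (u + of_int_vec z) * indicator B u \<partial>count_space UNIV) \<partial>lborel)"
    by (intro nn_integral_count_space_nn_integral[symmetric]) auto
  also have "\<dots> = (\<integral>\<^sup>+u. f u * indicator B u * (\<integral>\<^sup>+z. indicator A (u + of_int_vec z) \<partial>count_space UNIV) \<partial>lborel)"
    by (simp add: nn_integral_cmult[symmetric] mult_ac)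
  also have "\<dots> = (\<integral>\<^sup>+u. f u * indicator B u \<partial>lborel)"
    using one[OF A] by (intro nn_integral_cong_AE) auto
  finally show ?thesis .
qed

section \<open>The uniform law on the cell of a quantizer\<close>

abbreviation q_cell :: "(real^'n \<Rightarrow> int^'n) \<Rightarrow> (real^'n) set" where
  "q_cell R \<equiv> R -` {0}"

lemma quantizer_shift: "quantizer R \<Longrightarrow> R (u + of_int_vec z) = R u + z"
  by (simp add: quantizer_def)

lemma quantizer_diff: "quantizer R \<Longrightarrow> R (u - of_int_vec z) = R u - z"
  using quantizer_shift[of R u "- z"] by simp

lemma quantizer_error_in_cell: "quantizer R \<Longrightarrow> R (u - of_int_vec (R u)) = 0"
  by (simp add: quantizer_diff)

lemma frontier_q_cell_null:
  assumes "quantizer R"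
  shows "frontier (q_cell R) \<in> null_sets lborel"
  using assms null_sets_completion_iff[of "frontier (q_cell R)" lborel]
  by (auto simp: quantizer_def jordan_measurable_def)

lemma AE_in_interior_q_cell_iff:
  assumes "quantizer R"
  shows "AE u in lborel. u \<in> q_cell R \<longleftrightarrow> u \<in> interior (q_cell R)"
proof -
  have "AE u in lborel. u \<notin> frontier (q_cell R)"
    by (rule AE_not_in[OF frontier_q_cell_null[OF assms]])
  then show ?thesis
    by eventually_elim (use interior_subset[of "q_cell R"] closure_subset[of "q_cell R"] in \<open>auto simp: frontier_def\<close>)
qed

text \<open>By equivariance of \<open>R\<close>, the vector \<open>- R u\<close> is the only lattice
  vector that moves \<open>u\<close> into the cell; passing to the interior affects a null set
  only.\<close>

lemma fundamental_set_q_cell: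
  assumes "quantizer R"
  shows "fundamental_set (interior (q_cell R))"
proof -
  have "AE u in lborel. \<forall>z. u + of_int_vec z \<in> q_cell R \<longleftrightarrow> u + of_int_vec z \<in> interior (q_cell R)"
    unfolding AE_all_countable
    by (intro allI AE_lborel_shift[where P = "\<lambda>u. u \<in> q_cell R \<longleftrightarrow> u \<in> interior (q_cell R)"] AE_in_interior_q_cell_iff assms)
  then have "AE u in lborel. \<exists>!z. u + of_int_vec z \<in> interior (q_cell R)"
  proof eventually_elim
    case (elim u)
    then have "u + of_int_vec z \<in> interior (q_cell R) \<longleftrightarrow> R u + z = 0" for z
      using quantizer_shift[OF assms] by auto
    moreover have "R u + z = 0 \<longleftrightarrow> z = - R u" for z by (metis add_eq_0_iff)
    ultimately show ?case by simp
  qed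
  then show ?thesis by (simp add: fundamental_set_def)
qed

lemma fundamental_set_shift:
  assumes "fundamental_set A"
  shows "fundamental_set {u. u + h \<in> A}"
proof -
  have [measurable]: "A \<in> sets borel" using assms by (simp add: fundamental_set_def)
  have "AE u in lborel. \<exists>!z. u + of_int_vec z \<in> A" using assms by (simp add: fundamental_set_def)
  from AE_lborel_shift[OF this, of h] have "AE u in lborel. \<exists>!z. u + of_int_vec z + h \<in> A"
    by (simp add: add_ac)
  then show ?thesis by (simp add: fundamental_set_def)
qed

lemma fundamental_set_unit_cube: "fundamental_set {u::real^'n. \<forall>i. 0 \<le> u $ i \<and> u $ i < 1}"
proof -
  have "\<exists>!z. u + of_int_vec z \<in> {u. \<forall>i. 0 \<le> u $ i \<and> u $ i < 1}" for u :: "real^'n"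
  proof (rule ex1I[of _ "\<chi> i. - \<lfloor>u $ i\<rfloor>"])
    fix z assume *: "u + of_int_vec z \<in> {u. \<forall>i. 0 \<le> u $ i \<and> u $ i < 1}"
    have "z $ i = - \<lfloor>u $ i\<rfloor>" for i
    proof -
      have "0 \<le> u $ i + of_int (z $ i)" "u $ i + of_int (z $ i) < 1" using * by auto
      then show ?thesis by linarith
    qed
    then show "z = (\<chi> i. - \<lfloor>u $ i\<rfloor>)" by (simp add: vec_eq_iff)
  qed (auto simp: floor_le_iff, linarith+)
  moreover have "{u::real^'n. \<forall>i. 0 \<le> u $ i \<and> u $ i < 1} \<in> sets borel" by measurable
  ultimately show ?thesis by (simp add: fundamental_set_def)
qed

lemma emeasure_unit_cube: "emeasure lborel {u::real^'n. \<forall>i. 0 \<le> u $ i \<and> u $ i < 1} = 1"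
proof -
  let ?S = "{u::real^'n. \<forall>i. 0 \<le> u $ i \<and> u $ i < 1}"
  have [measurable]: "?S \<in> sets borel" by measurable
  have "box 0 (1::real^'n) \<subseteq> ?S" "?S \<subseteq> cbox 0 (1::real^'n)"
    by (auto simp: mem_box_cart less_imp_le)
  then have "emeasure lborel (box 0 (1::real^'n)) \<le> emeasure lborel ?S" "emeasure lborel ?S \<le> emeasure lborel (cbox 0 (1::real^'n))"
    by (auto intro!: emeasure_mono)
  moreover have "emeasure lborel (box 0 (1::real^'n)) = 1" "emeasure lborel (cbox 0 (1::real^'n)) = 1"
  proof -
    have "(1::real^'n) \<bullet> b = 1" if "b \<in> Basis" for b using that by (auto simp: Basis_vec_def inner_axis)
    then show "emeasure lborel (box 0 (1::real^'n)) = 1" "emeasure lborel (cbox 0 (1::real^'n)) = 1"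
      by (simp_all add: emeasure_lborel_box_eq emeasure_lborel_cbox_eq)
  qed
  ultimately show ?thesis by simp
qed

text \<open>The cell need not be Borel, but it differs from its interior by a null set only.\<close>

definition cell_measure :: "(real^'n \<Rightarrow> int^'n) \<Rightarrow> (real^'n) measure" where
  "cell_measure R = density lborel (indicator (interior (q_cell R)))"

lemma sets_cell_measure [simp, measurable_cong]: "sets (cell_measure R) = sets borel"
  by (simp add: cell_measure_def)

lemma space_cell_measure [simp]: "space (cell_measure R) = UNIV"
  by (simp add: cell_measure_def)

lemma nn_integral_cell_measure:
  "f \<in> borel_measurable borel \<Longrightarrow> (\<integral>\<^sup>+u. f u \<partial>cell_measure R) = (\<integral>\<^sup>+u. f u * indicator (interior (q_cell R)) u \<partial>lborel)"
  unfolding cell_measure_def by (subst nn_integral_density) (auto simp: mult.commute)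

text \<open>All fundamental domains have the same volume, and the unit cube has volume 1.\<close>

lemma prob_space_cell_measure:
  fixes R :: "real^'n \<Rightarrow> int^'n"
  assumes "quantizer R"
  shows "prob_space (cell_measure R)"
proof
  have "emeasure (cell_measure R) UNIV = (\<integral>\<^sup>+u. 1 * indicator (interior (q_cell R)) u \<partial>lborel)"
    using nn_integral_cell_measure[of "\<lambda>_. 1" R] by simp
  also have "\<dots> = (\<integral>\<^sup>+u. 1 * indicator {u::real^'n. \<forall>i. 0 \<le> u $ i \<and> u $ i < 1} u \<partial>lborel)"
    by (intro nn_integral_fundamental_set_eq[where f = "\<lambda>_. 1"] fundamental_set_q_cell assms fundamental_set_unit_cube)
      (auto simp: periodic_def)
  also have "\<dots> = 1"
    using emeasure_unit_cube fundamental_set_unit_cube by (simp add: fundamental_set_def)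
  finally show "emeasure (cell_measure R) (space (cell_measure R)) = 1" by simp
qed

lemma AE_cell_measure:
  "AE u in cell_measure R. u \<in> interior (q_cell R)"
  unfolding cell_measure_def by (subst AE_density) (auto simp: indicator_def)

lemma integrable_cell_measureI:
  fixes f :: "real^'n \<Rightarrow> 'b::{banach, second_countable_topology}"
  assumes "quantizer R" "f \<in> borel_measurable borel" "\<And>u. R u = 0 \<Longrightarrow> norm (f u) \<le> K"
  shows "integrable (cell_measure R) f"
proof -
  interpret prob_space "cell_measure R" by (rule prob_space_cell_measure[OF assms(1)])
  show ?thesis
    by (rule integrable_const_bound[of _ K])
      (use AE_cell_measure[of R] assms interior_subset[of "q_cell R"] in \<open>auto elim!: AE_mp\<close>)
qed

text \<open>Translates the integrals in \<open>q_mean\<close> and \<open>q_cov\<close>, taken over a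
  possibly non-Borel cell, into expectations.\<close>

lemma integral_cell_measure:
  fixes f :: "real^'n \<Rightarrow> 'b::{banach, second_countable_topology}"
  assumes "quantizer R" and [measurable]: "f \<in> borel_measurable borel"
  shows "(LINT u:q_cell R|lebesgue. f u) = (LINT u|cell_measure R. f u)"
proof -
  let ?I = "interior (q_cell R)"
  have "(LINT u:q_cell R|lebesgue. f u) = (LINT u|lebesgue. indicator ?I u *\<^sub>R f u)"
    unfolding set_lebesgue_integral_def
  proof (rule integral_cong_AE)
    have "AE u in lebesgue. u \<in> q_cell R \<longleftrightarrow> u \<in> ?I"
      by (rule AE_completion[OF AE_in_interior_q_cell_iff[OF assms(1)]])
    then have ae: "AE u in lebesgue. indicat_real (q_cell R) u *\<^sub>R f u = indicator ?I u *\<^sub>R f u"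
      by eventually_elim (auto simp: indicator_def)
    have "q_cell R \<inter> frontier (q_cell R) \<in> null_sets lebesgue"
      by (rule null_sets_completion_subset[OF _ null_sets_completionI[OF frontier_q_cell_null[OF assms(1)]]]) auto
    moreover have "q_cell R = ?I \<union> (q_cell R \<inter> frontier (q_cell R))"
      using interior_subset[of "q_cell R"] closure_subset[of "q_cell R"] by (auto simp: frontier_def)
    ultimately have "q_cell R \<in> sets lebesgue"
      by (metis borel_open lborelD null_setsD2 open_interior sets.Un sets_completionI_sets sets_lborel)
    moreover have "f \<in> borel_measurable lebesgue" by (intro measurable_completion) simp
    ultimately show "(\<lambda>u. indicat_real (q_cell R) u *\<^sub>R f u) \<in> borel_measurable lebesgue"
      by (intro borel_measurable_scaleR borel_measurable_indicator)
    show "(\<lambda>u. indicat_real ?I u *\<^sub>R f u) \<in> borel_measurable lebesgue"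
      by (intro measurable_completion) simp
    show "AE u in lebesgue. indicat_real (q_cell R) u *\<^sub>R f u = indicator ?I u *\<^sub>R f u" by (rule ae)
  qed
  also have "\<dots> = (LINT u|lborel. indicator ?I u *\<^sub>R f u)"
    by (rule integral_completion) simp
  also have "\<dots> = (LINT u|cell_measure R. f u)"
    unfolding cell_measure_def ennreal_indicator[symmetric] by (subst integral_density) auto
  finally show ?thesis .
qed

lemma bounded_q_cell:
  assumes "quantizer R"
  obtains K where "K > 0" "\<And>u. R u = 0 \<Longrightarrow> norm u \<le> K"
proof -
  have "bounded (q_cell R)" using assms by (simp add: quantizer_def jordan_measurable_def)
  then obtain K where "K > 0" "\<forall>u\<in>q_cell R. norm u \<le> K" using bounded_pos by blast
  then show thesis by (intro that[of K]) auto
qed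

text \<open>A translation by \<open>h\<close> with inner product \<open>1 / 2\<close> with the
  frequency reverses the sign of the cosine, while the translated cell is again a fundamental
  domain; the integral thus equals its own negative. The argument is run for \<open>1 + cos\<close>,
  which is nonnegative.\<close>

lemma integral_cell_measure_cos_eq_0:
  fixes m :: "int^'n"
  assumes R: "quantizer R" and "m \<noteq> 0"
  shows "(LINT u|cell_measure R. cos (2 * pi * (of_int_vec m \<bullet> u) + b)) = 0"
proof -
  interpret prob_space "cell_measure R" by (rule prob_space_cell_measure[OF R])
  let ?I = "interior (q_cell R)" and ?p = "\<lambda>u::real^'n. 2 * pi * (of_int_vec m \<bullet> u) + b"
  have m0: "of_int_vec m \<noteq> (0::real^'n)" using \<open>m \<noteq> 0\<close> by (auto simp: vec_eq_iff)
  define h :: "real^'n" where "h = (1 / (2 * (of_int_vec m \<bullet> of_int_vec m))) *\<^sub>R of_int_vec m"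
  have h: "of_int_vec m \<bullet> h = 1 / 2" using m0 by (simp add: h_def)
  have ph: "?p (u + h) = ?p u + pi" for u by (simp add: inner_add_right h algebra_simps)
  have I[measurable]: "?I \<in> sets borel" by simp
  have perp: "cos (?p (u + of_int_vec z)) = cos (?p u)" for u z
  proof -
    obtain k where "of_int_vec m \<bullet> of_int_vec z = (of_int k :: real)"
      using inner_of_int_vec_Ints[of m z] by (auto elim: Ints_cases)
    then have "?p (u + of_int_vec z) = ?p u + 2 * pi * of_int k" by (simp add: inner_add_right algebra_simps)
    moreover have "cos (x + 2 * pi * of_int k) = cos x" for x
      by (simp only: cos_add cos_int_2pin sin_int_2pin)
    ultimately show ?thesis by (simp only:)
  qed
  have "(\<integral>\<^sup>+u. ennreal (1 + cos (?p u)) \<partial>cell_measure R) = (\<integral>\<^sup>+u. ennreal (1 + cos (?p u)) * indicator ?I u \<partial>lborel)"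
    by (rule nn_integral_cell_measure) simp
  also have "\<dots> = (\<integral>\<^sup>+u. ennreal (1 + cos (?p u)) * indicator {u. u - h \<in> ?I} u \<partial>lborel)"
    using fundamental_set_shift[OF fundamental_set_q_cell[OF R], of "- h"]
    by (intro nn_integral_fundamental_set_eq fundamental_set_q_cell R) (auto simp: periodic_def perp)
  also have "\<dots> = (\<integral>\<^sup>+u. ennreal (1 + cos (?p (u + h))) * indicator ?I u \<partial>lborel)"
    by (subst nn_integral_lborel_shift[where h = h, symmetric]) (auto simp: indicator_def)
  also have "\<dots> = (\<integral>\<^sup>+u. ennreal (1 - cos (?p u)) \<partial>cell_measure R)"
    unfolding ph by (subst nn_integral_cell_measure) (simp_all only: cos_periodic_pi, simp_all)
  finally have eq: "(\<integral>\<^sup>+u. ennreal (1 + cos (?p u)) \<partial>cell_measure R) = (\<integral>\<^sup>+u. ennreal (1 - cos (?p u)) \<partial>cell_measure R)" .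
  have int: "integrable (cell_measure R) (\<lambda>u. cos (?p u))" by (intro integrable_const_bound[of _ 1]) auto
  have nn: "0 \<le> 1 + cos (?p u)" "0 \<le> 1 - cos (?p u)" for u
    using cos_ge_minus_one[of "?p u"] cos_le_one[of "?p u"] by linarith+
  have "(LINT u|cell_measure R. 1 + cos (?p u)) = (LINT u|cell_measure R. 1 - cos (?p u))"
    using eq nn by (subst (1 2) integral_eq_nn_integral) auto
  then show ?thesis using int by (simp add: prob_space)
qed

definition cell_char :: "(real^'n \<Rightarrow> int^'n) \<Rightarrow> real^'n \<Rightarrow> complex" where
  "cell_char R a = (LINT u|cell_measure R. iexp (a \<bullet> u))"

lemma cell_char_0: "quantizer R \<Longrightarrow> cell_char R 0 = 1"
  using prob_space.prob_space[OF prob_space_cell_measure[of R]] by (simp add: cell_char_def)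

lemma norm_cell_char_le: "quantizer R \<Longrightarrow> cmod (cell_char R a) \<le> 1"
proof -
  assume R: "quantizer R"
  interpret prob_space "cell_measure R" by (rule prob_space_cell_measure[OF R])
  have "cmod (cell_char R a) \<le> (LINT u|cell_measure R. cmod (iexp (a \<bullet> u)))"
    unfolding cell_char_def by (rule integral_norm_bound)
  then show ?thesis using prob_space by simp
qed

text \<open>At lattice frequencies the uniform law on the cell has the Fourier coefficients of Haar
  measure on the torus, because the cell is a fundamental domain.\<close>

lemma cell_char_2pi:
  fixes m :: "int^'n"
  assumes R: "quantizer R"
  shows "cell_char R ((2 * pi) *\<^sub>R of_int_vec m) = (if m = 0 then 1 else 0)"
proof (cases "m = 0")
  case False
  interpret prob_space "cell_measure R" by (rule prob_space_cell_measure[OF R])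
  let ?f = "\<lambda>u. iexp ((2 * pi) *\<^sub>R of_int_vec m \<bullet> u)"
  have int: "integrable (cell_measure R) ?f" by (intro integrable_const_bound[of _ 1]) auto
  have c: "Re (?f u) = cos (2 * pi * (of_int_vec m \<bullet> u) + 0)" "Im (?f u) = cos (2 * pi * (of_int_vec m \<bullet> u) + - (pi / 2))" for u
    unfolding inner_scaleR_left by (simp_all add: Re_exp Im_exp cos_diff)
  have "Re (LINT u|cell_measure R. ?f u) = 0" "Im (LINT u|cell_measure R. ?f u) = 0"
    unfolding integral_Re[OF int, symmetric] integral_Im[OF int, symmetric] c
    by (rule integral_cell_measure_cos_eq_0[OF R False])+
  then show ?thesis using False by (simp add: cell_char_def complex_eq_iff)
qed (use cell_char_0[OF R] in simp)

definition lattice_phases :: "(real^'n \<Rightarrow> real) set" where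
  "lattice_phases = {\<lambda>u. 2 * pi * (of_int_vec m \<bullet> u) | m. True}"

text \<open>The continuous function \<open>f\<close> factors through the torus, realized by the points with all
  coordinates of modulus one in \<open>complex^'n\<close>.\<close>

lemma periodic_trig_approximation:
  fixes f :: "real^'n \<Rightarrow> real"
  assumes f: "continuous_on UNIV f" "periodic f" and "e > 0"
  obtains p where "trig_poly lattice_phases p" "\<And>u. cmod (p u - of_real (f u)) \<le> e"
proof -
  define \<sigma> :: "real^'n \<Rightarrow> complex^'n" where "\<sigma> u = (\<chi> j. cis (2 * pi * u $ j))" for u
  define S where "S = {s::complex^'n. \<forall>j. norm (s $ j) = 1}"
  have \<sigma>S: "\<sigma> u \<in> S" for u by (simp add: \<sigma>_def S_def)
  have cis_eq: "\<exists>k::int. x - y = of_int k" if "cis (2 * pi * x) = cis (2 * pi * y)" for x y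
  proof -
    have "exp (\<i> * of_real (2 * pi * x)) = exp (\<i> * of_real (2 * pi * y))" using that by (simp add: cis_conv_exp)
    then obtain n :: int where "\<i> * of_real (2 * pi * x) = \<i> * of_real (2 * pi * y) + (of_int (2 * n) * pi) * \<i>"
      unfolding exp_eq by blast
    then have "\<i> * of_real (2 * pi * x) = \<i> * of_real (2 * pi * y + 2 * pi * of_int n)"
      by (simp add: algebra_simps)
    then have "2 * pi * x = 2 * pi * y + 2 * pi * of_int n"
      unfolding mult_cancel_left of_real_eq_iff by simp
    then have "2 * pi * (x - y) = 2 * pi * of_int n" by (simp add: algebra_simps)
    then show ?thesis by auto
  qed
  have inv: "f u = f v" if "\<sigma> u = \<sigma> v" for u v
  proof -
    have "\<forall>j. \<exists>k::int. u $ j - v $ j = of_int k" using that cis_eq by (simp add: \<sigma>_def vec_eq_iff)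
    then obtain k :: "'n \<Rightarrow> int" where "\<forall>j. u $ j - v $ j = of_int (k j)" by metis
    then have "u = v + of_int_vec (\<chi> j. k j)" by (simp add: vec_eq_iff algebra_simps)
    then show ?thesis using f(2) by (simp add: periodic_def)
  qed
  define G where "G s = f (SOME u. \<sigma> u = s)" for s
  have G\<sigma>: "G (\<sigma> u) = f u" for u
    unfolding G_def by (rule inv) (rule someI[of _ u], simp)
  have cont_\<sigma>: "continuous_on A \<sigma>" for A
    unfolding \<sigma>_def by (intro continuous_intros)
  have surj: "\<exists>u\<in>cbox 0 1. \<sigma> u = s" if "s \<in> S" for s
  proof
    have "Arg2pi (s $ j) / (2 * pi) \<le> 1" for j using Arg2pi_lt_2pi[of "s $ j"] by simp
    then show "(\<chi> j. Arg2pi (s $ j) / (2 * pi)) \<in> cbox 0 1"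
      by (auto simp: mem_box_cart intro!: divide_nonneg_nonneg Arg2pi_ge_0)
    have "cis (Arg2pi (s $ j)) = s $ j" for j
      using Arg2pi_eq[of "s $ j"] that by (simp add: S_def cis_conv_exp)
    then show "\<sigma> (\<chi> j. Arg2pi (s $ j) / (2 * pi)) = s" by (simp add: \<sigma>_def vec_eq_iff)
  qed
  have "S = (\<Inter>j. {s. norm (s $ j) = 1})" by (auto simp: S_def)
  moreover have "closed \<dots>" by (intro closed_INT ballI closed_Collect_eq continuous_intros)
  ultimately have clS: "closed S" by simp
  have S_img: "S = \<sigma> ` cbox 0 1" using surj \<sigma>S by blast
  then have cmpS: "compact S" by (simp add: compact_continuous_image cont_\<sigma> compact_cbox)
  \<comment> \<open>\<open>\<sigma>\<close> maps the compact unit cube onto \<open>S\<close> and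
    sends closed subsets of it to closed sets, so continuity of \<open>f\<close> descends to the
    quotient function \<open>G\<close>.\<close>
  have contG: "continuous_on S G"
    unfolding continuous_on_closed_vimage[OF clS]
  proof (intro allI impI)
    fix T :: "real set" assume "closed T"
    have "G -` T \<inter> S = \<sigma> ` (cbox 0 1 \<inter> f -` T)" unfolding S_img using G\<sigma> by auto
    moreover have "compact (cbox 0 1 \<inter> f -` T)"
      using f(1) \<open>closed T\<close> by (intro compact_Int_closed compact_cbox continuous_closed_vimage)
        (auto simp: continuous_on_eq_continuous_at)
    ultimately show "closed (G -` T \<inter> S)"
      by (metis compact_continuous_image cont_\<sigma> compact_imp_closed)
  qed
  have ph: "(\<lambda>u. 2 * pi * u $ j) \<in> lattice_phases" "(\<lambda>u. - (2 * pi * u $ j)) \<in> lattice_phases" for j :: 'n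
  proof -
    have "of_int_vec (axis j 1) = (axis j 1 :: real^'n)" by (simp add: vec_eq_iff axis_def)
    then have "of_int_vec (axis j 1) \<bullet> u = u $ j" "of_int_vec (- axis j 1) \<bullet> u = - u $ j" for u :: "real^'n"
      by (simp_all add: inner_axis')
    then show "(\<lambda>u. 2 * pi * u $ j) \<in> lattice_phases" "(\<lambda>u. - (2 * pi * u $ j)) \<in> lattice_phases"
      unfolding lattice_phases_def
      by (auto intro: exI[of _ "axis j 1"] exI[of _ "- axis j 1"] simp del: of_int_vec_simps(3))
  qed
  show thesis
  proof (rule trig_poly_approximation[OF cmpS \<sigma>S _ _ _ contG \<open>e > 0\<close>, of lattice_phases])
    show "(\<lambda>x. 0) \<in> lattice_phases" unfolding lattice_phases_def by (auto intro!: exI[of _ 0])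
    show "(\<lambda>x. p x + q x) \<in> lattice_phases" if pq: "p \<in> lattice_phases" "q \<in> lattice_phases" for p q
    proof -
      obtain m m' where "p = (\<lambda>u. 2 * pi * (of_int_vec m \<bullet> u))" "q = (\<lambda>u. 2 * pi * (of_int_vec m' \<bullet> u))"
        using pq by (auto simp: lattice_phases_def)
      then show ?thesis unfolding lattice_phases_def
        by (intro CollectI exI[of _ "m + m'"]) (auto simp: inner_add_left algebra_simps)
    qed
    show "\<exists>h. continuous_on S h \<and> trig_poly lattice_phases (\<lambda>x. of_real (h (\<sigma> x))) \<and> h s \<noteq> h t"
      if st: "s \<in> S" "t \<in> S" "s \<noteq> t" for s t
    proof -
      obtain j where j: "s $ j \<noteq> t $ j" using st by (auto simp: vec_eq_iff)
      then consider "Re (s $ j) \<noteq> Re (t $ j)" | "Im (s $ j) \<noteq> Im (t $ j)" by (auto simp: complex_eq_iff)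
      then show ?thesis
      proof cases
        case 1
        then show ?thesis using trig_poly_cos[OF ph(1)[of j] ph(2)[of j]]
          by (intro exI[of _ "\<lambda>s. Re (s $ j)"]) (auto simp: \<sigma>_def intro!: continuous_intros)
      next
        case 2
        then show ?thesis using trig_poly_sin[OF ph(1)[of j] ph(2)[of j]]
          by (intro exI[of _ "\<lambda>s. Im (s $ j)"]) (auto simp: \<sigma>_def intro!: continuous_intros)
      qed
    qed
  qed (use G\<sigma> in \<open>auto intro: that\<close>)
qed

section \<open>Joint equidistribution of the quantization errors\<close>

definition has_box_mean :: "(int^'n \<Rightarrow> complex) \<Rightarrow> complex \<Rightarrow> bool" where
  "has_box_mean f c \<longleftrightarrow> ((\<lambda>P. box_avg P f) \<longlongrightarrow> c) boxes_at_top"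

lemma box_avg_add: "box_avg P (\<lambda>x. f x + g x) = box_avg P f + box_avg P g"
  by (simp add: box_avg_def sum.distrib scaleR_add_right)

lemma box_avg_diff: "box_avg P (\<lambda>x. f x - g x) = box_avg P f - box_avg P g"
  by (simp add: box_avg_def sum_subtractf scaleR_diff_right)

lemma box_avg_cmult: "box_avg P (\<lambda>x. c * f x) = c * box_avg P (f :: _ \<Rightarrow> complex)"
  by (simp add: box_avg_def sum_distrib_left)

lemma norm_box_avg_le: "norm (box_avg P f) \<le> box_avg P (\<lambda>x. norm (f x))"
  unfolding box_avg_def norm_scaleR by (auto intro!: mult_left_mono norm_sum)

lemma box_avg_mono: "(\<And>x. f x \<le> g x) \<Longrightarrow> box_avg P f \<le> (box_avg P g :: real)"
  unfolding box_avg_def by (auto intro!: mult_left_mono sum_mono)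

lemma box_avg_of_real: "box_avg P (\<lambda>x. complex_of_real (f x)) = of_real (box_avg P f)"
  by (simp add: box_avg_def scaleR_conv_of_real)

lemma has_box_mean_add: "has_box_mean f c \<Longrightarrow> has_box_mean g d \<Longrightarrow> has_box_mean (\<lambda>x. f x + g x) (c + d)"
  unfolding has_box_mean_def box_avg_add by (rule tendsto_add)

lemma has_box_mean_cmult: "has_box_mean f c \<Longrightarrow> has_box_mean (\<lambda>x. d * f x) (d * c)"
  unfolding has_box_mean_def box_avg_cmult by (rule tendsto_mult_left)

lemma has_box_mean_const: "has_box_mean (\<lambda>x. c) c"
  unfolding has_box_mean_def
  by (rule tendsto_eventually)
    (use eventually_box_finite_nonempty in eventually_elim, simp add: box_avg_def scaleR_conv_of_real)

text \<open>The error is only required to be small on average, not uniformly: an approximation that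
  fails near the boundary of the cell is admissible as long as its bound \<open>w\<close> has a
  small mean.\<close>

lemma has_box_mean_approx:
  assumes "\<And>e. 0 < e \<Longrightarrow> \<exists>f' c' w d. has_box_mean f' c' \<and> cmod (c' - c) \<le> e \<and>
    (\<forall>x. cmod (f x - f' x) \<le> w x) \<and> has_box_mean (\<lambda>x. complex_of_real (w x)) (of_real d) \<and> d \<le> e"
  shows "has_box_mean f c"
  unfolding has_box_mean_def
proof (rule tendstoI)
  fix e :: real assume "e > 0"
  \<comment> \<open>Four of the five shares are spent: two on the average of \<open>w\<close>, one
    on the average of \<open>f'\<close>, one on the distance from \<open>c'\<close> to
    \<open>c\<close>.\<close>
  define \<epsilon> where "\<epsilon> = e / 5"
  have "\<epsilon> > 0" using \<open>e > 0\<close> by (simp add: \<epsilon>_def)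
  then obtain f' c' w d where *: "has_box_mean f' c'" "cmod (c' - c) \<le> \<epsilon>" "\<forall>x. cmod (f x - f' x) \<le> w x"
    "has_box_mean (\<lambda>x. complex_of_real (w x)) (of_real d)" "d \<le> \<epsilon>" using assms by blast
  have "((\<lambda>P. box_avg P w) \<longlongrightarrow> d) boxes_at_top"
    using *(4) unfolding has_box_mean_def box_avg_of_real by (simp only: tendsto_of_real_iff)
  moreover have "d < 2 * \<epsilon>" using * \<open>\<epsilon> > 0\<close> by linarith
  ultimately have "\<forall>\<^sub>F P in boxes_at_top. box_avg P w < 2 * \<epsilon>" by (rule order_tendstoD)
  moreover have "\<forall>\<^sub>F P in boxes_at_top. dist (box_avg P f') c' < \<epsilon>"
    using *(1) \<open>\<epsilon> > 0\<close> unfolding has_box_mean_def by (rule tendstoD)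
  ultimately show "\<forall>\<^sub>F P in boxes_at_top. dist (box_avg P f) c < e"
  proof eventually_elim
    case (elim P)
    have "cmod (box_avg P f - box_avg P f') \<le> box_avg P (\<lambda>x. cmod (f x - f' x))"
      using norm_box_avg_le[of P "\<lambda>x. f x - f' x"] by (simp add: box_avg_diff)
    also have "\<dots> \<le> box_avg P w" using *(3) by (intro box_avg_mono) auto
    finally have "cmod (box_avg P f - box_avg P f') < 2 * \<epsilon>" using elim by linarith
    then have "dist (box_avg P f) c < 2 * \<epsilon> + \<epsilon> + \<epsilon>" using elim *(2) unfolding dist_norm by norm
    then show ?case using \<open>e > 0\<close> by (simp add: \<epsilon>_def)
  qed
qed

text \<open>Over a box the exponential sum factors over the coordinates. The factor at
  \<open>k\<close> is a geometric sum with ratio different from 1, bounded independently of the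
  length and position of the box; the others are bounded by their side lengths.\<close>

lemma has_box_mean_iexp_eq_0:
  fixes \<alpha> :: "real^'n"
  assumes "\<alpha> $ k \<notin> \<int>"
  shows "has_box_mean (\<lambda>x. iexp (2 * pi * (\<alpha> \<bullet> of_int_vec x))) 0"
  unfolding has_box_mean_def
proof (rule tendstoI)
  fix e :: real assume "e > 0"
  let ?w = "\<lambda>j. iexp (2 * pi * \<alpha> $ j)"
  have w1: "?w k \<noteq> 1"
  proof
    assume "?w k = 1"
    then obtain n :: int where "2 * pi * \<alpha> $ k = of_int n * 2 * pi" by (auto simp: exp_eq_1)
    then have "\<alpha> $ k = of_int n" by simp
    then show False using assms by simp
  qed
  define C where "C = 2 / cmod (1 - ?w k)"
  have "C > 0" using w1 by (simp add: C_def)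
  have iexp_powi: "iexp (2 * pi * (\<alpha> $ j * of_int (a + int i))) = iexp (2 * pi * \<alpha> $ j * of_int a) * ?w j ^ i" for j a i
    by (simp add: exp_of_nat_mult[symmetric] exp_add[symmetric] algebra_simps)
  have fac: "(\<Sum>y\<in>{a..<a + int l}. iexp (2 * pi * (\<alpha> $ j * of_int y))) =
      iexp (2 * pi * \<alpha> $ j * of_int a) * (\<Sum>i<l. ?w j ^ i)" for a l j
  proof -
    have "bij_betw (\<lambda>i. a + int i) {..<l} {a..<a + int l}"
      by (rule bij_betwI[where g = "\<lambda>y. nat (y - a)"]) auto
    from sum.reindex_bij_betw[OF this, of "\<lambda>y. iexp (2 * pi * (\<alpha> $ j * of_int y))"] show ?thesis
      by (simp only: iexp_powi sum_distrib_left)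
  qed
  have bound: "cmod (box_avg P (\<lambda>x. iexp (2 * pi * (\<alpha> \<bullet> of_int_vec x)))) \<le> C / real N"
    if P: "P \<in> lattice_boxes N" and N: "N \<ge> 1" for P N
  proof -
    obtain a l where al: "P = lattice_box a l" "\<forall>j. N \<le> l $ j" using P by (auto simp: lattice_boxes_def)
    have lpos: "l $ j > 0" for j using al(2) N by (meson less_le_trans zero_less_one)
    have "(\<Sum>x\<in>P. iexp (2 * pi * (\<alpha> \<bullet> of_int_vec x))) =
        (\<Sum>g\<in>PiE UNIV (\<lambda>j. {a $ j..<a $ j + int (l $ j)}). iexp (2 * pi * (\<alpha> \<bullet> of_int_vec (vec_lambda g))))"
      unfolding al by (rule sum.reindex_bij_betw[OF lattice_box_bij, symmetric])
    also have "\<dots> = (\<Sum>g\<in>PiE UNIV (\<lambda>j. {a $ j..<a $ j + int (l $ j)}). \<Prod>j\<in>UNIV. iexp (2 * pi * (\<alpha> $ j * of_int (g j))))"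
      by (intro sum.cong refl) (simp add: inner_vec_def exp_sum[symmetric] sum_distrib_left)
    also have "\<dots> = (\<Prod>j\<in>UNIV. \<Sum>y\<in>{a $ j..<a $ j + int (l $ j)}. iexp (2 * pi * (\<alpha> $ j * of_int y)))"
      by (rule prod_sum_PiE[symmetric]) auto
    also have "cmod \<dots> = (\<Prod>j\<in>UNIV. cmod (\<Sum>i<l $ j. ?w j ^ i))"
      unfolding fac by (simp add: prod_norm[symmetric] norm_mult)
    also have "\<dots> \<le> (\<Prod>j\<in>UNIV. if j = k then C else real (l $ j))"
    proof (rule prod_mono, safe)
      fix j
      show "cmod (\<Sum>i<l $ j. ?w j ^ i) \<le> (if j = k then C else real (l $ j))"
      proof (cases "j = k")
        case True
        have "cmod (\<Sum>i<l $ k. ?w k ^ i) = cmod (1 - ?w k ^ (l $ k)) / cmod (1 - ?w k)"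
          using w1 by (simp add: geometric_sum norm_divide norm_minus_commute)
        also have "cmod (1 - ?w k ^ (l $ k)) \<le> cmod 1 + cmod (?w k ^ (l $ k))" by (rule norm_triangle_ineq4)
        also have "\<dots> = 2" by (simp add: norm_power)
        finally show ?thesis using True by (simp add: C_def divide_right_mono)
      next
        case False
        have "cmod (\<Sum>i<l $ j. ?w j ^ i) \<le> (\<Sum>i<l $ j. cmod (?w j ^ i))" by (rule norm_sum)
        also have "\<dots> = real (l $ j)" by (simp add: norm_power)
        finally show ?thesis using False by simp
      qed
    qed simp
    also have "\<dots> = C * (\<Prod>j\<in>UNIV - {k}. real (l $ j))"
      by (subst prod.remove[of UNIV k]) (auto intro!: prod.cong)
    finally have num: "cmod (\<Sum>x\<in>P. iexp (2 * pi * (\<alpha> \<bullet> of_int_vec x))) \<le> C * (\<Prod>j\<in>UNIV - {k}. real (l $ j))" .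
    have card: "real (card P) = real (l $ k) * (\<Prod>j\<in>UNIV - {k}. real (l $ j))"
      unfolding al card_lattice_box of_nat_prod by (subst prod.remove[of UNIV k]) auto
    have pos: "0 < (\<Prod>j\<in>UNIV - {k}. real (l $ j))" using lpos by (intro prod_pos) auto
    have "cmod (box_avg P (\<lambda>x. iexp (2 * pi * (\<alpha> \<bullet> of_int_vec x)))) \<le> C * (\<Prod>j\<in>UNIV - {k}. real (l $ j)) / real (card P)"
      using num by (simp add: box_avg_def divide_inverse_commute mult_left_mono)
    also have "\<dots> = C / real (l $ k)"
      unfolding card using pos by (intro nonzero_mult_divide_mult_cancel_right) linarith
    also have "\<dots> \<le> C / real N" using al(2) N \<open>C > 0\<close> lpos[of k] by (intro divide_left_mono) auto
    finally show ?thesis .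
  qed
  obtain N where N: "real N > C / e" using reals_Archimedean2 by blast
  then have N1: "N \<ge> 1" using \<open>C > 0\<close> \<open>e > 0\<close>
    by (metis divide_pos_pos less_one linorder_not_less of_nat_0 order.asym)
  then have "C / real N < e" using N \<open>e > 0\<close> by (simp add: field_simps)
  then show "\<forall>\<^sub>F P in boxes_at_top. dist (box_avg P (\<lambda>x. iexp (2 * pi * (\<alpha> \<bullet> of_int_vec x)))) 0 < e"
    unfolding eventually_boxes_at_top using N1 bound[OF _ N1] by (auto intro!: exI[of _ N] intro: le_less_trans)
qed

lemma abs_cos_sin_diff_le:
  fixes x y :: real
  shows "\<bar>cos x - cos y\<bar> \<le> \<bar>x - y\<bar>" "\<bar>sin x - sin y\<bar> \<le> \<bar>x - y\<bar>"
proof -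
  have "\<bar>sin ((y - x) / 2)\<bar> \<le> \<bar>x - y\<bar> / 2" "\<bar>sin ((x - y) / 2)\<bar> \<le> \<bar>x - y\<bar> / 2"
    using abs_sin_x_le_abs_x[of "(y - x) / 2"] abs_sin_x_le_abs_x[of "(x - y) / 2"] by (simp_all add: abs_minus_commute)
  then have "\<bar>sin ((x + y) / 2)\<bar> * \<bar>sin ((y - x) / 2)\<bar> \<le> 1 * (\<bar>x - y\<bar> / 2)"
    "\<bar>sin ((x - y) / 2)\<bar> * \<bar>cos ((x + y) / 2)\<bar> \<le> (\<bar>x - y\<bar> / 2) * 1"
    by (intro mult_mono abs_sin_le_one abs_cos_le_one; simp)+
  then show "\<bar>cos x - cos y\<bar> \<le> \<bar>x - y\<bar>" "\<bar>sin x - sin y\<bar> \<le> \<bar>x - y\<bar>"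
    unfolding cos_diff_cos sin_diff_sin abs_mult by simp_all
qed

section \<open>Integral combinations of the rows of powers of \<open>L\<close>\<close>

lemma matpow_0 [simp]: "matpow A 0 = mat 1" and matpow_Suc: "matpow A (Suc k) = A ** matpow A k"
  by (simp_all add: matpow_def)

lemma row_comb_inner:
  fixes A :: "nat \<Rightarrow> real^'n^'n"
  shows "(\<Sum>j\<in>J. of_int_vec (m j) \<bullet> (A j *v x)) = (\<Sum>j\<in>J. \<Sum>i\<in>UNIV. of_int (m j $ i) *\<^sub>R row i (A j)) \<bullet> x"
  by (simp add: inner_sum_left inner_vec_def[of "of_int_vec _"] matrix_vector_mult_def row_def inner_vec_def[of "vec_lambda _"])
    (simp add: inner_vec_def)

text \<open>An integral vector is a combination of rows of the identity, so an integral combination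
  of rows of the powers yields a rational relation in the stacked matrix; nonresonance makes all its
  coefficients vanish. The exponent 0 is excluded, since its rows are those of the identity.\<close>

lemma iteratively_nonresonant_frequency:
  fixes L :: "real^'n^'n" and m :: "nat \<Rightarrow> int^'n"
  assumes L: "iteratively_nonresonant L" and J: "finite J" "0 \<notin> J"
    and int: "\<And>k. (\<Sum>j\<in>J. \<Sum>i\<in>UNIV. of_int (m j $ i) *\<^sub>R row i (matpow L j)) $ k \<in> \<int>"
  shows "\<forall>j\<in>J. m j = 0"
proof -
  let ?I = "(int ` J) \<times> (UNIV :: 'n set)"
  have "finite ?I" "?I \<subseteq> (UNIV - {0}) \<times> UNIV" using J by auto
  then have nr: "nonresonant ?I (\<lambda>(k, i). row i (matpowi L k))"
    using L by (simp add: iteratively_nonresonant_def)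
  have "\<exists>n::int. (\<Sum>j\<in>J. \<Sum>i\<in>UNIV. of_int (m j $ i) *\<^sub>R row i (matpow L j)) $ k = of_int n" for k
    using int[of k] unfolding Ints_def by (rule imageE) blast
  then obtain z :: "'n \<Rightarrow> int" where
    z: "(\<Sum>j\<in>J. \<Sum>i\<in>UNIV. of_int (m j $ i) *\<^sub>R row i (matpow L j)) $ k = of_int (z k)" for k
    using choice[of "\<lambda>k n. (\<Sum>j\<in>J. \<Sum>i\<in>UNIV. of_int (m j $ i) *\<^sub>R row i (matpow L j)) $ k = of_int n"] by blast
  define c :: "'n + int \<times> 'n \<Rightarrow> rat" where "c = case_sum (\<lambda>k. - of_int (z k)) (\<lambda>(k, i). of_int (m (nat k) $ i))"
  have "(\<Sum>p\<in>UNIV <+> ?I. of_rat (c p) *\<^sub>R case_sum (\<lambda>j. axis j 1) (\<lambda>(k, i). row i (matpowi L k)) p)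
      = (\<Sum>k\<in>UNIV. - of_int (z k) *\<^sub>R axis k 1) + (\<Sum>p\<in>?I. of_int (m (nat (fst p)) $ snd p) *\<^sub>R row (snd p) (matpowi L (fst p)))"
    using J by (subst sum.Plus) (auto simp: c_def of_rat_minus split_beta intro!: sum.cong)
  also have "(\<Sum>p\<in>?I. of_int (m (nat (fst p)) $ snd p) *\<^sub>R row (snd p) (matpowi L (fst p))) =
      (\<Sum>k\<in>int ` J. \<Sum>i\<in>UNIV. of_int (m (nat k) $ i) *\<^sub>R row i (matpowi L k))"
    by (simp add: sum.cartesian_product split_beta)
  also have "\<dots> = (\<Sum>j\<in>J. \<Sum>i\<in>UNIV. of_int (m j $ i) *\<^sub>R row i (matpow L j))"
    by (subst sum.reindex) (auto simp: matpowi_def)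
  also have "(\<Sum>k\<in>UNIV. - of_int (z k) *\<^sub>R axis k 1) + \<dots> = (0 :: real^'n)"
    unfolding vec_eq_iff by (simp only: vector_add_component z) (simp add: axis_def if_distrib cong: if_cong)
  finally have "\<forall>p\<in>UNIV <+> ?I. c p = 0" using nr unfolding nonresonant_def rat_independent_def by blast
  then have c0: "c p = 0" if "p \<in> UNIV <+> ?I" for p using that by (rule bspec)
  have "m j $ i = 0" if "j \<in> J" for j i
  proof -
    have "(Inr (int j, i) :: 'n + int \<times> 'n) \<in> UNIV <+> ?I" using that by (intro InrI) auto
    from c0[OF this] show ?thesis by (simp add: c_def)
  qed
  then show ?thesis by (simp add: vec_eq_iff)
qed

section \<open>Induction over time for the joint distribution of the errors\<close>

context
  fixes R :: "real^'n \<Rightarrow> int^'n" and L :: "real^'n^'n"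
  assumes R: "quantizer R" and L: "iteratively_nonresonant L"
begin

abbreviation (input) err :: "nat \<Rightarrow> int^'n \<Rightarrow> real^'n" where
  "err \<equiv> q_error_at R L"

lemma err_Suc: "err (Suc k) x = L *v of_int_vec ((q_map R L ^^ k) x) - of_int_vec ((q_map R L ^^ Suc k) x)"
  by (simp add: q_error_at_def q_error_def)

text \<open>The perturbed linear recursion is solved explicitly. It shows that modulo the lattice
  the newest error is a power of \<open>L\<close> applied to \<open>x\<close> minus a linear
  function of the earlier errors.\<close>

lemma q_map_iterate:
  "of_int_vec ((q_map R L ^^ k) x) = matpow L k *v of_int_vec x - (\<Sum>j\<in>{1..k}. matpow L (k - j) *v err j x)"
proof (induction k)
  case (Suc k)
  have "of_int_vec ((q_map R L ^^ Suc k) x) = L *v of_int_vec ((q_map R L ^^ k) x) - err (Suc k) x"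
    by (simp add: err_Suc)
  also have "\<dots> = matpow L (Suc k) *v of_int_vec x - (\<Sum>j\<in>{1..k}. L *v (matpow L (k - j) *v err j x)) - err (Suc k) x"
    unfolding Suc by (simp add: matrix_vector_mult_diff_distrib matpow_Suc matrix_vector_mul_assoc
      linear_sum[OF matrix_vector_mul_linear])
  also have "(\<Sum>j\<in>{1..k}. L *v (matpow L (k - j) *v err j x)) = (\<Sum>j\<in>{1..k}. matpow L (Suc k - j) *v err j x)"
    by (intro sum.cong refl) (simp add: Suc_diff_le matpow_Suc matrix_vector_mul_assoc)
  finally show ?case by simp
qed simp

lemma err_in_cell: "1 \<le> k \<Longrightarrow> R (err k x) = 0"
  using quantizer_error_in_cell[OF R] by (simp add: q_error_at_def q_error_def q_map_def)

text \<open>Multiplication by this truncation turns functions of \<open>u - R u\<close>, which are discontinuous in \<open>u\<close>,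
  into continuous ones.\<close>

definition cell_cutoff :: "real \<Rightarrow> real^'n \<Rightarrow> real" where
  "cell_cutoff d u = min 1 (infdist (u - of_int_vec (R u)) (- q_cell R) / d)"

text \<open>The cell cannot contain two points that differ by a nonzero lattice vector. This makes
  \<open>infdist\<close> to the complement a true distance.\<close>

lemma compl_q_cell_nonempty: "- q_cell R \<noteq> {}"
proof
  assume "- q_cell R = {}"
  then have "R (of_int_vec 1) = 0" "R 0 = 0" by auto
  then show False using quantizer_shift[OF R, of 0 1] by (simp add: vec_eq_iff)
qed

lemma cell_cutoff_bounds: "d > 0 \<Longrightarrow> 0 \<le> cell_cutoff d u \<and> cell_cutoff d u \<le> 1"
  by (simp add: cell_cutoff_def infdist_nonneg)

text \<open>If \<open>u\<close> and \<open>v\<close> lie in different translates of the cell, then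
  \<open>v\<close> is outside the translate containing \<open>u\<close>, so \<open>u\<close> is at
  most \<open>dist u v\<close> away from the complement of that translate.\<close>

lemma cell_cutoff_near:
  assumes "d > 0" "R u \<noteq> R v"
  shows "cell_cutoff d u \<le> dist u v / d"
proof -
  have "v - of_int_vec (R u) \<in> - q_cell R" using assms(2) by (simp add: quantizer_diff[OF R])
  then have "infdist (u - of_int_vec (R u)) (- q_cell R) \<le> dist (u - of_int_vec (R u)) (v - of_int_vec (R u))"
    by (rule infdist_le)
  also have "\<dots> = dist u v" by (simp add: dist_norm)
  finally show ?thesis using assms(1) by (auto simp: cell_cutoff_def min_le_iff_disj divide_right_mono)
qed

text \<open>Within one translate of the cell this is the product rule for bounded Lipschitz
  functions; across translates the cutoff is small at both points, which absorbs the jump.\<close>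

lemma continuous_cell_function:
  fixes g :: "real^'n \<Rightarrow> real"
  assumes d: "d > 0" and lip: "\<And>u v. \<bar>g u - g v\<bar> \<le> K * dist u v" and bd: "\<And>u. \<bar>g u\<bar> \<le> M"
  shows "continuous_on UNIV (\<lambda>u. g (u - of_int_vec (R u)) * cell_cutoff d u)"
proof (rule lipschitz_imp_continuous_on)
  fix u v
  have K: "0 \<le> K"
  proof -
    have "0 \<le> \<bar>g (axis undefined 1) - g 0\<bar>" by simp
    also have "\<dots> \<le> K * dist (axis undefined 1) (0 :: real^'n)" by (rule lip)
    finally show ?thesis by (simp add: zero_le_mult_iff)
  qed
  have M: "0 \<le> M" using bd[of 0] by linarith
  let ?u = "u - of_int_vec (R u)" and ?v = "v - of_int_vec (R v)"
  show "dist (g ?u * cell_cutoff d u) (g ?v * cell_cutoff d v) \<le> (K + 2 * M / d) * dist u v"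
  proof (cases "R u = R v")
    case True
    have duv: "dist ?u ?v = dist u v" using True by (simp add: dist_norm)
    have "\<bar>cell_cutoff d u - cell_cutoff d v\<bar> \<le> \<bar>infdist ?u (- q_cell R) / d - infdist ?v (- q_cell R) / d\<bar>"
      unfolding cell_cutoff_def by linarith
    also have "\<dots> = \<bar>infdist ?u (- q_cell R) - infdist ?v (- q_cell R)\<bar> / d"
      using d by (simp flip: diff_divide_distrib)
    also have "\<dots> \<le> dist u v / d"
      using d infdist_triangle_abs[of ?u "- q_cell R" ?v] duv by (intro divide_right_mono) auto
    finally have 1: "\<bar>cell_cutoff d u - cell_cutoff d v\<bar> \<le> dist u v / d" .
    have "g ?u * cell_cutoff d u - g ?v * cell_cutoff d v =
        (g ?u - g ?v) * cell_cutoff d u + g ?v * (cell_cutoff d u - cell_cutoff d v)" by (simp add: algebra_simps)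
    also have "\<bar>\<dots>\<bar> \<le> \<bar>g ?u - g ?v\<bar> * 1 + M * (dist u v / d)"
      using mult_mono[OF bd[of ?v] 1 M abs_ge_zero] mult_left_mono[OF _ abs_ge_zero, of "\<bar>cell_cutoff d u\<bar>" 1 "g ?u - g ?v"]
        cell_cutoff_bounds[OF d, of u]
      by (intro order_trans[OF abs_triangle_ineq] add_mono) (simp_all only: abs_mult abs_of_nonneg)
    also have "\<dots> \<le> K * dist u v + 2 * (M * (dist u v / d))"
      using lip[of ?u ?v] mult_nonneg_nonneg[OF M, of "dist u v / d"] d unfolding duv by (intro add_mono) auto
    finally show ?thesis by (simp add: dist_real_def algebra_simps)
  next
    case False
    have "\<bar>g ?u * cell_cutoff d u - g ?v * cell_cutoff d v\<bar> \<le> \<bar>g ?u\<bar> * cell_cutoff d u + \<bar>g ?v\<bar> * cell_cutoff d v"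
      using cell_cutoff_bounds[OF d] by (intro order_trans[OF abs_triangle_ineq4]) (auto simp: abs_mult)
    also have "\<dots> \<le> M * (dist u v / d) + M * (dist u v / d)"
      using cell_cutoff_near[OF d False] cell_cutoff_near[OF d False[symmetric]] bd M cell_cutoff_bounds[OF d]
      by (intro add_mono mult_mono) (auto simp: dist_commute)
    also have "\<dots> \<le> (K + 2 * M / d) * dist u v" using K by (simp add: algebra_simps)
    finally show ?thesis by (simp add: dist_real_def)
  qed
qed

text \<open>Every interior point has positive distance to the complement of the cell, so the cutoff
  eventually equals 1 there.\<close>

lemma integral_cell_cutoff_tendsto:
  "(\<lambda>n. LINT u|cell_measure R. cell_cutoff (1 / real (Suc n)) u) \<longlonglongrightarrow> 1"
proof -
  interpret prob_space "cell_measure R" by (rule prob_space_cell_measure[OF R])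
  have "(\<lambda>n. LINT u|cell_measure R. cell_cutoff (1 / real (Suc n)) u) \<longlonglongrightarrow> (LINT u|cell_measure R. (1::real))"
  proof (rule integral_dominated_convergence[where w = "\<lambda>_. 1"])
    show "AE u in cell_measure R. (\<lambda>n. cell_cutoff (1 / real (Suc n)) u) \<longlonglongrightarrow> 1"
      using AE_cell_measure
    proof eventually_elim
      case (elim u)
      then have "u \<notin> closure (- q_cell R)" by (simp add: closure_complement)
      then have p: "infdist u (- q_cell R) > 0"
        using compl_q_cell_nonempty in_closure_iff_infdist_zero infdist_nonneg by (metis less_le)
      have "R u = 0" using elim interior_subset by fastforce
      obtain k where k: "1 / infdist u (- q_cell R) < real k" using reals_Archimedean2 by blast
      have "cell_cutoff (1 / real (Suc n)) u = 1" if "n \<ge> k" for n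
      proof -
        have "1 / infdist u (- q_cell R) < real (Suc n)" using k that by linarith
        then have "1 < real (Suc n) * infdist u (- q_cell R)" using p by (simp add: divide_less_eq)
        then show ?thesis using \<open>R u = 0\<close> by (simp add: cell_cutoff_def mult.commute)
      qed
      then show ?case by (intro tendsto_eventually) (auto simp: eventually_sequentially)
    qed
    have "continuous_on UNIV (\<lambda>u. 1 * cell_cutoff (1 / real (Suc n)) u)" for n
      by (rule continuous_cell_function[where K = 0 and M = 1]) auto
    then show "cell_cutoff (1 / real (Suc n)) \<in> borel_measurable (cell_measure R)" for n
      using borel_measurable_continuous_onI by (auto cong: measurable_cong_sets)
    show "AE u in cell_measure R. norm (cell_cutoff (1 / real (Suc n)) u) \<le> 1" for n
      using cell_cutoff_bounds[of "1 / real (Suc n)"] by auto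
  qed auto
  then show ?thesis using prob_space by simp
qed

text \<open>Invariant of the induction over \<open>k\<close>: the errors up to time \<open>k\<close> are independent and uniform on the
  cell, also jointly with the remaining powers \<open>L\<^sup>j x\<close> modulo the lattice.\<close>

definition joint_mean :: "nat \<Rightarrow> nat \<Rightarrow> bool" where
  "joint_mean K k \<longleftrightarrow> (\<forall>a m. has_box_mean
     (\<lambda>x. iexp ((\<Sum>j\<in>{1..k}. a j \<bullet> err j x) + 2 * pi * (\<Sum>j\<in>{k<..K}. of_int_vec (m j) \<bullet> (matpow L j *v of_int_vec x))))
     (if \<forall>j\<in>{k<..K}. m j = (0::int^'n) then \<Prod>j\<in>{1..k}. cell_char R (a j) else 0))"

text \<open>Here only the torus points remain: the phase is given by a single frequency vector in
  \<open>x\<close>, and nonresonance prevents it from being integral unless all the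
  \<open>m j\<close> involved vanish.\<close>

lemma joint_mean_0: "joint_mean K 0"
  unfolding joint_mean_def
proof (intro allI)
  fix a :: "nat \<Rightarrow> real^'n" and m :: "nat \<Rightarrow> int^'n"
  define \<alpha> where "\<alpha> = (\<Sum>j\<in>{0<..K}. \<Sum>i\<in>UNIV. of_int (m j $ i) *\<^sub>R row i (matpow L j))"
  have \<alpha>: "(\<Sum>j\<in>{0<..K}. of_int_vec (m j) \<bullet> (matpow L j *v of_int_vec x)) = \<alpha> \<bullet> of_int_vec x" for x
    unfolding \<alpha>_def by (rule row_comb_inner)
  show "has_box_mean (\<lambda>x. iexp ((\<Sum>j\<in>{1..0}. a j \<bullet> err j x) + 2 * pi * (\<Sum>j\<in>{0<..K}. of_int_vec (m j) \<bullet> (matpow L j *v of_int_vec x))))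
     (if \<forall>j\<in>{0<..K}. m j = 0 then \<Prod>j\<in>{1..0}. cell_char R (a j) else 0)"
  proof (cases "\<forall>j\<in>{0<..K}. m j = 0")
    case True
    then show ?thesis using has_box_mean_const[of 1] by simp
  next
    case False
    then obtain k where "\<alpha> $ k \<notin> \<int>"
      using iteratively_nonresonant_frequency[OF L, of "{0<..K}" m] unfolding \<alpha>_def by fastforce
    then show ?thesis unfolding \<alpha> if_not_P[OF False] using has_box_mean_iexp_eq_0[of \<alpha> k] by simp
  qed
qed

text \<open>The phase of the new error at a lattice frequency is, up to an integer multiple of
  \<open>2 * pi\<close>, a phase of the earlier errors and of the torus point at time
  \<open>Suc k\<close>, so the induction hypothesis gives its mean. Lattice frequencies determine
  the mean for every continuous periodic function of the error. For a general frequency the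
  exponential is made periodic through \<open>u - R u\<close>, which agrees with \<open>u\<close> on
  the cell, and continuous by the cutoff.\<close>

lemma joint_mean_Suc:
  assumes IH: "joint_mean K k" and "k < K"
  shows "joint_mean K (Suc k)"
  unfolding joint_mean_def
proof (intro allI)
  interpret prob_space "cell_measure R" by (rule prob_space_cell_measure[OF R])
  let ?E = "err (Suc k)"
  define Y where "Y a m x = iexp ((\<Sum>j\<in>{1..k}. a j \<bullet> err j x) + 2 * pi * (\<Sum>j\<in>{Suc k<..K}. of_int_vec (m j) \<bullet> (matpow L j *v of_int_vec x)))"
    for a :: "nat \<Rightarrow> real^'n" and m :: "nat \<Rightarrow> int^'n" and x
  define c where "c a m = (if \<forall>j\<in>{Suc k<..K}. m j = 0 then \<Prod>j\<in>{1..k}. cell_char R (a j) else 0)"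
    for a :: "nat \<Rightarrow> real^'n" and m :: "nat \<Rightarrow> int^'n"
  have nY: "cmod (Y a m x) = 1" for a m x by (simp add: Y_def)
  have nc: "cmod (c a m) \<le> 1" for a m
    unfolding c_def using norm_cell_char_le[OF R] by (auto simp: prod_norm[symmetric] intro!: prod_le_1)
  have ins: "{k<..K} = insert (Suc k) {Suc k<..K}" using \<open>k < K\<close> by auto
  have phase_mean: "has_box_mean (\<lambda>x. Y a m x * iexp (2 * pi * (of_int_vec z \<bullet> ?E x))) (c a m * cell_char R ((2 * pi) *\<^sub>R of_int_vec z))"
    for a m z
  proof -
    \<comment> \<open>Transposition moves the powers of \<open>L\<close> from the earlier errors
      onto their frequencies; the slot \<open>Suc k\<close> of the torus frequencies receives
      \<open>z\<close>.\<close>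
    define a' where "a' j = a j - (2 * pi) *\<^sub>R (transpose (matpow L (Suc k - j)) *v of_int_vec z)" for j
    define m' where "m' = m(Suc k := z)"
    have eq1: "Y a m x * iexp (2 * pi * (of_int_vec z \<bullet> ?E x)) =
        iexp ((\<Sum>j\<in>{1..k}. a' j \<bullet> err j x) + 2 * pi * (\<Sum>j\<in>{k<..K}. of_int_vec (m' j) \<bullet> (matpow L j *v of_int_vec x)))" for x
    proof -
      let ?t = "of_int_vec z \<bullet> (of_int_vec ((q_map R L ^^ Suc k) x) :: real^'n)"
      have "?E x = matpow L (Suc k) *v of_int_vec x - (\<Sum>j\<in>{1..k}. matpow L (Suc k - j) *v err j x) - of_int_vec ((q_map R L ^^ Suc k) x)"
        using q_map_iterate[of "Suc k" x] by (simp add: algebra_simps)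
      then have zE: "of_int_vec z \<bullet> ?E x = of_int_vec z \<bullet> (matpow L (Suc k) *v of_int_vec x)
          - (\<Sum>j\<in>{1..k}. (transpose (matpow L (Suc k - j)) *v of_int_vec z) \<bullet> err j x) - ?t"
        by (simp add: inner_diff_right inner_sum_right dot_lmul_matrix[symmetric] matrix_vector_mul_assoc transpose_matrix_vector)
      have s1: "(\<Sum>j\<in>{1..k}. a' j \<bullet> err j x) = (\<Sum>j\<in>{1..k}. a j \<bullet> err j x) - 2 * pi * (\<Sum>j\<in>{1..k}. (transpose (matpow L (Suc k - j)) *v of_int_vec z) \<bullet> err j x)"
        by (simp add: a'_def inner_diff_left sum_subtractf sum_distrib_left)
      have s2: "(\<Sum>j\<in>{k<..K}. of_int_vec (m' j) \<bullet> (matpow L j *v of_int_vec x)) =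
          of_int_vec z \<bullet> (matpow L (Suc k) *v of_int_vec x) + (\<Sum>j\<in>{Suc k<..K}. of_int_vec (m j) \<bullet> (matpow L j *v of_int_vec x))"
        unfolding ins by (subst sum.insert) (auto simp: m'_def intro!: sum.cong)
      have "iexp ((\<Sum>j\<in>{1..k}. a' j \<bullet> err j x) + 2 * pi * (\<Sum>j\<in>{k<..K}. of_int_vec (m' j) \<bullet> (matpow L j *v of_int_vec x)))
        = iexp (((\<Sum>j\<in>{1..k}. a j \<bullet> err j x) + 2 * pi * (\<Sum>j\<in>{Suc k<..K}. of_int_vec (m j) \<bullet> (matpow L j *v of_int_vec x))
           + 2 * pi * (of_int_vec z \<bullet> ?E x)) + 2 * pi * ?t)"
        unfolding s1 s2 zE by (rule arg_cong[where f = "\<lambda>y. iexp y"]) (simp add: algebra_simps)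
      also have "\<dots> = iexp ((\<Sum>j\<in>{1..k}. a j \<bullet> err j x) + 2 * pi * (\<Sum>j\<in>{Suc k<..K}. of_int_vec (m j) \<bullet> (matpow L j *v of_int_vec x))
           + 2 * pi * (of_int_vec z \<bullet> ?E x))"
        by (rule iexp_add_2pi_Ints[OF inner_of_int_vec_Ints])
      also have "\<dots> = Y a m x * iexp (2 * pi * (of_int_vec z \<bullet> ?E x))"
        by (simp only: Y_def of_real_add distrib_left exp_add)
      finally show ?thesis by simp
    qed
    \<comment> \<open>For nonzero \<open>z\<close> both sides vanish: the torus point at time
      \<open>Suc k\<close> has mean zero, and so has the lattice character on the cell.\<close>
    have eq2: "(if \<forall>j\<in>{k<..K}. m' j = 0 then \<Prod>j\<in>{1..k}. cell_char R (a' j) else 0) = c a m * cell_char R ((2 * pi) *\<^sub>R of_int_vec z)"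
    proof (cases "z = 0")
      case True
      then have "a' = a" by (simp add: a'_def fun_eq_iff)
      moreover have "(\<forall>j\<in>{k<..K}. m' j = 0) \<longleftrightarrow> (\<forall>j\<in>{Suc k<..K}. m j = 0)"
        unfolding ins using True by (auto simp: m'_def)
      ultimately show ?thesis using True cell_char_0[OF R] by (simp add: c_def)
    next
      case False
      then have "\<not> (\<forall>j\<in>{k<..K}. m' j = 0)" unfolding ins by (simp add: m'_def)
      then show ?thesis unfolding if_not_P[OF \<open>\<not> (\<forall>j\<in>{k<..K}. m' j = 0)\<close>] using False by (simp add: cell_char_2pi[OF R])
    qed
    show ?thesis unfolding eq1 eq2[symmetric]
      by (rule IH[unfolded joint_mean_def, THEN spec, THEN spec])
  qed
  have trig: "has_box_mean (\<lambda>x. Y a m x * p (?E x)) (c a m * (LINT u|cell_measure R. p u)) \<and> integrable (cell_measure R) p"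
    if "trig_poly lattice_phases p" for p a m
    using that
  proof induction
    case (phase p d)
    then obtain z where p: "p = (\<lambda>u. 2 * pi * (of_int_vec z \<bullet> u))" by (auto simp: lattice_phases_def)
    have int: "integrable (cell_measure R) (\<lambda>u. iexp (2 * pi * (of_int_vec z \<bullet> u)))"
      by (intro integrable_const_bound[of _ 1]) auto
    have "(LINT u|cell_measure R. iexp (2 * pi * (of_int_vec z \<bullet> u))) = cell_char R ((2 * pi) *\<^sub>R of_int_vec z)"
      by (simp add: cell_char_def)
    then show ?case using has_box_mean_cmult[OF phase_mean[of a m z], of d] int unfolding p by (simp add: mult_ac)
  next
    case (add f g)
    then show ?case using has_box_mean_add[of "\<lambda>x. Y a m x * f (?E x)" _ "\<lambda>x. Y a m x * g (?E x)"]
      by (auto simp: distrib_left)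
  qed
  have cont: "has_box_mean (\<lambda>x. Y a m x * of_real (f (?E x))) (c a m * of_real (LINT u|cell_measure R. f u))"
    if f: "continuous_on UNIV f" "periodic f" "\<And>u. \<bar>f u\<bar> \<le> M" for f :: "real^'n \<Rightarrow> real" and M a m
  proof (rule has_box_mean_approx)
    fix e :: real assume "e > 0"
    obtain p where p: "trig_poly lattice_phases p" "\<And>u. cmod (p u - of_real (f u)) \<le> e"
      using periodic_trig_approximation[OF f(1,2) \<open>e > 0\<close>] by blast
    have intf: "integrable (cell_measure R) (\<lambda>u. complex_of_real (f u))"
      using borel_measurable_continuous_onI[OF f(1)] f(3) by (intro integrable_const_bound[of _ M]) auto
    have intp: "integrable (cell_measure R) p" using trig[OF p(1)] by blast
    have "c a m * (LINT u|cell_measure R. p u) - c a m * of_real (LINT u|cell_measure R. f u)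
       = c a m * (LINT u|cell_measure R. p u - of_real (f u))"
      using intp intf by (simp add: right_diff_distrib)
    also have "cmod \<dots> \<le> 1 * (LINT u|cell_measure R. cmod (p u - of_real (f u)))"
      unfolding norm_mult by (intro mult_mono nc integral_norm_bound) auto
    also have "\<dots> \<le> (LINT u|cell_measure R. e)"
      using p(2) intp intf unfolding mult_1 by (intro integral_mono) auto
    also have "\<dots> = e" using prob_space by simp
    finally have 1: "cmod (c a m * (LINT u|cell_measure R. p u) - c a m * of_real (LINT u|cell_measure R. f u)) \<le> e" .
    have 2: "cmod (Y a m x * of_real (f (?E x)) - Y a m x * p (?E x)) \<le> e" for x
      using p(2)[of "?E x"] nY[of a m x] by (simp add: norm_mult norm_minus_commute flip: right_diff_distrib)
    show "\<exists>f' c' w d. has_box_mean f' c' \<and> cmod (c' - c a m * of_real (LINT u|cell_measure R. f u)) \<le> e \<and>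
      (\<forall>x. cmod (Y a m x * of_real (f (?E x)) - f' x) \<le> w x) \<and> has_box_mean (\<lambda>x. complex_of_real (w x)) (of_real d) \<and> d \<le> e"
      using trig[OF p(1), of a m] 1 2 has_box_mean_const[of "of_real e"]
      by (intro exI[of _ "\<lambda>x. Y a m x * p (?E x)"] exI[of _ "c a m * (LINT u|cell_measure R. p u)"] exI[of _ "\<lambda>_. e"] exI[of _ e]) auto
  qed
  fix a :: "nat \<Rightarrow> real^'n" and m :: "nat \<Rightarrow> int^'n"
  let ?b = "a (Suc k)"
  have "has_box_mean (\<lambda>x. Y a m x * iexp (?b \<bullet> ?E x)) (c a m * cell_char R ?b)"
  proof (rule has_box_mean_approx)
    fix e :: real assume "e > 0"
    have "\<forall>\<^sub>F n in sequentially. (LINT u|cell_measure R. cell_cutoff (1 / real (Suc n)) u) > 1 - e"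
      using integral_cell_cutoff_tendsto \<open>e > 0\<close> by (intro order_tendstoD(1)) auto
    then obtain n where n: "(LINT u|cell_measure R. cell_cutoff (1 / real (Suc n)) u) > 1 - e"
      by (auto simp: eventually_sequentially)
    \<comment> \<open>With this width the cutoff loses mass less than \<open>e\<close> under the
      uniform law.\<close>
    define d where "d = 1 / real (Suc n)"
    have d: "d > 0" by (simp add: d_def)
    let ?\<eta> = "cell_cutoff d"
    have \<eta>01: "0 \<le> ?\<eta> u" "?\<eta> u \<le> 1" for u using cell_cutoff_bounds[OF d] by auto
    let ?u = "\<lambda>u::real^'n. u - of_int_vec (R u)"
    have per\<eta>: "?\<eta> (u + of_int_vec z) = ?\<eta> u" for u z by (simp add: cell_cutoff_def quantizer_shift[OF R])
    have lip: "\<bar>cos (?b \<bullet> u) - cos (?b \<bullet> v)\<bar> \<le> norm ?b * dist u v" "\<bar>sin (?b \<bullet> u) - sin (?b \<bullet> v)\<bar> \<le> norm ?b * dist u v" for u v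
    proof -
      have "\<bar>?b \<bullet> u - ?b \<bullet> v\<bar> \<le> norm ?b * dist u v"
        using Cauchy_Schwarz_ineq2[of ?b "u - v"] by (simp add: inner_diff_right dist_norm)
      then show "\<bar>cos (?b \<bullet> u) - cos (?b \<bullet> v)\<bar> \<le> norm ?b * dist u v" "\<bar>sin (?b \<bullet> u) - sin (?b \<bullet> v)\<bar> \<le> norm ?b * dist u v"
        using abs_cos_sin_diff_le[of "?b \<bullet> u" "?b \<bullet> v"] by linarith+
    qed
    define f1 where "f1 u = cos (?b \<bullet> ?u u) * ?\<eta> u" for u
    define f2 where "f2 u = sin (?b \<bullet> ?u u) * ?\<eta> u" for u
    define \<psi> where "\<psi> u = 1 - ?\<eta> u" for u
    have f1: "continuous_on UNIV f1" "periodic f1" "\<And>u. \<bar>f1 u\<bar> \<le> 1"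
      unfolding f1_def using continuous_cell_function[OF d lip(1), of 1] \<eta>01
      by (auto simp: periodic_def quantizer_shift[OF R] per\<eta> abs_mult intro!: mult_le_one)
    have f2: "continuous_on UNIV f2" "periodic f2" "\<And>u. \<bar>f2 u\<bar> \<le> 1"
      unfolding f2_def using continuous_cell_function[OF d lip(2), of 1] \<eta>01
      by (auto simp: periodic_def quantizer_shift[OF R] per\<eta> abs_mult intro!: mult_le_one)
    have c\<eta>: "continuous_on UNIV ?\<eta>"
      using continuous_cell_function[OF d, of "\<lambda>_. 1" 0 1] by simp
    have \<psi>: "continuous_on UNIV \<psi>" "periodic \<psi>" "\<And>u. \<bar>\<psi> u\<bar> \<le> 1"
      unfolding \<psi>_def using c\<eta> \<eta>01 by (auto simp: periodic_def per\<eta> intro!: continuous_intros)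
    note [measurable] = borel_measurable_continuous_onI[OF f1(1)] borel_measurable_continuous_onI[OF f2(1)]
      borel_measurable_continuous_onI[OF \<psi>(1)] borel_measurable_continuous_onI[OF c\<eta>]
    define F where "F u = complex_of_real (f1 u) + \<i> * of_real (f2 u)" for u
    have F: "F u = iexp (?b \<bullet> u) * of_real (?\<eta> u)" "cmod (iexp (?b \<bullet> u) - F u) \<le> \<psi> u" if "R u = 0" for u
    proof -
      show *: "F u = iexp (?b \<bullet> u) * of_real (?\<eta> u)"
        using that by (simp add: F_def f1_def f2_def complex_eq_iff Re_exp Im_exp)
      have "iexp (?b \<bullet> u) - F u = iexp (?b \<bullet> u) * of_real (\<psi> u)" unfolding * \<psi>_def by (simp add: algebra_simps)
      then have "cmod (iexp (?b \<bullet> u) - F u) = cmod (of_real (\<psi> u))" by (simp add: norm_mult)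
      then show "cmod (iexp (?b \<bullet> u) - F u) \<le> \<psi> u" using \<eta>01[of u] by (simp add: \<psi>_def del: of_real_diff)
    qed
    have int: "integrable (cell_measure R) f1" "integrable (cell_measure R) f2" "integrable (cell_measure R) \<psi>" "integrable (cell_measure R) ?\<eta>"
      "integrable (cell_measure R) (\<lambda>u. iexp (?b \<bullet> u))"
      using f1 f2 \<psi> \<eta>01 by (auto intro!: integrable_const_bound[of _ 1])
    then have intF: "integrable (cell_measure R) F" unfolding F_def by auto
    have IF: "(LINT u|cell_measure R. F u) = of_real (LINT u|cell_measure R. f1 u) + \<i> * of_real (LINT u|cell_measure R. f2 u)"
      using int unfolding F_def by simp
    have "has_box_mean (\<lambda>x. Y a m x * of_real (f1 (?E x)) + \<i> * (Y a m x * of_real (f2 (?E x))))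
       (c a m * of_real (LINT u|cell_measure R. f1 u) + \<i> * (c a m * of_real (LINT u|cell_measure R. f2 u)))"
      by (intro has_box_mean_add has_box_mean_cmult cont[OF f1] cont[OF f2])
    then have 1: "has_box_mean (\<lambda>x. Y a m x * F (?E x)) (c a m * (LINT u|cell_measure R. F u))"
      unfolding F_def[of "?E _"] IF by (simp add: algebra_simps)
    have \<psi>e: "(LINT u|cell_measure R. \<psi> u) \<le> e" using n int prob_space unfolding \<psi>_def d_def by simp
    have AE0: "AE u in cell_measure R. R u = 0"
      using AE_cell_measure by eventually_elim (use interior_subset in fastforce)
    have "c a m * (LINT u|cell_measure R. F u) - c a m * cell_char R ?b
       = c a m * (LINT u|cell_measure R. F u - iexp (?b \<bullet> u))"
      using int intF by (simp add: cell_char_def right_diff_distrib)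
    also have "cmod \<dots> \<le> 1 * (LINT u|cell_measure R. cmod (F u - iexp (?b \<bullet> u)))"
      unfolding norm_mult by (intro mult_mono nc integral_norm_bound) auto
    also have "1 * (LINT u|cell_measure R. cmod (F u - iexp (?b \<bullet> u))) \<le> (LINT u|cell_measure R. \<psi> u)"
      unfolding mult_1
    proof (rule integral_mono_AE)
      show "AE u in cell_measure R. cmod (F u - iexp (?b \<bullet> u)) \<le> \<psi> u"
        using AE0 by eventually_elim (use F(2) in \<open>simp add: norm_minus_commute\<close>)
    qed (use int intF in auto)
    finally have 2: "cmod (c a m * (LINT u|cell_measure R. F u) - c a m * cell_char R ?b) \<le> e" using \<psi>e by linarith
    have 3: "cmod (Y a m x * iexp (?b \<bullet> ?E x) - Y a m x * F (?E x)) \<le> \<psi> (?E x)" for x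
      using F(2)[OF err_in_cell[of "Suc k" x]] nY[of a m x] by (simp add: norm_mult flip: right_diff_distrib)
    \<comment> \<open>With all frequencies zero the factor \<open>Y\<close> is 1, so the continuous
      case gives the mean of the truncation error itself.\<close>
    have "Y (\<lambda>_. 0) (\<lambda>_. 0) x = 1" "c (\<lambda>_. 0) (\<lambda>_. 0) = 1" for x
      by (simp_all add: Y_def c_def cell_char_0[OF R])
    then have 4: "has_box_mean (\<lambda>x. of_real (\<psi> (?E x))) (of_real (LINT u|cell_measure R. \<psi> u))"
      using cont[OF \<psi>, of "\<lambda>_. 0" "\<lambda>_. 0"] by simp
    show "\<exists>f' c' w d. has_box_mean f' c' \<and> cmod (c' - c a m * cell_char R ?b) \<le> e \<and>
      (\<forall>x. cmod (Y a m x * iexp (?b \<bullet> ?E x) - f' x) \<le> w x) \<and> has_box_mean (\<lambda>x. complex_of_real (w x)) (of_real d) \<and> d \<le> e"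
      by (rule exI[of _ "\<lambda>x. Y a m x * F (?E x)"], rule exI[of _ "c a m * (LINT u|cell_measure R. F u)"],
          rule exI[of _ "\<lambda>x. \<psi> (?E x)"], rule exI[of _ "LINT u|cell_measure R. \<psi> u"])
        (intro conjI allI 1 2 3 4 \<psi>e)
  qed
  moreover have "Y a m x * iexp (?b \<bullet> ?E x) =
     iexp ((\<Sum>j\<in>{1..Suc k}. a j \<bullet> err j x) + 2 * pi * (\<Sum>j\<in>{Suc k<..K}. of_int_vec (m j) \<bullet> (matpow L j *v of_int_vec x)))" for x
    unfolding Y_def exp_add[symmetric] distrib_left[symmetric] of_real_add[symmetric] by (simp add: add_ac)
  moreover have "c a m * cell_char R ?b = (if \<forall>j\<in>{Suc k<..K}. m j = 0 then \<Prod>j\<in>{1..Suc k}. cell_char R (a j) else 0)"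
    by (simp add: c_def mult.commute)
  ultimately show "has_box_mean (\<lambda>x. iexp ((\<Sum>j\<in>{1..Suc k}. a j \<bullet> err j x) + 2 * pi * (\<Sum>j\<in>{Suc k<..K}. of_int_vec (m j) \<bullet> (matpow L j *v of_int_vec x))))
     (if \<forall>j\<in>{Suc k<..K}. m j = 0 then \<Prod>j\<in>{1..Suc k}. cell_char R (a j) else 0)"
    by (simp only:)
qed

text \<open>At \<open>K = k\<close> no torus points remain, and the invariant is the product formula
  for the errors alone.\<close>

proposition has_box_mean_iexp_err:
  "has_box_mean (\<lambda>x. iexp (\<Sum>j\<in>{1..k}. a j \<bullet> err j x)) (\<Prod>j\<in>{1..k}. cell_char R (a j))"
proof -
  have "joint_mean k i" if "i \<le> k" for i
    using that by (induction i) (auto intro: joint_mean_0 joint_mean_Suc)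
  from this[of k] show ?thesis unfolding joint_mean_def by (auto dest!: spec[of _ a])
qed

end

section \<open>Polygonal paths\<close>

text \<open>The argument lists increments rather than nodes, so that only the first \<open>m\<close>
  coordinates matter and independence of increments can be used directly.\<close>

definition poly_path :: "nat \<Rightarrow> (nat \<Rightarrow> 'v::real_normed_vector) \<Rightarrow> 'v path0" where
  "poly_path m v = Path (\<lambda>t. if t \<in> {0..1} then polygonal (\<lambda>i. \<Sum>j<i. v j) (real m * t) else 0)"

lemma path_fun_poly_path:
  "path_fun (poly_path m v) = (\<lambda>t. if t \<in> {0..1} then polygonal (\<lambda>i. \<Sum>j<i. v j) (real m * t) else 0)"
proof -
  have "continuous_on {0..1} (\<lambda>t. polygonal (\<lambda>i. \<Sum>j<i. v j) (real m * t))"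
    by (rule continuous_on_compose2[OF continuous_on_polygonal[of m]])
      (auto intro!: continuous_intros mult_left_le)
  then have "continuous_on {0..1} (\<lambda>t. if t \<in> {0..1} then polygonal (\<lambda>i. \<Sum>j<i. v j) (real m * t) else 0)"
    by (rule continuous_on_eq) simp
  then show ?thesis
    unfolding poly_path_def by (subst Path_inverse) (auto simp: path0_set_def polygonal_def)
qed

lemma dist_path0_le:
  assumes "\<And>t. t \<in> {0..1} \<Longrightarrow> dist (path_fun f t) (path_fun g t) \<le> d"
  shows "dist f g \<le> d"
  unfolding dist_path0_def using assms by (intro cSUP_least) auto

lemma poly_path_cong: "(\<And>j. j < m \<Longrightarrow> v j = w j) \<Longrightarrow> poly_path m v = poly_path m w"
proof -
  assume eq: "\<And>j. j < m \<Longrightarrow> v j = w j"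
  have "polygonal (\<lambda>i. \<Sum>j<i. v j) (real m * t) = polygonal (\<lambda>i. \<Sum>j<i. w j) (real m * t)" if "t \<in> {0..1}" for t
  proof -
    have "real m * t \<le> real m" using that by (simp add: mult_left_le)
    then have "nat \<lfloor>real m * t\<rfloor> \<le> m" "nat \<lceil>real m * t\<rceil> \<le> m" by (auto simp: nat_le_iff ceiling_le_iff) linarith
    moreover have "(\<Sum>j<i. v j) = (\<Sum>j<i. w j)" if "i \<le> m" for i
      using that eq by (intro sum.cong) auto
    ultimately show ?thesis by (simp add: polygonal_def)
  qed
  then show ?thesis unfolding poly_path_def by (intro arg_cong[where f = Path] ext) simp
qed

lemma polygonal_dist_le:
  fixes s s' :: "nat \<Rightarrow> 'v::real_normed_vector"
  assumes "\<And>i. i \<le> m \<Longrightarrow> norm (s i - s' i) \<le> d" "0 \<le> u" "u \<le> real m"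
  shows "norm (polygonal s u - polygonal s' u) \<le> d"
proof -
  let ?a = "nat \<lfloor>u\<rfloor>" and ?b = "nat \<lceil>u\<rceil>" and ?l = "u - of_int \<lfloor>u\<rfloor>"
  have ab: "?a \<le> m" "?b \<le> m" using assms(2,3) by (auto simp: nat_le_iff ceiling_le_iff) linarith
  have l: "0 \<le> ?l" "0 \<le> 1 - ?l" by linarith+
  have "polygonal s u - polygonal s' u = (1 - ?l) *\<^sub>R (s ?a - s' ?a) + ?l *\<^sub>R (s ?b - s' ?b)"
    by (simp add: polygonal_def algebra_simps)
  also have "norm \<dots> \<le> (1 - ?l) * norm (s ?a - s' ?a) + ?l * norm (s ?b - s' ?b)"
    using norm_triangle_ineq[of "(1 - ?l) *\<^sub>R (s ?a - s' ?a)" "?l *\<^sub>R (s ?b - s' ?b)"] l by simp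
  also have "\<dots> \<le> (1 - ?l) * d + ?l * d"
    using l ab assms(1) by (intro add_mono mult_left_mono) auto
  finally show ?thesis by (simp add: algebra_simps)
qed

lemma polygonal_dist_floor:
  fixes s :: "nat \<Rightarrow> 'v::real_normed_vector"
  shows "norm (polygonal s u - s (nat \<lfloor>u\<rfloor>)) \<le> norm (s (nat \<lceil>u\<rceil>) - s (nat \<lfloor>u\<rfloor>))"
proof -
  have "\<bar>u - of_int \<lfloor>u\<rfloor>\<bar> \<le> 1" by linarith
  then show ?thesis by (simp add: polygonal_def mult_left_le_one_le)
qed

text \<open>Nodes are partial sums and interpolation does not increase the maximal distance between
  nodes. Continuity and measurability of \<open>poly_path\<close> rest on this.\<close>

lemma dist_poly_path_le: "dist (poly_path m v) (poly_path m w) \<le> (\<Sum>j<m. norm (v j - w j))"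
proof (rule dist_path0_le)
  fix t :: real assume t: "t \<in> {0..1}"
  have "norm ((\<Sum>j<i. v j) - (\<Sum>j<i. w j)) \<le> (\<Sum>j<m. norm (v j - w j))" if "i \<le> m" for i
  proof -
    have "norm ((\<Sum>j<i. v j) - (\<Sum>j<i. w j)) \<le> (\<Sum>j<i. norm (v j - w j))"
      unfolding sum_subtractf[symmetric] by (rule norm_sum)
    also have "\<dots> \<le> (\<Sum>j<m. norm (v j - w j))" using that by (intro sum_mono2) auto
    finally show ?thesis .
  qed
  then show "dist (path_fun (poly_path m v) t) (path_fun (poly_path m w) t) \<le> (\<Sum>j<m. norm (v j - w j))"
    using t unfolding path_fun_poly_path dist_norm by (auto intro!: polygonal_dist_le[of m] mult_left_le)
qed

lemma continuous_on_poly_path: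
  assumes "\<And>j. j < m \<Longrightarrow> continuous_on S (\<lambda>y. v y j)"
  shows "continuous_on S (\<lambda>y. poly_path m (v y))"
  unfolding continuous_on_def
proof
  fix x assume "x \<in> S"
  have "((\<lambda>y. \<Sum>j<m. norm (v y j - v x j)) \<longlongrightarrow> (\<Sum>j<m. norm (v x j - v x j))) (at x within S)"
    using assms \<open>x \<in> S\<close> by (intro tendsto_sum tendsto_norm tendsto_diff tendsto_const) (auto simp: continuous_on_def)
  then have "((\<lambda>y. \<Sum>j<m. norm (v y j - v x j)) \<longlongrightarrow> 0) (at x within S)" by simp
  then have "((\<lambda>y. dist (poly_path m (v y)) (poly_path m (v x))) \<longlongrightarrow> 0) (at x within S)"
    by (rule Lim_null_comparison[rotated]) (simp add: dist_poly_path_le)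
  then show "((\<lambda>y. poly_path m (v y)) \<longlongrightarrow> poly_path m (v x)) (at x within S)"
    by (rule tendsto_dist_iff[THEN iffD2])
qed

text \<open>The path is a continuous function of measurable vectors, which gives Borel measurability
  for the uniform norm directly. Increments beyond \<open>m\<close> are set to 0 to make every
  coordinate measurable.\<close>

lemma measurable_poly_path:
  fixes v :: "'a \<Rightarrow> nat \<Rightarrow> 'v::euclidean_space"
  assumes "\<And>j. j < m \<Longrightarrow> (\<lambda>\<omega>. v \<omega> j) \<in> borel_measurable M"
  shows "(\<lambda>\<omega>. poly_path m (v \<omega>)) \<in> borel_measurable M"
proof -
  let ?w = "\<lambda>\<omega> j. if j < m then v \<omega> j else 0"
  have "?w \<in> borel_measurable M"
  proof (rule measurable_coordinatewise_then_product)
    show "(\<lambda>\<omega>. if i < m then v \<omega> i else 0) \<in> borel_measurable M" for i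
      using assms by (cases "i < m") auto
  qed
  moreover have "poly_path m \<in> borel_measurable borel"
    by (intro borel_measurable_continuous_onI continuous_on_poly_path) (rule continuous_on_product_coordinates)
  ultimately have "(\<lambda>\<omega>. poly_path m (?w \<omega>)) \<in> borel_measurable M" by (rule measurable_compose)
  moreover have "poly_path m (?w \<omega>) = poly_path m (v \<omega>)" for \<omega> by (rule poly_path_cong) simp
  ultimately show ?thesis by simp
qed

lemma continuous_on_matrix_vector_mul:
  fixes A :: "real^'n^'m"
  assumes "continuous_on S f"
  shows "continuous_on S (\<lambda>y. A *v f y)"
  by (rule continuous_on_compose2[OF linear_continuous_on[OF matrix_vector_mul_bounded_linear, of UNIV] assms]) auto

section \<open>The law of the quantized path\<close>

text \<open>Coordinate \<open>j\<close> of a sample point plays the role of the error at time \<open>Suc j\<close>.\<close>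

definition err_space :: "(real^'n \<Rightarrow> int^'n) \<Rightarrow> (nat \<Rightarrow> real^'n) measure" where
  "err_space R = PiM UNIV (\<lambda>_. cell_measure R)"

text \<open>One formula for two paths: with the errors of a lattice point in place of
  \<open>e\<close> it is the quantized path, with a sample of \<open>err_space R\<close> its random
  model.\<close>

definition lin_path :: "nat \<Rightarrow> (nat \<Rightarrow> real^'n^'n) \<Rightarrow> real^'n \<Rightarrow> (nat \<Rightarrow> real^'n) \<Rightarrow> (real^'n) path0" where
  "lin_path N B c e = poly_path N (\<lambda>j. B j *v (e j - c))"

context
  fixes R :: "real^'n \<Rightarrow> int^'n"
  assumes R: "quantizer R"
begin

lemma prob_space_err_space: "prob_space (err_space R)"
  unfolding err_space_def by (intro prob_space_PiM prob_space_cell_measure R)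

lemma measurable_err_space [measurable]: "(\<lambda>e. e j) \<in> borel_measurable (err_space R)"
proof -
  have "(\<lambda>e. e j) \<in> measurable (err_space R) (cell_measure R)"
    unfolding err_space_def by (rule measurable_component_singleton) simp
  then show ?thesis by (simp cong: measurable_cong_sets)
qed

lemma distr_err_space: "distr (err_space R) borel (\<lambda>e. e j) = cell_measure R"
proof -
  have "distr (err_space R) (cell_measure R) (\<lambda>e. e j) = cell_measure R"
    unfolding err_space_def by (intro distr_PiM_component prob_space_cell_measure R) simp
  moreover have "distr (err_space R) (cell_measure R) (\<lambda>e. e j) = distr (err_space R) borel (\<lambda>e. e j)"
    by (rule distr_cong) auto
  ultimately show ?thesis by simp
qed

lemma integral_err_space_component:
  fixes f :: "real^'n \<Rightarrow> 'b::{banach, second_countable_topology}"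
  assumes "f \<in> borel_measurable borel"
  shows "(LINT e|err_space R. f (e j)) = (LINT u|cell_measure R. f u)"
  unfolding distr_err_space[symmetric, of j] by (rule integral_distr[symmetric]) (auto simp: assms)

lemma indep_vars_err_space: "prob_space.indep_vars (err_space R) (\<lambda>_. borel) (\<lambda>j e. e j) UNIV"
proof -
  interpret prob_space "err_space R" by (rule prob_space_err_space)
  have s: "sets (PiM UNIV (\<lambda>_::nat. borel :: (real^'n) measure)) = sets (err_space R)"
    unfolding err_space_def by (intro sets_PiM_cong) auto
  have "distr (err_space R) (PiM UNIV (\<lambda>_::nat. borel)) (\<lambda>e. \<lambda>j\<in>UNIV. e j) = distr (err_space R) (err_space R) (\<lambda>e. e)"
    using s by (intro distr_cong) auto
  also have "\<dots> = PiM UNIV (\<lambda>j. distr (err_space R) borel (\<lambda>e. e j))"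
    unfolding distr_err_space by (simp add: err_space_def distr_id2)
  finally show ?thesis by (subst indep_vars_iff_distr_eq_PiM) auto
qed

text \<open>The product coincides with the box mean of the corresponding exponential of quantization
  errors, which is what identifies the two.\<close>

lemma char_err_space:
  assumes "finite J"
  shows "(LINT e|err_space R. iexp (\<Sum>j\<in>J. a j \<bullet> e j)) = (\<Prod>j\<in>J. cell_char R (a j))"
proof -
  interpret prob_space "err_space R" by (rule prob_space_err_space)
  have ind: "indep_vars (\<lambda>_. borel) (\<lambda>j e. iexp (a j \<bullet> e j)) J"
    by (rule indep_vars_compose2[OF indep_vars_subset[OF indep_vars_err_space]]) auto
  have "(LINT e|err_space R. iexp (\<Sum>j\<in>J. a j \<bullet> e j)) = (LINT e|err_space R. (\<Prod>j\<in>J. iexp (a j \<bullet> e j)))"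
    using assms by (simp add: exp_sum sum_distrib_left)
  also have "\<dots> = (\<Prod>j\<in>J. (LINT e|err_space R. iexp (a j \<bullet> e j)))"
    by (intro indep_vars_lebesgue_integral assms ind integrable_const_bound[of _ 1]) auto
  also have "\<dots> = (\<Prod>j\<in>J. cell_char R (a j))"
    unfolding cell_char_def by (intro prod.cong refl integral_err_space_component) simp
  finally show ?thesis .
qed

lemma measurable_lin_path [measurable]: "lin_path N B c \<in> borel_measurable (err_space R)"
  unfolding lin_path_def
proof (rule measurable_poly_path)
  fix j
  have "(\<lambda>u. B j *v (u - c)) \<in> borel_measurable borel"
    by (intro borel_measurable_continuous_onI continuous_on_matrix_vector_mul continuous_intros)
  then show "(\<lambda>e. B j *v (e j - c)) \<in> borel_measurable (err_space R)"
    by (rule measurable_compose[OF measurable_err_space])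
qed

text \<open>For uniform lattice points in growing boxes the characteristic functions of the first
  \<open>N\<close> errors converge to those of the product space, and tightness holds because the
  cell is bounded. The path is a continuous function of these errors, so averages over it converge
  too.\<close>

proposition freq_distributed_lin_path:
  assumes L: "iteratively_nonresonant L"
  shows "freq_distributed (distr (err_space R) borel (lin_path N B c)) (\<lambda>x. lin_path N B c (\<lambda>j. q_error_at R L (Suc j) x))"
proof (rule freq_distributedI)
  interpret prob_space "err_space R" by (rule prob_space_err_space)
  show "prob_space (distr (err_space R) borel (lin_path N B c))" by (rule prob_space_distr) simp
  fix g :: "(real^'n) path0 \<Rightarrow> real" and K
  assume g: "\<And>x. 0 \<le> g x \<and> g x \<le> 1" "\<And>x y. \<bar>g x - g y\<bar> \<le> K * dist x y"
  have cg: "continuous_on S g" for S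
    by (rule lipschitz_imp_continuous_on[of _ K]) (use g(2) in \<open>simp add: dist_real_def\<close>)
  let ?J = "{..<N} \<times> (UNIV :: 'n set)"
  let ?v = "\<lambda>y::nat \<times> 'n \<Rightarrow> real. \<lambda>j. \<chi> i. y (j, i)"
  define G where "G y = g (lin_path N B c (?v y))" for y
  \<comment> \<open>The box enters only through the measure; the argument \<open>P\<close> is
    present because the family is indexed by boxes.\<close>
  define X where "X P x = (\<lambda>(j, i). q_error_at R L (Suc j) x $ i)" for P :: "(int^'n) set" and x
  define Z where "Z e = (\<lambda>(j, i). e j $ i)" for e :: "nat \<Rightarrow> real^'n"
  obtain k where k: "k > 0" "\<And>u. R u = 0 \<Longrightarrow> norm u \<le> k" using bounded_q_cell[OF R] by blast
  have phase: "(\<Sum>p\<in>?J. a p * (case p of (j, i) \<Rightarrow> y j $ i)) = (\<Sum>j<N. (\<chi> i. a (j, i)) \<bullet> (y j :: real^'n))" for a y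
    unfolding inner_vec_def sum.cartesian_product by (intro sum.cong) auto
  have gZ: "(\<lambda>e. g (lin_path N B c e)) \<in> borel_measurable (err_space R)"
    using borel_measurable_continuous_onI[OF cg] by (rule measurable_compose[OF measurable_lin_path])
  have "((\<lambda>P. LINT x|measure_pmf (pmf_of_set P). G (X P x)) \<longlongrightarrow> (LINT e|err_space R. G (Z e))) boxes_at_top"
  proof (rule tendsto_integral_of_tendsto_char[where J = ?J and C = 1 and g = G and X = X and Z = Z])
    fix a :: "nat \<times> 'n \<Rightarrow> real"
    \<comment> \<open>Times start at 1, coordinates of a sample at 0.\<close>
    define b where "b j = (\<chi> i. a (j - 1, i))" for j
    have bj: "(\<Sum>j<N. (\<chi> i. a (j, i)) \<bullet> q_error_at R L (Suc j) x) = (\<Sum>j\<in>{1..N}. b j \<bullet> q_error_at R L j x)" for x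
      by (rule sum.reindex_bij_witness[of _ "\<lambda>j. j - 1" Suc]) (auto simp: b_def)
    have "has_box_mean (\<lambda>x. iexp (\<Sum>j\<in>{1..N}. b j \<bullet> q_error_at R L j x)) (\<Prod>j\<in>{1..N}. cell_char R (b j))"
      by (rule has_box_mean_iexp_err[OF R L])
    moreover have "(\<Prod>j\<in>{1..N}. cell_char R (b j)) = (\<Prod>j<N. cell_char R (\<chi> i. a (j, i)))"
      by (rule prod.reindex_bij_witness[of _ Suc "\<lambda>j. j - 1"]) (auto simp: b_def)
    ultimately have "((\<lambda>P. box_avg P (\<lambda>x. iexp (\<Sum>p\<in>?J. a p * X P x p))) \<longlongrightarrow> (LINT e|err_space R. iexp (\<Sum>p\<in>?J. a p * Z e p))) boxes_at_top"
      unfolding X_def Z_def phase bj has_box_mean_def char_err_space[OF finite_lessThan] by simp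
    then show "((\<lambda>P. LINT x|measure_pmf (pmf_of_set P). iexp (\<Sum>p\<in>?J. a p * X P x p)) \<longlongrightarrow> (LINT e|err_space R. iexp (\<Sum>p\<in>?J. a p * Z e p))) boxes_at_top"
      by (rule Lim_transform_eventually)
        (use eventually_box_finite_nonempty in eventually_elim, simp add: integral_pmf_of_box)
  next
    fix e :: real assume "e > 0"
    have "\<bar>X P x p\<bar> \<le> k" for P x p
    proof -
      obtain j i where p: "p = (j, i)" by (cases p)
      have "\<bar>q_error_at R L (Suc j) x $ i\<bar> \<le> norm (q_error_at R L (Suc j) x)" by (rule component_le_norm_cart)
      also have "\<dots> \<le> k" using k(2) err_in_cell[OF R L, of "Suc j" x] by simp
      finally show ?thesis by (simp add: X_def p)
    qed
    then have "measure (measure_pmf (pmf_of_set P)) {x \<in> space (measure_pmf (pmf_of_set P)). \<exists>p\<in>?J. k < \<bar>X P x p\<bar>} \<le> e" for P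
      using \<open>e > 0\<close> by (simp add: not_less[symmetric])
    then show "\<exists>K>0. \<forall>\<^sub>F P in boxes_at_top. measure (measure_pmf (pmf_of_set P)) {x \<in> space (measure_pmf (pmf_of_set P)). \<exists>p\<in>?J. K < \<bar>X P x p\<bar>} \<le> e"
      using k(1) by (intro exI[of _ k]) simp
  next
    have "continuous_on UNIV (\<lambda>y. lin_path N B c (?v y))"
      unfolding lin_path_def
      by (intro continuous_on_poly_path continuous_on_matrix_vector_mul continuous_on_diff continuous_on_const
        continuous_on_vec_lambda continuous_on_product_coordinates)
    then show "continuous_on UNIV G"
      unfolding G_def by (rule continuous_on_compose2[OF cg[of UNIV]]) auto
    show "\<bar>G y\<bar> \<le> 1" for y unfolding G_def using g(1) by simp
    show "G y = G (\<lambda>p. if p \<in> ?J then y p else 0)" for y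
      unfolding G_def lin_path_def by (intro arg_cong[where f = g] poly_path_cong) simp
    have "(\<lambda>e. e j $ i) \<in> borel_measurable (err_space R)" for j i
      by (rule measurable_compose[OF measurable_err_space borel_measurable_continuous_onI])
        (intro continuous_intros)
    then show "(\<lambda>e. Z e p) \<in> borel_measurable (err_space R)" for p by (cases p) (simp add: Z_def)
    show "(\<lambda>e. G (Z e)) \<in> borel_measurable (err_space R)" using gZ by (simp add: G_def Z_def)
  qed (auto intro: measure_pmf.prob_space_axioms prob_space_err_space)
  then have "((\<lambda>P. LINT x|measure_pmf (pmf_of_set P). g (lin_path N B c (\<lambda>j. q_error_at R L (Suc j) x))) \<longlongrightarrow>
      (LINT e|err_space R. g (lin_path N B c e))) boxes_at_top"
    by (simp add: G_def X_def Z_def)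
  moreover have "(LINT e|err_space R. g (lin_path N B c e)) = (LINT f|distr (err_space R) borel (lin_path N B c). g f)"
    using borel_measurable_continuous_onI[OF cg] by (intro integral_distr[symmetric]) auto
  ultimately have "((\<lambda>P. LINT x|measure_pmf (pmf_of_set P). g (lin_path N B c (\<lambda>j. q_error_at R L (Suc j) x))) \<longlongrightarrow>
      (LINT f|distr (err_space R) borel (lin_path N B c). g f)) boxes_at_top" by simp
  then show "((\<lambda>P. box_avg P (\<lambda>x. g (lin_path N B c (\<lambda>j. q_error_at R L (Suc j) x)))) \<longlongrightarrow>
      (LINT f|distr (err_space R) borel (lin_path N B c). g f)) boxes_at_top"
    by (rule Lim_transform_eventually)
      (use eventually_box_finite_nonempty in eventually_elim, simp add: integral_pmf_of_box)
qed simp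

declare measurable_err_space [measurable del] measurable_lin_path [measurable del]

end

section \<open>Sums of independent bounded vectors\<close>

context prob_space
begin

lemma integrable_bounded:
  fixes f :: "'a \<Rightarrow> 'b::{banach, second_countable_topology}"
  assumes "f \<in> borel_measurable M" "\<And>\<omega>. norm (f \<omega>) \<le> K"
  shows "integrable M f"
  using assms by (intro integrable_const_bound[of _ K]) auto

text \<open>Expanding the inner product reduces the claim to the product rule for expectations of
  independent real variables, coordinate by coordinate.\<close>

lemma expectation_inner_indep_eq_0:
  fixes Z Y :: "'a \<Rightarrow> real^'n"
  assumes ind: "indep_var borel Z borel Y" and Y0: "expectation Y = 0"
    and bY: "\<And>\<omega>. norm (Y \<omega>) \<le> B" and f: "f \<in> borel_measurable borel" and bf: "\<And>\<omega>. norm (f (Z \<omega>)) \<le> K"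
  shows "expectation (\<lambda>\<omega>. f (Z \<omega>) \<bullet> Y \<omega>) = 0"
proof -
  have Z[measurable]: "Z \<in> borel_measurable M" and Y[measurable]: "Y \<in> borel_measurable M"
    using ind indep_var_rv1 indep_var_rv2 by blast+
  note [measurable] = f
  have bY': "\<bar>Y \<omega> $ i\<bar> \<le> B" "\<bar>f (Z \<omega>) $ i\<bar> \<le> K" for i \<omega>
    using component_le_norm_cart[of "Y \<omega>" i] component_le_norm_cart[of "f (Z \<omega>)" i] bY[of \<omega>] bf[of \<omega>] by linarith+
  have iY: "integrable M Y" using bY by (intro integrable_bounded) auto
  have comp[measurable]: "(\<lambda>x::real^'n. x $ i) \<in> borel_measurable borel" for i
    by (intro borel_measurable_continuous_onI continuous_intros)
  have ii: "integrable M (\<lambda>\<omega>. f (Z \<omega>) $ i)" "integrable M (\<lambda>\<omega>. Y \<omega> $ i)" for i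
    using bY' by (auto intro!: integrable_bounded)
  have iv: "indep_var borel (\<lambda>\<omega>. f (Z \<omega>) $ i) borel (\<lambda>\<omega>. Y \<omega> $ i)" for i
  proof -
    have "indep_var borel ((\<lambda>z. f z $ i) \<circ> Z) borel ((\<lambda>y. y $ i) \<circ> Y)"
      by (rule indep_var_compose[OF ind]) measurable
    then show ?thesis by (simp add: comp_def)
  qed
  have Yi: "expectation (\<lambda>\<omega>. Y \<omega> $ i) = 0" for i
    using integral_bounded_linear[OF bounded_linear_vec_nth iY, of i] Y0 by simp
  have "expectation (\<lambda>\<omega>. f (Z \<omega>) \<bullet> Y \<omega>) = (\<Sum>i\<in>UNIV. expectation (\<lambda>\<omega>. f (Z \<omega>) $ i * Y \<omega> $ i))"
    unfolding inner_vec_def inner_real_def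
    by (rule Bochner_Integration.integral_sum) (rule indep_var_integrable[OF iv ii])
  also have "\<dots> = 0"
    using indep_var_lebesgue_integral[OF iv ii] Yi by simp
  finally show ?thesis .
qed

end

text \<open>The partial sums of \<open>y\<close> from index \<open>a\<close>, frozen as soon as their norm exceeds \<open>d\<close>. Running the
  moment recursion for the frozen sums turns Markov's inequality into a maximal inequality.\<close>

primrec frozen_sum :: "real \<Rightarrow> nat \<Rightarrow> (nat \<Rightarrow> 'v::real_normed_vector) \<Rightarrow> nat \<Rightarrow> 'v" where
  "frozen_sum d a y 0 = 0"
| "frozen_sum d a y (Suc k) = (if norm (frozen_sum d a y k) \<le> d then frozen_sum d a y k + y (a + k) else frozen_sum d a y k)"

lemma frozen_sum_cong: "(\<And>j. j < a + k \<Longrightarrow> y j = z j) \<Longrightarrow> frozen_sum d a y k = frozen_sum d a z k"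
  by (induction k) auto

lemma norm_frozen_sum_le:
  assumes "\<And>j. norm (y j) \<le> B"
  shows "norm (frozen_sum d a y k) \<le> real k * B"
proof (induction k)
  case (Suc k)
  have "0 \<le> B" using assms[of 0] norm_ge_zero[of "y 0"] by linarith
  then show ?case
    using Suc assms[of "a + k"] norm_triangle_ineq[of "frozen_sum d a y k" "y (a + k)"] by (auto simp: algebra_simps)
qed simp

lemma frozen_sum_exceeds:
  assumes "i \<le> k" "norm (\<Sum>j\<in>{a..<a + i}. y j) > d" "0 \<le> d"
  shows "norm (frozen_sum d a y k) > d"
proof (rule ccontr)
  assume "\<not> norm (frozen_sum d a y k) > d"
  then have "norm (frozen_sum d a y k) \<le> d" by simp
  then have "norm (frozen_sum d a y j) \<le> d \<and> frozen_sum d a y j = (\<Sum>l\<in>{a..<a + j}. y l)" if "j \<le> k" for j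
    using that
  proof (induction k arbitrary: j)
    case 0
    then show ?case using \<open>0 \<le> d\<close> by simp
  next
    case (Suc k)
    have n: "norm (frozen_sum d a y k) \<le> d" using Suc.prems(1) by (auto split: if_splits)
    show ?case
    proof (cases "j = Suc k")
      case True
      then show ?thesis using Suc.prems(1) n Suc.IH[OF n, of k] by simp
    qed (use Suc.IH[OF n, of j] Suc.prems in auto)
  qed
  then show False using assms by force
qed

lemma measurable_frozen_sum:
  fixes d :: real
  assumes "k \<le> n"
  shows "(\<lambda>y. frozen_sum d a y k) \<in> borel_measurable (PiM {..<a + n} (\<lambda>_. borel :: 'v::{second_countable_topology, real_normed_vector} measure))"
  using assms
proof (induction k)
  case (Suc k)
  then have [measurable]: "(\<lambda>y. frozen_sum d a y k) \<in> borel_measurable (PiM {..<a + n} (\<lambda>_. borel :: 'v measure))" by simp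
  have [measurable]: "(\<lambda>y. y (a + k)) \<in> borel_measurable (PiM {..<a + n} (\<lambda>_. borel :: 'v measure))"
    using Suc by (intro measurable_component_singleton) auto
  show ?case by simp
qed simp

text \<open>The laws may differ from step to step, as they do for rotated errors. The bound holds at
  every sample point, which makes all moments integrable at once.\<close>

locale bounded_independent_vectors = prob_space +
  fixes Y :: "nat \<Rightarrow> 'a \<Rightarrow> real^'n" and B :: real
  assumes indep: "indep_vars (\<lambda>_. borel) Y UNIV"
    and mean_zero: "expectation (Y j) = 0"
    and bounded_Y: "norm (Y j \<omega>) \<le> B"
begin

lemma measurable_Y [measurable]: "Y j \<in> borel_measurable M"
  using indep by (auto simp: indep_vars_def)

lemma B_nonneg: "0 \<le> B"
  using bounded_Y[of 0 undefined] norm_ge_zero[of "Y 0 undefined"] by linarith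

lemma indep_var_frozen_sum: "indep_var borel (\<lambda>\<omega>. frozen_sum d a (\<lambda>j. Y j \<omega>) k) borel (Y (a + k))"
proof -
  have "indep_var (PiM {..<a + k} (\<lambda>_. borel)) (\<lambda>\<omega>. restrict (\<lambda>i. Y i \<omega>) {..<a + k})
      (PiM {a + k} (\<lambda>_. borel)) (\<lambda>\<omega>. restrict (\<lambda>i. Y i \<omega>) {a + k})"
    by (rule indep_var_restrict[OF indep]) auto
  then have "indep_var borel ((\<lambda>y. frozen_sum d a y k) \<circ> (\<lambda>\<omega>. restrict (\<lambda>i. Y i \<omega>) {..<a + k}))
      borel ((\<lambda>y. y (a + k)) \<circ> (\<lambda>\<omega>. restrict (\<lambda>i. Y i \<omega>) {a + k}))"
    by (rule indep_var_compose) (auto intro: measurable_frozen_sum measurable_component_singleton)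
  moreover have "frozen_sum d a (restrict (\<lambda>i. Y i \<omega>) {..<a + k}) k = frozen_sum d a (\<lambda>i. Y i \<omega>) k" for \<omega>
    by (rule frozen_sum_cong) auto
  ultimately show ?thesis by (simp add: comp_def)
qed

lemma measurable_frozen_sum_Y [measurable]: "(\<lambda>\<omega>. frozen_sum d a (\<lambda>j. Y j \<omega>) k) \<in> borel_measurable M"
  using indep_var_frozen_sum by (rule indep_var_rv1)

text \<open>Since freezing is decided by the past, terms linear in the new vector have mean zero.
  The fourth moment thus grows by at most \<open>8 * B^2\<close> times the second moment plus
  \<open>3 * B^4\<close>, and \<open>4 * k^2 + 8 * k + 3 \<le> 4 * (k + 1)^2\<close> closes the
  induction.\<close>

lemma frozen_sum_moments:
  fixes d :: real
  defines "Z \<equiv> \<lambda>a k \<omega>. frozen_sum d a (\<lambda>j. Y j \<omega>) k"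
  shows "expectation (\<lambda>\<omega>. (norm (Z a k \<omega>))\<^sup>2) \<le> real k * B\<^sup>2"
    and "expectation (\<lambda>\<omega>. (norm (Z a k \<omega>)) ^ 4) \<le> 4 * (real k)\<^sup>2 * B ^ 4"
proof -
  have zk: "norm (Z a k \<omega>) \<le> real k * B" for k \<omega>
    unfolding Z_def by (rule norm_frozen_sum_le) (rule bounded_Y)
  have [measurable]: "Z a k \<in> borel_measurable M" for k unfolding Z_def by measurable
  have intp: "integrable M (\<lambda>\<omega>. (norm (Z a k \<omega>)) ^ p)" for k p
    by (rule integrable_bounded[of _ "(real k * B) ^ p"]) (auto simp: power_mono[OF zk])
  define c where "c k \<omega> = (if norm (Z a k \<omega>) \<le> d then 1 else 0 :: real)" for k \<omega>
  have Zs: "Z a (Suc k) \<omega> = Z a k \<omega> + c k \<omega> *\<^sub>R Y (a + k) \<omega>" for k \<omega> by (simp add: Z_def c_def)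
  have ortho: "expectation (\<lambda>\<omega>. c k \<omega> * (norm (Z a k \<omega>)) ^ p * (Z a k \<omega> \<bullet> Y (a + k) \<omega>)) = 0
     \<and> integrable M (\<lambda>\<omega>. c k \<omega> * (norm (Z a k \<omega>)) ^ p * (Z a k \<omega> \<bullet> Y (a + k) \<omega>))" for k p
  proof -
    let ?f = "\<lambda>z::real^'n. ((if norm z \<le> d then 1 else 0) * norm z ^ p) *\<^sub>R z"
    have bf: "norm (?f (Z a k \<omega>)) \<le> (real k * B) ^ p * (real k * B)" for \<omega>
      using B_nonneg by (auto simp: abs_mult intro!: mult_mono power_mono zk mult_nonneg_nonneg zero_le_power)
    have "expectation (\<lambda>\<omega>. ?f (Z a k \<omega>) \<bullet> Y (a + k) \<omega>) = 0"
      by (rule expectation_inner_indep_eq_0[where Z = "Z a k" and f = ?f, OF _ mean_zero bounded_Y _ bf])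
        (auto simp: Z_def indep_var_frozen_sum)
    moreover have "integrable M (\<lambda>\<omega>. ?f (Z a k \<omega>) \<bullet> Y (a + k) \<omega>)"
    proof (rule integrable_bounded[of _ "(real k * B) ^ p * (real k * B) * B"])
      show "norm (?f (Z a k \<omega>) \<bullet> Y (a + k) \<omega>) \<le> (real k * B) ^ p * (real k * B) * B" for \<omega>
        using B_nonneg Cauchy_Schwarz_ineq2[of "?f (Z a k \<omega>)" "Y (a + k) \<omega>"]
          mult_mono[OF bf[of \<omega>] bounded_Y[of "a + k" \<omega>]] by auto
    qed measurable
    ultimately show ?thesis by (simp add: c_def mult_ac)
  qed
  have y2: "(norm (Y j \<omega>)) ^ p \<le> B ^ p" for j \<omega> p by (rule power_mono) (auto simp: bounded_Y)
  have sq: "expectation (\<lambda>\<omega>. (norm (Z a k \<omega>))\<^sup>2) \<le> real k * B\<^sup>2" for k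
  proof (induction k)
    case (Suc k)
    have "(norm (Z a (Suc k) \<omega>))\<^sup>2 \<le> (norm (Z a k \<omega>))\<^sup>2 + 2 * (c k \<omega> * norm (Z a k \<omega>) ^ 0 * (Z a k \<omega> \<bullet> Y (a + k) \<omega>)) + B\<^sup>2" for \<omega>
      using y2[of "a + k" \<omega> 2] by (auto simp: Zs c_def power2_norm_eq_inner inner_add inner_commute)
    then have "expectation (\<lambda>\<omega>. (norm (Z a (Suc k) \<omega>))\<^sup>2) \<le> expectation (\<lambda>\<omega>. (norm (Z a k \<omega>))\<^sup>2 + 2 * (c k \<omega> * norm (Z a k \<omega>) ^ 0 * (Z a k \<omega> \<bullet> Y (a + k) \<omega>)) + B\<^sup>2)"
      using intp ortho[of k 0] by (intro integral_mono) auto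
    also have "\<dots> = expectation (\<lambda>\<omega>. (norm (Z a k \<omega>))\<^sup>2) + B\<^sup>2"
      using intp[of k 2] ortho[of k 0] by (simp add: prob_space)
    also have "\<dots> \<le> real (Suc k) * B\<^sup>2" using Suc by (simp add: algebra_simps)
    finally show ?case .
  qed (simp add: Z_def)
  show "expectation (\<lambda>\<omega>. (norm (Z a k \<omega>))\<^sup>2) \<le> real k * B\<^sup>2" by (rule sq)
  show "expectation (\<lambda>\<omega>. (norm (Z a k \<omega>)) ^ 4) \<le> 4 * (real k)\<^sup>2 * B ^ 4"
  proof (induction k)
    case (Suc k)
    \<comment> \<open>The term linear in \<open>y\<close> is kept exact because it will average out;
      the term cubic in \<open>y\<close> is split by
      \<open>4 * p * q^3 \<le> 2 * p^2 * q^2 + 2 * q^4\<close>.\<close>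
    have four: "norm (z + y) ^ 4 \<le> norm z ^ 4 + 4 * (norm z ^ 2 * (z \<bullet> y)) + 8 * B\<^sup>2 * norm z ^ 2 + 3 * B ^ 4"
      if yB: "norm y \<le> B" for z y :: "real^'n"
    proof -
      define p q s where "p = norm z" and "q = norm y" and "s = z \<bullet> y"
      have pq: "0 \<le> p" "0 \<le> q" "\<bar>s\<bar> \<le> p * q" by (auto simp: p_def q_def s_def Cauchy_Schwarz_ineq2)
      have "norm (z + y) ^ 4 = ((norm (z + y))\<^sup>2)\<^sup>2" by simp
      also have "(norm (z + y))\<^sup>2 = p\<^sup>2 + 2 * s + q\<^sup>2"
        by (simp add: p_def q_def s_def power2_norm_eq_inner inner_add inner_commute)
      also have "(p\<^sup>2 + 2 * s + q\<^sup>2)\<^sup>2 = p ^ 4 + 4 * (p\<^sup>2 * s) + 4 * s\<^sup>2 + 2 * p\<^sup>2 * q\<^sup>2 + q ^ 4 + 4 * s * q\<^sup>2" by algebra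
      also have "\<dots> \<le> p ^ 4 + 4 * (p\<^sup>2 * s) + 8 * q\<^sup>2 * p\<^sup>2 + 3 * q ^ 4"
      proof -
        have 1: "s\<^sup>2 \<le> p\<^sup>2 * q\<^sup>2" using pq by (simp flip: power_mult_distrib) (metis abs_le_square_iff abs_of_nonneg mult_nonneg_nonneg)
        have "s * q\<^sup>2 \<le> p * q * q\<^sup>2" using pq by (intro mult_right_mono) auto
        moreover have "0 \<le> 2 * (p - q)\<^sup>2 * q\<^sup>2" by simp
        ultimately have 2: "4 * s * q\<^sup>2 \<le> 2 * p\<^sup>2 * q\<^sup>2 + 2 * q ^ 4" by (simp add: power2_eq_square power4_eq_xxxx algebra_simps)
        show ?thesis using 1 2 by (simp add: algebra_simps)
      qed
      also have "\<dots> \<le> p ^ 4 + 4 * (p\<^sup>2 * s) + 8 * B\<^sup>2 * p\<^sup>2 + 3 * B ^ 4"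
        using yB pq by (intro add_mono order.refl mult_right_mono mult_left_mono power_mono) (auto simp: q_def)
      finally show ?thesis by (simp add: p_def s_def)
    qed
    have "norm (Z a (Suc k) \<omega>) ^ 4 \<le> norm (Z a k \<omega>) ^ 4 + 4 * (c k \<omega> * norm (Z a k \<omega>) ^ 2 * (Z a k \<omega> \<bullet> Y (a + k) \<omega>)) + 8 * B\<^sup>2 * norm (Z a k \<omega>) ^ 2 + 3 * B ^ 4" for \<omega>
      using four[OF bounded_Y, of "Z a k \<omega>"] B_nonneg by (auto simp: Zs c_def)
    then have "expectation (\<lambda>\<omega>. norm (Z a (Suc k) \<omega>) ^ 4) \<le> expectation (\<lambda>\<omega>. norm (Z a k \<omega>) ^ 4 + 4 * (c k \<omega> * norm (Z a k \<omega>) ^ 2 * (Z a k \<omega> \<bullet> Y (a + k) \<omega>)) + 8 * B\<^sup>2 * norm (Z a k \<omega>) ^ 2 + 3 * B ^ 4)"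
      using intp ortho[of k 2] by (intro integral_mono) auto
    also have "\<dots> = expectation (\<lambda>\<omega>. norm (Z a k \<omega>) ^ 4) + 8 * B\<^sup>2 * expectation (\<lambda>\<omega>. (norm (Z a k \<omega>))\<^sup>2) + 3 * B ^ 4"
      using intp[of k 2] intp[of k 4] ortho[of k 2] by (simp add: prob_space)
    also have "\<dots> \<le> 4 * (real k)\<^sup>2 * B ^ 4 + 8 * B\<^sup>2 * (real k * B\<^sup>2) + 3 * B ^ 4"
      using Suc sq[of k] by (intro add_mono mult_left_mono) auto
    also have "\<dots> \<le> 4 * (real (Suc k))\<^sup>2 * B ^ 4"
      using B_nonneg by (simp add: power2_eq_square power4_eq_xxxx algebra_simps)
    finally show ?case .
  qed (simp add: Z_def)
qed

definition exceed :: "real \<Rightarrow> nat \<Rightarrow> nat \<Rightarrow> 'a set" where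
  "exceed d a n = {\<omega>\<in>space M. \<exists>k\<le>n. norm (\<Sum>j\<in>{a..<a + k}. Y j \<omega>) > d}"

lemma sets_exceed [measurable]: "exceed d a n \<in> sets M"
proof -
  have "exceed d a n = (\<Union>k\<le>n. {\<omega>\<in>space M. norm (\<Sum>j\<in>{a..<a + k}. Y j \<omega>) > d})" by (auto simp: exceed_def)
  then show ?thesis by simp
qed

lemma maximal_inequality:
  assumes "d > 0"
  shows "prob (exceed d a n) \<le> 4 * (real n)\<^sup>2 * B ^ 4 / d ^ 4"
proof -
  let ?Z = "\<lambda>\<omega>. frozen_sum d a (\<lambda>j. Y j \<omega>) n"
  have int: "integrable M (\<lambda>\<omega>. (norm (?Z \<omega>)) ^ 4)"
    by (rule integrable_bounded[of _ "(real n * B) ^ 4"])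
      (auto intro!: power_mono norm_frozen_sum_le bounded_Y)
  have "prob (exceed d a n) \<le> prob {\<omega>\<in>space M. norm (?Z \<omega>) ^ 4 \<ge> d ^ 4}"
  proof (rule finite_measure_mono)
    show "exceed d a n \<subseteq> {\<omega>\<in>space M. norm (?Z \<omega>) ^ 4 \<ge> d ^ 4}"
    proof
      fix \<omega> assume "\<omega> \<in> exceed d a n"
      then obtain k where k: "\<omega> \<in> space M" "k \<le> n" "norm (\<Sum>j\<in>{a..<a + k}. Y j \<omega>) > d"
        by (auto simp: exceed_def)
      have "d < norm (?Z \<omega>)" using assms by (intro frozen_sum_exceeds[OF k(2,3)]) simp
      then have "d ^ 4 \<le> norm (?Z \<omega>) ^ 4" using assms by (intro power_mono) auto
      then show "\<omega> \<in> {\<omega>\<in>space M. norm (?Z \<omega>) ^ 4 \<ge> d ^ 4}" using k by simp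
    qed
  qed measurable
  also have "\<dots> \<le> expectation (\<lambda>\<omega>. norm (?Z \<omega>) ^ 4) / d ^ 4"
    using assms int by (intro integral_Markov_inequality_measure[where A = "space M", simplified]) auto
  also have "\<dots> \<le> 4 * (real n)\<^sup>2 * B ^ 4 / d ^ 4"
    using assms by (intro divide_right_mono frozen_sum_moments) auto
  finally show ?thesis .
qed

end

section \<open>The Wiener measure\<close>

lemma integral_iexp_normal_density:
  assumes "s > 0"
  shows "(LBINT x. normal_density 0 s x *\<^sub>R iexp (t * x)) = of_real (exp (- (s * t)\<^sup>2 / 2))"
proof -
  have nd: "normal_density 0 s (s * x) = std_normal_density x / s" for x
    using assms by (simp add: normal_density_def power_mult_distrib real_sqrt_mult)
  have "(LBINT x. normal_density 0 s x *\<^sub>R iexp (t * x)) = s *\<^sub>R (LBINT x. normal_density 0 s (s * x) *\<^sub>R iexp (t * (s * x)))"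
    using assms by (subst lborel_integral_real_affine[where c = s and t = 0]) auto
  also have "\<dots> = (LBINT x. std_normal_density x *\<^sub>R iexp (s * t * x))"
    unfolding nd using assms by (subst integral_scaleR_right[symmetric]) (simp add: mult_ac)
  also have "\<dots> = char std_normal_distribution (s * t)"
    unfolding char_def by (subst integral_density) auto
  finally show ?thesis by (simp add: char_std_normal_distribution)
qed

lemma integral_iexp_normal_density_vec:
  fixes a :: "real^'n"
  assumes "s > 0"
  shows "(LBINT x. (\<Prod>i\<in>UNIV. normal_density 0 s (x $ i)) *\<^sub>R iexp (a \<bullet> x)) = of_real (exp (- (s\<^sup>2 * (a \<bullet> a)) / 2))"
proof -
  let ?F = "\<lambda>x::real^'n. (\<Prod>i\<in>UNIV. normal_density 0 s (x $ i)) *\<^sub>R iexp (a \<bullet> x)"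
  let ?h = "\<lambda>b x. normal_density 0 s x *\<^sub>R iexp ((a \<bullet> b) * x)"
  interpret product_sigma_finite "\<lambda>_::real^'n. lborel :: real measure" by standard
  have B: "(Basis :: (real^'n) set) = (\<lambda>i. axis i 1) ` UNIV" by (auto simp: Basis_vec_def)
  have inj: "inj (\<lambda>i::'n. axis i (1::real))" by (auto simp: inj_on_def axis_eq_axis)
  have F: "?F (\<Sum>b\<in>Basis. f b *\<^sub>R b) = (\<Prod>b\<in>Basis. ?h b (f b))" for f
  proof -
    have comp: "(\<Sum>b\<in>Basis. f b *\<^sub>R b) $ i = f (axis i 1)" for i
      unfolding B by (subst sum.reindex[OF inj]) (simp add: axis_def if_distrib cong: if_cong)
    have "?F (\<Sum>b\<in>Basis. f b *\<^sub>R b) = of_real (\<Prod>i\<in>UNIV. normal_density 0 s (f (axis i 1))) * iexp (\<Sum>b\<in>Basis. (a \<bullet> b) * f b)"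
      unfolding comp by (simp only: inner_sum_right inner_scaleR_right mult.commute[of "f _"] scaleR_conv_of_real[where 'a = complex])
    also have "(\<Prod>i\<in>UNIV. normal_density 0 s (f (axis i 1))) = (\<Prod>b\<in>Basis. normal_density 0 s (f b))"
      unfolding B by (subst prod.reindex[OF inj]) simp
    also have "iexp (\<Sum>b\<in>Basis. (a \<bullet> b) * f b) = (\<Prod>b\<in>Basis. iexp ((a \<bullet> b) * f b))"
      by (simp add: exp_sum[symmetric] sum_distrib_left)
    finally show ?thesis by (simp only: prod.distrib scaleR_conv_of_real[where 'a = complex] of_real_prod)
  qed
  have int: "integrable lborel (?h b)" for b
  proof (rule Bochner_Integration.integrable_bound)
    show "integrable lborel (normal_density 0 s)" using assms by (rule integrable_normal_density)
  qed auto
  have [measurable]: "(\<lambda>x::real^'n. x $ i) \<in> borel_measurable borel" for i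
    by (intro borel_measurable_continuous_onI continuous_intros)
  have "?F \<in> borel_measurable borel" by measurable
  then have "(LBINT x. ?F x) = (LINT f|(\<Pi>\<^sub>M b\<in>Basis. lborel). ?F (\<Sum>b\<in>Basis. f b *\<^sub>R b))"
    by (subst lborel_eq, subst integral_distr) auto
  also have "\<dots> = (\<Prod>b\<in>Basis. LBINT x. ?h b x)"
    unfolding F by (rule product_integral_prod[OF finite_Basis int])
  also have "\<dots> = (\<Prod>b\<in>Basis. of_real (exp (- (s * (a \<bullet> b))\<^sup>2 / 2)))"
    by (simp only: integral_iexp_normal_density[OF assms])
  also have "\<dots> = of_real (exp (\<Sum>b\<in>Basis. - (s * (a \<bullet> b))\<^sup>2 / 2))"
    by (simp add: exp_sum)
  also have "(\<Sum>b\<in>Basis. - (s * (a \<bullet> b))\<^sup>2 / 2) = - (s\<^sup>2 * (a \<bullet> a)) / 2"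
    by (simp add: euclidean_inner[of a a] power_mult_distrib sum_distrib_left sum_negf sum_divide_distrib power2_eq_square mult_ac)
  finally show ?thesis .
qed

text \<open>Feeding these increments into \<open>poly_path m\<close> gives the interpolation of
  \<open>f\<close> on the grid of the points \<open>i / m\<close>.\<close>

definition path_incr :: "nat \<Rightarrow> 'v::real_normed_vector path0 \<Rightarrow> nat \<Rightarrow> 'v" where
  "path_incr m f i = path_fun f (real (Suc i) / real m) - path_fun f (real i / real m)"

context
  fixes W :: "(real^'n) path0 measure"
  assumes W: "wiener_measure W"
begin

lemma prob_space_wiener: "prob_space W"
  using W by (simp add: wiener_measure_def standard_wiener_process_def)

lemma sets_wiener: "sets W = sets borel"
  using W by (simp add: wiener_measure_def)

lemma measurable_path_incr:
  assumes "i < m"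
  shows "(\<lambda>f. path_incr m f i) \<in> borel_measurable W"
proof -
  have "(\<lambda>f. path_fun f t) \<in> borel_measurable W" if "t \<in> {0..1}" for t
    using W that by (simp add: wiener_measure_def standard_wiener_process_def)
  moreover have "real (Suc i) / real m \<in> {0..1}" "real i / real m \<in> {0..1}" using assms by (auto simp: divide_le_eq)
  ultimately show ?thesis unfolding path_incr_def by (intro borel_measurable_diff) blast+
qed

text \<open>The increments over the grid are independent, and each of their coordinates has variance
  \<open>1 / m\<close>, so the characteristic function is a product of Gaussian ones.\<close>

lemma char_path_incr:
  assumes "m > 0"
  shows "(LINT f|W. iexp (\<Sum>i<m. a i \<bullet> path_incr m f i)) = of_real (exp (- (\<Sum>i<m. a i \<bullet> a i) / (2 * real m)))"
proof -
  interpret prob_space W by (rule prob_space_wiener)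
  let ?t = "\<lambda>i. real (min i m) / real m"
  have "indep_vars (\<lambda>_. borel) (\<lambda>i f. path_fun f (?t (Suc i)) - path_fun f (?t i)) {..<m}"
    using W assms unfolding wiener_measure_def standard_wiener_process_def
    by (elim conjE allE[of _ m] allE[of _ ?t] mp) (auto simp: divide_right_mono)
  then have ind: "indep_vars (\<lambda>_. borel) (\<lambda>i f. path_incr m f i) {..<m}"
    by (rule indep_vars_cong[THEN iffD1, rotated -1]) (auto simp: path_incr_def fun_eq_iff min_def)
  have one: "(LINT f|W. iexp (a i \<bullet> path_incr m f i)) = of_real (exp (- (a i \<bullet> a i) / (2 * real m)))" if "i < m" for i
  proof -
    let ?s = "real i / real m" and ?u = "real (Suc i) / real m"
    have d: "?u - ?s = 1 / real m" by (simp add: diff_divide_distrib[symmetric])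
    have "0 \<le> ?s" "?s < ?u" "?u \<le> 1" using that assms by (auto simp: divide_strict_right_mono divide_le_eq)
    then have dist: "distributed W lborel (\<lambda>f. path_incr m f i) (\<lambda>x. ennreal (\<Prod>i\<in>UNIV. normal_density 0 (sqrt (1 / real m)) (x $ i)))"
      using W unfolding wiener_measure_def standard_wiener_process_def path_incr_def d[symmetric] by blast
    have "(LINT f|W. iexp (a i \<bullet> path_incr m f i)) = (LINT x|distr W lborel (\<lambda>f. path_incr m f i). iexp (a i \<bullet> x))"
      by (rule integral_distr[symmetric]) (use measurable_path_incr[OF that] in simp_all)
    also have "\<dots> = (LBINT x. (\<Prod>j\<in>UNIV. normal_density 0 (sqrt (1 / real m)) (x $ j)) *\<^sub>R iexp (a i \<bullet> x))"
      unfolding distributed_distr_eq_density[OF dist]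
    proof (rule integral_density)
      have [measurable]: "(\<lambda>x::real^'n. x $ i) \<in> borel_measurable borel" for i
        by (intro borel_measurable_continuous_onI continuous_intros)
      have "(\<lambda>x::real^'n. \<Prod>j\<in>UNIV. normal_density 0 (sqrt (1 / real m)) (x $ j)) \<in> borel_measurable borel" by measurable
      then show "(\<lambda>x::real^'n. \<Prod>j\<in>UNIV. normal_density 0 (sqrt (1 / real m)) (x $ j)) \<in> borel_measurable lborel" by simp
    qed (auto intro!: AE_I2 prod_nonneg)
    also have "\<dots> = of_real (exp (- (a i \<bullet> a i) / (2 * real m)))"
      using assms by (subst integral_iexp_normal_density_vec) (auto simp: real_sqrt_divide power_divide)
    finally show ?thesis .
  qed
  have "(LINT f|W. iexp (\<Sum>i<m. a i \<bullet> path_incr m f i)) = (LINT f|W. (\<Prod>i<m. iexp (a i \<bullet> path_incr m f i)))"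
    by (simp add: exp_sum sum_distrib_left)
  also have "\<dots> = (\<Prod>i<m. (LINT f|W. iexp (a i \<bullet> path_incr m f i)))"
  proof (rule indep_vars_lebesgue_integral)
    show "indep_vars (\<lambda>_. borel) (\<lambda>i f. iexp (a i \<bullet> path_incr m f i)) {..<m}"
      by (rule indep_vars_compose2[OF ind]) auto
    show "integrable W (\<lambda>f. iexp (a i \<bullet> path_incr m f i))" if "i \<in> {..<m}" for i
      using measurable_path_incr[of i m] that by (intro integrable_const_bound[of _ 1]) auto
  qed simp
  also have "\<dots> = (\<Prod>i<m. of_real (exp (- (a i \<bullet> a i) / (2 * real m))))"
    by (intro prod.cong refl one) simp
  also have "\<dots> = of_real (exp (\<Sum>i<m. - (a i \<bullet> a i) / (2 * real m)))" by (simp add: exp_sum)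
  also have "(\<Sum>i<m. - (a i \<bullet> a i) / (2 * real m)) = - (\<Sum>i<m. a i \<bullet> a i) / (2 * real m)"
    by (simp add: sum_divide_distrib sum_negf)
  finally show ?thesis .
qed

end

lemma sum_path_incr:
  assumes "m > 0"
  shows "(\<Sum>j<i. path_incr m f j) = path_fun f (real i / real m)"
proof -
  have "path_fun f 0 = 0" using path_fun[of f] by (simp add: path0_set_def)
  then show ?thesis using assms unfolding path_incr_def
    by (subst sum_lessThan_telescope) simp
qed

text \<open>Uniform continuity: the interpolant and \<open>f\<close> are both close to the value of
  \<open>f\<close> at the grid point to the left of \<open>t\<close>.\<close>

lemma poly_path_incr_tendsto:
  fixes f :: "'v::real_normed_vector path0"
  shows "(\<lambda>m. poly_path m (path_incr m f)) \<longlonglongrightarrow> f"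
proof (rule metric_LIMSEQ_I)
  fix e :: real assume "e > 0"
  have "continuous_on {0..1} (path_fun f)" using path_fun[of f] by (simp add: path0_set_def)
  then have "uniformly_continuous_on {0..1} (path_fun f)"
    by (rule compact_uniformly_continuous) simp
  then obtain \<delta> where \<delta>: "\<delta> > 0" "\<And>s t. s \<in> {0..1} \<Longrightarrow> t \<in> {0..1} \<Longrightarrow> dist s t < \<delta> \<Longrightarrow> dist (path_fun f s) (path_fun f t) < e / 3"
    unfolding uniformly_continuous_on_def using \<open>e > 0\<close> by (metis divide_pos_pos zero_less_numeral)
  obtain m0 where m0: "1 / \<delta> < real m0" using reals_Archimedean2 by blast
  have "dist (poly_path m (path_incr m f)) f < e" if "m \<ge> Suc m0" for m
  proof -
    have m: "m > 0" "1 / real m < \<delta>"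
    proof -
      have "1 / \<delta> < real m" using m0 that by linarith
      then show "m > 0" "1 / real m < \<delta>" using that \<delta>(1) by (auto simp: field_simps)
    qed
    have "dist (path_fun (poly_path m (path_incr m f)) t) (path_fun f t) \<le> 2 * e / 3" if t: "t \<in> {0..1}" for t
    proof -
      let ?s = "\<lambda>i. path_fun f (real i / real m)" and ?u = "real m * t"
      let ?a = "nat \<lfloor>?u\<rfloor>" and ?b = "nat \<lceil>?u\<rceil>"
      have u: "0 \<le> ?u" "?u \<le> real m" using t by (auto simp: mult_left_le)
      have ra: "real ?a = of_int \<lfloor>?u\<rfloor>" "real ?b = of_int \<lceil>?u\<rceil>" using u by auto
      have ab: "real ?a / real m \<in> {0..1}" "real ?b / real m \<in> {0..1}"
        using u m floor_mono[OF u(2)] ceiling_mono[OF u(2)] unfolding ra by (auto simp: divide_le_eq)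
      have "\<bar>real ?b - real ?a\<bar> \<le> 1" "\<bar>real ?a - ?u\<bar> \<le> 1" unfolding ra using ceiling_diff_floor_le_1[of ?u] floor_le_ceiling[of ?u] by linarith+
      then have "\<bar>real ?b - real ?a\<bar> / real m \<le> 1 / real m" "\<bar>real ?a - ?u\<bar> / real m \<le> 1 / real m"
        using m by (auto intro: divide_right_mono)
      moreover have "dist (real ?b / real m) (real ?a / real m) = \<bar>real ?b - real ?a\<bar> / real m"
        "dist (real ?a / real m) t = \<bar>real ?a - ?u\<bar> / real m"
        using m by (auto simp: dist_real_def abs_if field_simps)
      ultimately have d: "dist (real ?b / real m) (real ?a / real m) < \<delta>" "dist (real ?a / real m) t < \<delta>"
        using m by linarith+
      have "path_fun (poly_path m (path_incr m f)) t = polygonal ?s ?u"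
        using t by (simp add: path_fun_poly_path sum_path_incr[OF m(1)])
      moreover have "dist (polygonal ?s ?u) (?s ?a) \<le> dist (?s ?b) (?s ?a)"
        unfolding dist_norm by (rule polygonal_dist_floor)
      ultimately show ?thesis
        using \<delta>(2)[OF ab(2,1) d(1)] \<delta>(2)[OF ab(1) t d(2)]
          dist_triangle[of "polygonal ?s ?u" "path_fun f t" "?s ?a"] by simp
    qed
    then have "dist (poly_path m (path_incr m f)) f \<le> 2 * e / 3" by (rule dist_path0_le)
    then show ?thesis using \<open>e > 0\<close> by simp
  qed
  then show "\<exists>no. \<forall>m\<ge>no. dist (poly_path m (path_incr m f)) f < e" by blast
qed

section \<open>Invariance principle\<close>

lemma sum_blocks:
  fixes \<kappa> :: "nat \<Rightarrow> nat" and h :: "nat \<Rightarrow> 'b::comm_monoid_add"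
  assumes "\<kappa> 0 = 0" "mono \<kappa>"
  shows "(\<Sum>i<k. \<Sum>j\<in>{\<kappa> i..<\<kappa> (Suc i)}. h j) = (\<Sum>j<\<kappa> k. h j)"
proof (induction k)
  case (Suc k)
  have "\<kappa> k \<le> \<kappa> (Suc k)" using assms(2) by (simp add: monoD)
  then show ?case using Suc by (simp add: lessThan_atLeast0 sum.atLeastLessThan_concat)
qed (use assms in simp)

text \<open>The block boundaries are \<open>N * i / m\<close> rounded down, so that for positive
  \<open>m\<close> the last one is exactly \<open>N\<close> and block lengths differ by at most
  one.\<close>

definition knot :: "nat \<Rightarrow> nat \<Rightarrow> nat \<Rightarrow> nat" where
  "knot m N i = N * i div m"

lemma knot_simps: "knot m N 0 = 0" "m > 0 \<Longrightarrow> knot m N m = N" "mono (knot m N)"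
  by (auto simp: knot_def mono_def intro!: div_le_mono)

lemma floor_knot: "m > 0 \<Longrightarrow> int (knot m N i) = \<lfloor>real N * real i / real m\<rfloor>"
  using floor_divide_of_nat_eq[of "N * i" m, where 'a = real] by (simp add: knot_def)

lemma real_knot: "m > 0 \<Longrightarrow> real (knot m N i) = of_int \<lfloor>real N * real i / real m\<rfloor>"
  by (simp flip: floor_knot)

lemma knot_block_length:
  assumes "m > 0"
  shows "real (knot m N (Suc i) - knot m N i) \<le> real N / real m + 1"
proof -
  have "knot m N i \<le> knot m N (Suc i)" using knot_simps(3) by (simp add: monoD)
  then have "real (knot m N (Suc i) - knot m N i) = of_int \<lfloor>real N * real (Suc i) / real m\<rfloor> - of_int \<lfloor>real N * real i / real m\<rfloor>"
    by (simp only: of_nat_diff real_knot[OF assms])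
  also have "real N * real (Suc i) / real m = real N * real i / real m + real N / real m"
    by (simp add: add_divide_distrib algebra_simps)
  finally show ?thesis by linarith
qed

lemma knot_tendsto: "(\<lambda>N. real (knot m N i) / real N) \<longlonglongrightarrow> real i / real m"
proof (cases "m = 0")
  case False
  show ?thesis
  proof (rule tendsto_sandwich)
    show "\<forall>\<^sub>F N in sequentially. real i / real m - 1 / real N \<le> real (knot m N i) / real N"
      using eventually_gt_at_top[of 0]
    proof eventually_elim
      case (elim N)
      have "real (N * i) / real m - real (knot m N i) \<le> 1" using False real_knot[of m N i] by simp linarith
      then have "(real (N * i) / real m - 1) / real N \<le> real (knot m N i) / real N"
        by (intro divide_right_mono) auto
      then show ?case using elim by (simp add: diff_divide_distrib)
    qed
    show "\<forall>\<^sub>F N in sequentially. real (knot m N i) / real N \<le> real i / real m"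
      using eventually_gt_at_top[of 0]
    proof eventually_elim
      case (elim N)
      have "0 \<le> real (N * i) / real m - real (knot m N i)" using False real_knot[of m N i] by simp
      then have "real (knot m N i) / real N \<le> (real (N * i) / real m) / real N"
        by (intro divide_right_mono) auto
      then show ?case using elim by simp
    qed
    have "(\<lambda>N. real i / real m - 1 / real N) \<longlonglongrightarrow> real i / real m - 0"
      by (intro tendsto_intros lim_1_over_n)
    then show "(\<lambda>N. real i / real m - 1 / real N) \<longlonglongrightarrow> real i / real m" by simp
  qed simp
qed (simp add: knot_def)

text \<open>The quotient is the average over the first \<open>knot m N i\<close> terms, times
  \<open>knot m N i / N\<close>. For \<open>i = 0\<close> the knots do not tend to infinity, but
  both sides are 0.\<close>

lemma knot_average_tendsto:
  fixes q :: "nat \<Rightarrow> real"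
  assumes "m > 0" and avg: "(\<lambda>k. (\<Sum>j<k. q j) / real k) \<longlonglongrightarrow> c"
  shows "(\<lambda>N. (\<Sum>j<knot m N i. q j) / real N) \<longlonglongrightarrow> real i / real m * c"
proof (cases "i = 0")
  case False
  have "filterlim (\<lambda>N. knot m N i) at_top sequentially"
    unfolding filterlim_at_top
  proof
    fix Z
    show "\<forall>\<^sub>F N in sequentially. Z \<le> knot m N i"
      using eventually_ge_at_top[of "Z * m"]
    proof eventually_elim
      case (elim N)
      moreover have "N \<le> N * i" using False by simp
      ultimately have "Z * m \<le> N * i" by (rule le_trans)
      then show ?case using assms(1) unfolding knot_def by (simp add: less_eq_div_iff_mult_less_eq)
    qed
  qed
  from filterlim_compose[OF avg this]
  have "(\<lambda>N. (\<Sum>j<knot m N i. q j) / real (knot m N i)) \<longlonglongrightarrow> c" .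
  from tendsto_mult[OF knot_tendsto[of m i] this]
  have "(\<lambda>N. real (knot m N i) / real N * ((\<Sum>j<knot m N i. q j) / real (knot m N i))) \<longlonglongrightarrow> real i / real m * c" .
  moreover have "real (knot m N i) / real N * ((\<Sum>j<knot m N i. q j) / real (knot m N i)) = (\<Sum>j<knot m N i. q j) / real N" for N
    by (cases "knot m N i = 0") auto
  ultimately show ?thesis by simp
qed (simp add: knot_def)

lemma nat_ceiling_cases:
  fixes u :: real
  assumes "0 \<le> u"
  shows "nat \<lceil>u\<rceil> = nat \<lfloor>u\<rfloor> \<or> nat \<lceil>u\<rceil> = Suc (nat \<lfloor>u\<rfloor>)"
proof -
  have "0 \<le> \<lfloor>u\<rfloor>" using assms by simp
  then show ?thesis unfolding ceiling_altdef by (simp add: Suc_nat_eq_nat_zadd1 add.commute)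
qed

text \<open>Three errors of size \<open>d\<close>: the fine path moves by at most one step beyond
  its last node, the coarse path by at most one block, and the two nodes differ by a partial sum
  within one block.\<close>

lemma poly_path_blocks_close:
  fixes v :: "nat \<Rightarrow> 'v::real_normed_vector"
  assumes m: "m > 0" and step: "\<And>j. norm (v j) \<le> d"
    and osc: "\<And>i k. i < m \<Longrightarrow> k \<le> knot m N (Suc i) - knot m N i \<Longrightarrow> norm (\<Sum>j\<in>{knot m N i..<knot m N i + k}. v j) \<le> d"
  shows "dist (poly_path N v) (poly_path m (\<lambda>i. \<Sum>j\<in>{knot m N i..<knot m N (Suc i)}. v j)) \<le> 3 * d"
proof (rule dist_path0_le)
  fix t :: real assume t: "t \<in> {0..1}"
  let ?S = "\<lambda>k. \<Sum>j<k. v j" and ?\<kappa> = "knot m N"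
  let ?u = "real N * t" and ?w = "real m * t"
  let ?k = "nat \<lfloor>?u\<rfloor>" and ?i = "nat \<lfloor>?w\<rfloor>"
  have d: "0 \<le> d" using step[of 0] norm_ge_zero[of "v 0"] by linarith
  have uw: "0 \<le> ?u" "?u \<le> real N" "0 \<le> ?w" "?w \<le> real m" using t by (auto simp: mult_left_le)
  have dS: "?S b - ?S a = (\<Sum>j\<in>{a..<b}. v j)" if "a \<le> b" for a b
    using that by (simp add: lessThan_atLeast0 sum_diff_nat_ivl)
  have 1: "norm (polygonal ?S ?u - ?S ?k) \<le> d"
  proof -
    have "nat \<lceil>?u\<rceil> = ?k \<or> nat \<lceil>?u\<rceil> = Suc ?k" by (rule nat_ceiling_cases[OF uw(1)])
    then have "norm (?S (nat \<lceil>?u\<rceil>) - ?S ?k) \<le> d" using d step by (elim disjE) simp_all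
    then show ?thesis using polygonal_dist_floor[of ?S ?u] by linarith
  qed
  have i: "?i \<le> m" using floor_mono[OF uw(4)] by (simp add: nat_le_iff)
  have 2: "norm (polygonal (\<lambda>i. ?S (?\<kappa> i)) ?w - ?S (?\<kappa> ?i)) \<le> d"
  proof -
    have "nat \<lceil>?w\<rceil> = ?i \<or> nat \<lceil>?w\<rceil> = Suc ?i" by (rule nat_ceiling_cases[OF uw(3)])
    moreover have "nat \<lceil>?w\<rceil> \<le> m" using uw(4) by (simp add: nat_le_iff ceiling_le_iff)
    moreover have "norm (?S (?\<kappa> (Suc ?i)) - ?S (?\<kappa> ?i)) \<le> d" if "?i < m"
    proof -
      have le: "?\<kappa> ?i \<le> ?\<kappa> (Suc ?i)" using knot_simps(3) by (simp add: monoD)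
      then show ?thesis using osc[OF that order.refl] dS[OF le] by simp
    qed
    ultimately have "norm (?S (?\<kappa> (nat \<lceil>?w\<rceil>)) - ?S (?\<kappa> ?i)) \<le> d"
      using d by (metis Suc_le_eq cancel_comm_monoid_add_class.diff_cancel norm_zero)
    then show ?thesis using polygonal_dist_floor[of "\<lambda>i. ?S (?\<kappa> i)" ?w] by linarith
  qed
  have 3: "norm (?S ?k - ?S (?\<kappa> ?i)) \<le> d"
  proof (cases "?i < m")
    case True
    have ri: "real ?i \<le> ?w" "?w < real (Suc ?i)" using uw by (auto; linarith)+
    have ui: "real N * real ?i / real m \<le> ?u" "?u \<le> real N * real (Suc ?i) / real m"
    proof -
      have "real N * real ?i \<le> real N * ?w" "real N * ?w \<le> real N * real (Suc ?i)"
        using ri by (intro mult_left_mono; simp)+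
      then show "real N * real ?i / real m \<le> ?u" "?u \<le> real N * real (Suc ?i) / real m"
        using m by (simp_all add: divide_le_eq le_divide_eq mult_ac)
    qed
    have "int (?\<kappa> ?i) \<le> \<lfloor>?u\<rfloor>" "\<lfloor>?u\<rfloor> \<le> int (?\<kappa> (Suc ?i))"
      unfolding floor_knot[OF m] using floor_mono[OF ui(1)] floor_mono[OF ui(2)] .
    then have k: "?\<kappa> ?i \<le> ?k" "?k \<le> ?\<kappa> (Suc ?i)" by linarith+
    have "?k - ?\<kappa> ?i \<le> ?\<kappa> (Suc ?i) - ?\<kappa> ?i" using k(2) by (rule diff_le_mono)
    from osc[OF True this] show ?thesis using k by (simp add: dS)
  next
    \<comment> \<open>At the right endpoint there is no further block and the two nodes
      coincide.\<close>
    case False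
    then have "?i = m" using i by simp
    then have "real m \<le> ?w" using uw by linarith
    then have "t = 1" using t m by (simp add: mult_le_cancel_left1)
    then show ?thesis using d knot_simps(2)[OF m] by simp
  qed
  have "path_fun (poly_path m (\<lambda>i. \<Sum>j\<in>{?\<kappa> i..<?\<kappa> (Suc i)}. v j)) t = polygonal (\<lambda>i. ?S (?\<kappa> i)) ?w"
    using t by (simp add: path_fun_poly_path sum_blocks[OF knot_simps(1,3)])
  moreover have "path_fun (poly_path N v) t = polygonal ?S ?u" using t by (simp add: path_fun_poly_path)
  moreover have "norm (polygonal ?S ?u - polygonal (\<lambda>i. ?S (?\<kappa> i)) ?w) \<le> 3 * d"
    using 1 2 3 by norm
  ultimately show "dist (path_fun (poly_path N v) t) (path_fun (poly_path m (\<lambda>i. \<Sum>j\<in>{?\<kappa> i..<?\<kappa> (Suc i)}. v j)) t) \<le> 3 * d"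
    by (simp add: dist_norm)
qed

lemma abs_exp_minus_approx:
  fixes x :: real
  assumes "0 \<le> x"
  shows "\<bar>exp (- x) - (1 - x)\<bar> \<le> x\<^sup>2"
proof -
  have 1: "1 - x \<le> exp (- x)" using exp_ge_add_one_self[of "- x"] by simp
  have "exp (- x) * (1 + x) \<le> exp (- x) * exp x" using exp_ge_add_one_self[of x] by (intro mult_left_mono) auto
  also have "\<dots> = 1" by (simp flip: exp_add)
  \<comment> \<open>The product on the right equals \<open>1 + x^3\<close>.\<close>
  also have "1 \<le> (1 - x + x\<^sup>2) * (1 + x)" using assms by (simp add: algebra_simps power2_eq_square)
  finally have "exp (- x) \<le> 1 - x + x\<^sup>2" using assms by (simp add: mult_le_cancel_right)
  with 1 show ?thesis by simp
qed

section \<open>Central limit theorem for the block increments\<close>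

context bounded_independent_vectors
begin

definition second_moment :: "real^'n \<Rightarrow> nat \<Rightarrow> real" where
  "second_moment b j = expectation (\<lambda>\<omega>. (b \<bullet> Y j \<omega>)\<^sup>2)"

lemma inner_Y_le: "norm b \<le> \<beta> \<Longrightarrow> \<bar>b \<bullet> Y j \<omega>\<bar> \<le> \<beta> * B"
  using Cauchy_Schwarz_ineq2[of b "Y j \<omega>"] mult_mono[OF _ bounded_Y[of j \<omega>], of "norm b" \<beta>] norm_ge_zero[of b] by force

lemma second_moment_bounds:
  assumes "norm b \<le> \<beta>"
  shows "0 \<le> second_moment b j" "second_moment b j \<le> (\<beta> * B)\<^sup>2"
proof -
  show "0 \<le> second_moment b j" by (simp add: second_moment_def)
  have sq: "(b \<bullet> Y j \<omega>)\<^sup>2 \<le> (\<beta> * B)\<^sup>2" for \<omega>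
    using inner_Y_le[OF assms, of j \<omega>] by (metis abs_ge_zero power2_abs power_mono)
  then have "second_moment b j \<le> expectation (\<lambda>_. (\<beta> * B)\<^sup>2)"
    unfolding second_moment_def by (intro integral_mono integrable_bounded[of _ "(\<beta> * B)\<^sup>2"]) auto
  then show "second_moment b j \<le> (\<beta> * B)\<^sup>2" by (simp add: prob_space)
qed

text \<open>Both terms are compared with \<open>1 - q / (2 * N)\<close>, where \<open>q\<close> is
  the second moment: the first by the third-order estimate for characteristic functions, the second
  by the quadratic bound for \<open>exp\<close>. Each error is of smaller order than
  \<open>1 / N\<close>, so \<open>N\<close> of them vanish in the limit.\<close>

lemma expectation_iexp_Y_approx:
  assumes b: "norm b \<le> \<beta>" and N: "N > 0"
  shows "cmod (expectation (\<lambda>\<omega>. iexp (1 / sqrt (real N) * (b \<bullet> Y j \<omega>))) - of_real (exp (- (second_moment b j / (2 * real N)))))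
    \<le> (\<beta> * B) ^ 3 / (6 * real N * sqrt (real N)) + (\<beta> * B) ^ 4 / (4 * (real N)\<^sup>2)"
proof -
  let ?X = "\<lambda>\<omega>. b \<bullet> Y j \<omega>" and ?t = "1 / sqrt (real N)" and ?T = "\<beta> * B" and ?q = "second_moment b j"
  have T: "0 \<le> ?T" using B_nonneg b norm_ge_zero[of b] by (intro mult_nonneg_nonneg) linarith+
  have iY: "integrable M (Y j)" by (rule integrable_bounded[OF _ bounded_Y]) simp
  have EX: "expectation ?X = 0" using integral_inner_right[of b M "Y j"] iY mean_zero by simp
  have pw: "\<bar>?X \<omega>\<bar> ^ p \<le> ?T ^ p" for \<omega> p using inner_Y_le[OF b] by (intro power_mono) auto
  have intp: "integrable M (\<lambda>\<omega>. \<bar>?X \<omega>\<bar> ^ p)" "integrable M (\<lambda>\<omega>. ?X \<omega> ^ p)" for p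
    using pw by (auto intro!: integrable_bounded[of _ "?T ^ p"] simp: power_abs)
  have "variance ?X = ?q" by (simp add: EX second_moment_def)
  then have "cmod (char (distr M borel ?X) ?t - (1 - (of_real ?t)\<^sup>2 * of_real ?q / 2)) \<le> (?t\<^sup>2 / 6) * expectation (\<lambda>\<omega>. min (6 * (?X \<omega>)\<^sup>2) (\<bar>?t\<bar> * \<bar>?X \<omega>\<bar> ^ 3))"
    using char_approx3'[OF _ _ _ EX _ refl, of ?q ?t] intp(2)[of 1] intp(2)[of 2] by simp
  also have "1 - (of_real ?t)\<^sup>2 * of_real ?q / 2 = complex_of_real (1 - ?t\<^sup>2 * ?q / 2)"
    by (simp only: of_real_diff of_real_mult of_real_divide of_real_power of_real_1 of_real_numeral)
  also have "char (distr M borel ?X) ?t = expectation (\<lambda>\<omega>. iexp (?t * ?X \<omega>))"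
    unfolding char_def by (subst integral_distr) auto
  also have "expectation (\<lambda>\<omega>. min (6 * (?X \<omega>)\<^sup>2) (\<bar>?t\<bar> * \<bar>?X \<omega>\<bar> ^ 3)) \<le> expectation (\<lambda>\<omega>. ?t * ?T ^ 3)"
  proof (rule integral_mono)
    show "min (6 * (?X \<omega>)\<^sup>2) (\<bar>?t\<bar> * \<bar>?X \<omega>\<bar> ^ 3) \<le> ?t * ?T ^ 3" for \<omega>
      using mult_left_mono[OF pw[of \<omega> 3], of ?t] by simp
    show "integrable M (\<lambda>\<omega>. min (6 * (?X \<omega>)\<^sup>2) (\<bar>?t\<bar> * \<bar>?X \<omega>\<bar> ^ 3))"
      using intp(1)[of 3] intp(2)[of 2] by (intro integrable_min) auto
  qed simp
  also have "(?t\<^sup>2 / 6) * expectation (\<lambda>\<omega>. ?t * ?T ^ 3) = ?T ^ 3 / (6 * real N * sqrt (real N))"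
    using N by (simp add: prob_space power_divide)
  finally have 1: "cmod (expectation (\<lambda>\<omega>. iexp (?t * ?X \<omega>)) - of_real (1 - ?t\<^sup>2 * ?q / 2)) \<le> ?T ^ 3 / (6 * real N * sqrt (real N))"
    by (simp add: mult_left_mono)
  have q: "0 \<le> ?q / (2 * real N)" using second_moment_bounds[OF b] by simp
  have t2: "?t\<^sup>2 * ?q / 2 = ?q / (2 * real N)" using N by (simp add: power_divide)
  have "\<bar>exp (- (?q / (2 * real N))) - (1 - ?q / (2 * real N))\<bar> \<le> (?q / (2 * real N))\<^sup>2"
    by (rule abs_exp_minus_approx[OF q])
  also have "\<dots> \<le> (?T\<^sup>2 / (2 * real N))\<^sup>2"
    using q second_moment_bounds[OF b] N by (intro power_mono divide_right_mono) auto
  also have "\<dots> = ?T ^ 4 / (4 * (real N)\<^sup>2)" by (simp add: power_divide power_mult_distrib flip: power_mult)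
  finally have 2: "cmod (of_real (exp (- (?q / (2 * real N))) - (1 - ?t\<^sup>2 * ?q / 2))) \<le> ?T ^ 4 / (4 * (real N)\<^sup>2)"
    unfolding t2 norm_of_real .
  have "cmod (e - w) \<le> cmod (e - r) + cmod (w - r)" for e w r :: complex
    using norm_triangle_ineq4[of "e - r" "w - r"] by simp
  then show ?thesis
    by (rule order_trans) (rule add_mono[OF 1 2[unfolded of_real_diff[of "exp _"]]])
qed

definition block_incr :: "nat \<Rightarrow> nat \<Rightarrow> nat \<Rightarrow> 'a \<Rightarrow> real^'n" where
  "block_incr m N i \<omega> = (\<Sum>j\<in>{knot m N i..<knot m N (Suc i)}. (1 / sqrt (real N)) *\<^sub>R Y j \<omega>)"

lemma measurable_block_incr [measurable]: "block_incr m N i \<in> borel_measurable M"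
  unfolding block_incr_def by measurable

text \<open>The expectation factors over single steps, each of which carries the frequency of its
  block. Replacing every factor by its Gaussian counterpart changes the product by at most the sum
  of the differences, as all factors lie in the unit disc; the exponents then add up to differences
  of averages at the knots.\<close>

lemma char_block_incr_tendsto:
  assumes cov: "\<And>b. (\<lambda>k. (\<Sum>j<k. second_moment b j) / real k) \<longlonglongrightarrow> b \<bullet> b" and m: "m > 0"
  shows "(\<lambda>N. expectation (\<lambda>\<omega>. iexp (\<Sum>i<m. a i \<bullet> block_incr m N i \<omega>))) \<longlonglongrightarrow> of_real (exp (- (\<Sum>i<m. a i \<bullet> a i) / (2 * real m)))"
proof -
  define \<beta> where "\<beta> = (\<Sum>i<m. norm (a i))"
  \<comment> \<open>The block containing \<open>j\<close>; in \<open>b\<close> the default 0 covers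
    indices outside all blocks and respects the bound \<open>\<beta>\<close>.\<close>
  define idx where "idx N j = (LEAST i. j < knot m N (Suc i))" for N j
  define b where "b N j = (if idx N j < m then a (idx N j) else 0)" for N j
  let ?T = "\<beta> * B"
  have idx: "idx N j = i" if "j \<in> {knot m N i..<knot m N (Suc i)}" for N i j
    unfolding idx_def
  proof (rule Least_equality)
    show "j < knot m N (Suc i)" using that by simp
    show "i \<le> i'" if "j < knot m N (Suc i')" for i'
    proof (rule ccontr)
      assume "\<not> i \<le> i'"
      then have "knot m N (Suc i') \<le> knot m N i" using knot_simps(3) by (intro monoD[of "knot m N"]) auto
      then show False using that \<open>j \<in> _\<close> by simp
    qed
  qed
  have blocks: "(\<Sum>i<m. \<Sum>j\<in>{knot m N i..<knot m N (Suc i)}. h (a i) j) = (\<Sum>j<N. h (b N j) j)" for h :: "real^'n \<Rightarrow> nat \<Rightarrow> real" and N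
  proof -
    have "(\<Sum>i<m. \<Sum>j\<in>{knot m N i..<knot m N (Suc i)}. h (a i) j) = (\<Sum>i<m. \<Sum>j\<in>{knot m N i..<knot m N (Suc i)}. h (b N j) j)"
      using idx by (intro sum.cong refl) (simp add: b_def)
    also have "\<dots> = (\<Sum>j<knot m N m. h (b N j) j)" by (rule sum_blocks[OF knot_simps(1,3)])
    finally show ?thesis using knot_simps(2)[OF m] by simp
  qed
  have \<beta>: "norm (b N j) \<le> \<beta>" for N j
    unfolding b_def \<beta>_def by (auto intro!: member_le_sum sum_nonneg)
  have T: "0 \<le> ?T" using B_nonneg by (simp add: \<beta>_def sum_nonneg)
  let ?z = "\<lambda>N j. expectation (\<lambda>\<omega>. iexp (1 / sqrt (real N) * (b N j \<bullet> Y j \<omega>)))"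
  let ?w = "\<lambda>N j. complex_of_real (exp (- (second_moment (b N j) j / (2 * real N))))"
  have z: "expectation (\<lambda>\<omega>. iexp (\<Sum>i<m. a i \<bullet> block_incr m N i \<omega>)) = (\<Prod>j<N. ?z N j)" for N
  proof -
    have "(\<Sum>i<m. a i \<bullet> block_incr m N i \<omega>) = (\<Sum>j<N. 1 / sqrt (real N) * (b N j \<bullet> Y j \<omega>))" for \<omega>
      using blocks[of "\<lambda>a j. 1 / sqrt (real N) * (a \<bullet> Y j \<omega>)" N] by (simp add: block_incr_def inner_sum_right)
    then have "expectation (\<lambda>\<omega>. iexp (\<Sum>i<m. a i \<bullet> block_incr m N i \<omega>)) = expectation (\<lambda>\<omega>. (\<Prod>j<N. iexp (1 / sqrt (real N) * (b N j \<bullet> Y j \<omega>))))"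
      by (simp only: of_real_sum sum_distrib_left exp_sum[OF finite_lessThan])
    also have "\<dots> = (\<Prod>j<N. ?z N j)"
    proof (rule indep_vars_lebesgue_integral)
      show "indep_vars (\<lambda>_. borel) (\<lambda>j \<omega>. iexp (1 / sqrt (real N) * (b N j \<bullet> Y j \<omega>))) {..<N}"
        by (rule indep_vars_compose2[OF indep_vars_subset[OF indep]]) auto
      show "integrable M (\<lambda>\<omega>. iexp (1 / sqrt (real N) * (b N j \<bullet> Y j \<omega>)))" for j
      proof (rule integrable_bounded[of _ 1])
        show "(\<lambda>\<omega>. iexp (1 / sqrt (real N) * (b N j \<bullet> Y j \<omega>))) \<in> borel_measurable M" by measurable
      qed (simp del: of_real_mult)
    qed simp
    finally show ?thesis .
  qed
  have "(\<lambda>N. (\<Prod>j<N. ?z N j) - (\<Prod>j<N. ?w N j)) \<longlonglongrightarrow> 0"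
  proof (rule Lim_null_comparison)
    show "\<forall>\<^sub>F N in sequentially. cmod ((\<Prod>j<N. ?z N j) - (\<Prod>j<N. ?w N j)) \<le> ?T ^ 3 / 6 * (1 / sqrt (real N)) + ?T ^ 4 / 4 * (1 / real N)"
      using eventually_gt_at_top[of 0]
    proof eventually_elim
      case (elim N)
      have "cmod ((\<Prod>j<N. ?z N j) - (\<Prod>j<N. ?w N j)) \<le> (\<Sum>j<N. cmod (?z N j - ?w N j))"
      proof (rule norm_prod_diff)
        show "cmod (?z N j) \<le> 1" for j
        proof -
          have "cmod (?z N j) \<le> expectation (\<lambda>\<omega>. cmod (iexp (1 / sqrt (real N) * (b N j \<bullet> Y j \<omega>))))"
            by (rule integral_norm_bound)
          then show ?thesis by (simp add: prob_space del: of_real_mult)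
        qed
        show "cmod (?w N j) \<le> 1" for j using second_moment_bounds(1)[OF \<beta>, of N j j] by simp
      qed
      also have "\<dots> \<le> (\<Sum>j<N. ?T ^ 3 / (6 * real N * sqrt (real N)) + ?T ^ 4 / (4 * (real N)\<^sup>2))"
        by (intro sum_mono expectation_iexp_Y_approx \<beta> elim)
      also have "\<dots> = ?T ^ 3 / 6 * (1 / sqrt (real N)) + ?T ^ 4 / 4 * (1 / real N)"
        using elim by (simp add: field_simps power2_eq_square)
      finally show ?case .
    qed
    have "(\<lambda>N. 1 / sqrt (real N)) \<longlonglongrightarrow> 0"
      using tendsto_real_sqrt[OF lim_1_over_n] by (simp add: real_sqrt_divide)
    then have "(\<lambda>N. ?T ^ 3 / 6 * (1 / sqrt (real N)) + ?T ^ 4 / 4 * (1 / real N)) \<longlonglongrightarrow> ?T ^ 3 / 6 * 0 + ?T ^ 4 / 4 * 0"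
      by (intro tendsto_intros lim_1_over_n)
    then show "(\<lambda>N. ?T ^ 3 / 6 * (1 / sqrt (real N)) + ?T ^ 4 / 4 * (1 / real N)) \<longlonglongrightarrow> 0" by simp
  qed
  moreover have "(\<lambda>N. \<Prod>j<N. ?w N j) \<longlonglongrightarrow> of_real (exp (- (\<Sum>i<m. a i \<bullet> a i) / (2 * real m)))"
  proof -
    have w: "(\<Prod>j<N. ?w N j) = of_real (exp (- (\<Sum>i<m. (\<Sum>j<knot m N (Suc i). second_moment (a i) j) / real N - (\<Sum>j<knot m N i. second_moment (a i) j) / real N) / 2))" for N
    proof -
      have "(\<Prod>j<N. ?w N j) = of_real (exp (\<Sum>j<N. - (second_moment (b N j) j / (2 * real N))))"
        by (simp add: exp_sum)
      also have "(\<Sum>j<N. - (second_moment (b N j) j / (2 * real N))) = - ((\<Sum>j<N. second_moment (b N j) j) / real N) / 2"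
        by (simp add: sum_negf sum_divide_distrib mult.commute)
      also have "(\<Sum>j<N. second_moment (b N j) j) = (\<Sum>i<m. \<Sum>j\<in>{knot m N i..<knot m N (Suc i)}. second_moment (a i) j)"
        by (rule blocks[symmetric])
      also have "\<dots> = (\<Sum>i<m. (\<Sum>j<knot m N (Suc i). second_moment (a i) j) - (\<Sum>j<knot m N i. second_moment (a i) j))"
        using knot_simps(3)[of m N] by (intro sum.cong refl) (simp add: lessThan_atLeast0 sum_diff_nat_ivl monoD)
      finally show ?thesis by (simp add: sum_divide_distrib diff_divide_distrib)
    qed
    have "(\<lambda>N. \<Sum>i<m. (\<Sum>j<knot m N (Suc i). second_moment (a i) j) / real N - (\<Sum>j<knot m N i. second_moment (a i) j) / real N)
      \<longlonglongrightarrow> (\<Sum>i<m. real (Suc i) / real m * (a i \<bullet> a i) - real i / real m * (a i \<bullet> a i))"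
      by (intro tendsto_sum tendsto_diff knot_average_tendsto[OF m cov])
    also have "(\<Sum>i<m. real (Suc i) / real m * (a i \<bullet> a i) - real i / real m * (a i \<bullet> a i)) = (\<Sum>i<m. a i \<bullet> a i) / real m"
      unfolding sum_divide_distrib by (intro sum.cong refl) (simp add: algebra_simps add_divide_distrib diff_divide_distrib)
    finally have "(\<lambda>N. - (\<Sum>i<m. (\<Sum>j<knot m N (Suc i). second_moment (a i) j) / real N - (\<Sum>j<knot m N i. second_moment (a i) j) / real N) / 2)
      \<longlonglongrightarrow> - ((\<Sum>i<m. a i \<bullet> a i) / real m) / 2" by (intro tendsto_intros) auto
    then show ?thesis unfolding w by (intro tendsto_of_real tendsto_exp) (simp add: mult.commute)
  qed
  ultimately show ?thesis unfolding z by (rule Lim_transform[rotated])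
qed

text \<open>A block has at most \<open>N\<close> steps, so a threshold of order
  \<open>sqrt N\<close> yields a bound free of \<open>N\<close>; this is the tightness required for
  the block increments.\<close>

lemma prob_block_exceed:
  assumes "m > 0" "N > 0" "K > 0"
  shows "prob {\<omega>\<in>space M. \<exists>p\<in>{..<m} \<times> UNIV. K < \<bar>block_incr m N (fst p) \<omega> $ snd p\<bar>} \<le> real m * (4 * B ^ 4 / K ^ 4)"
proof -
  let ?A = "\<lambda>i. exceed (K * sqrt (real N)) (knot m N i) (knot m N (Suc i) - knot m N i)"
  have "prob {\<omega>\<in>space M. \<exists>p\<in>{..<m} \<times> UNIV. K < \<bar>block_incr m N (fst p) \<omega> $ snd p\<bar>} \<le> prob (\<Union>i<m. ?A i)"
  proof (rule finite_measure_mono)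
    show "{\<omega>\<in>space M. \<exists>p\<in>{..<m} \<times> UNIV. K < \<bar>block_incr m N (fst p) \<omega> $ snd p\<bar>} \<subseteq> (\<Union>i<m. ?A i)"
    proof
      fix \<omega> assume "\<omega> \<in> {\<omega>\<in>space M. \<exists>p\<in>{..<m} \<times> UNIV. K < \<bar>block_incr m N (fst p) \<omega> $ snd p\<bar>}"
      then obtain i c where \<omega>: "\<omega> \<in> space M" and "i \<in> {..<m}" and K: "K < \<bar>block_incr m N i \<omega> $ c\<bar>" by auto
      have "K < norm (block_incr m N i \<omega>)" using K component_le_norm_cart[of "block_incr m N i \<omega>" c] by linarith
      also have "block_incr m N i \<omega> = (1 / sqrt (real N)) *\<^sub>R (\<Sum>j\<in>{knot m N i..<knot m N (Suc i)}. Y j \<omega>)"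
        by (simp add: block_incr_def scaleR_sum_right)
      also have "norm \<dots> = norm (\<Sum>j\<in>{knot m N i..<knot m N (Suc i)}. Y j \<omega>) / sqrt (real N)"
        using \<open>N > 0\<close> by simp
      finally have "K * sqrt (real N) < norm (\<Sum>j\<in>{knot m N i..<knot m N (Suc i)}. Y j \<omega>)"
        using \<open>N > 0\<close> by (simp add: less_divide_eq)
      moreover have "knot m N i + (knot m N (Suc i) - knot m N i) = knot m N (Suc i)"
        using knot_simps(3) by (simp add: monoD)
      ultimately have "\<omega> \<in> ?A i" using \<omega> unfolding exceed_def
        by (intro CollectI conjI exI[of _ "knot m N (Suc i) - knot m N i"]) simp_all
      then show "\<omega> \<in> (\<Union>i<m. ?A i)" using \<open>i \<in> {..<m}\<close> by blast
    qed
  qed auto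
  also have "\<dots> \<le> (\<Sum>i<m. prob (?A i))" by (rule finite_measure_subadditive_finite) auto
  also have "\<dots> \<le> (\<Sum>i<m. 4 * B ^ 4 / K ^ 4)"
  proof (rule sum_mono)
    fix i assume "i \<in> {..<m}"
    then have "knot m N (Suc i) \<le> knot m N m" using knot_simps(3) by (intro monoD[of "knot m N"]) auto
    then have n: "real (knot m N (Suc i) - knot m N i) \<le> real N" using knot_simps(2)[OF assms(1)] by simp
    have "prob (?A i) \<le> 4 * (real (knot m N (Suc i) - knot m N i))\<^sup>2 * B ^ 4 / (K * sqrt (real N)) ^ 4"
      using assms by (intro maximal_inequality) auto
    also have "\<dots> \<le> 4 * (real N)\<^sup>2 * B ^ 4 / (K * sqrt (real N)) ^ 4"
      using n B_nonneg assms by (intro divide_right_mono mult_right_mono mult_left_mono power_mono) auto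
    also have "(K * sqrt (real N)) ^ 4 = K ^ 4 * (real N)\<^sup>2"
      by (simp add: power_mult_distrib power4_eq_xxxx power2_eq_square)
    also have "4 * (real N)\<^sup>2 * B ^ 4 / (K ^ 4 * (real N)\<^sup>2) = 4 * B ^ 4 / K ^ 4" using assms by (simp add: field_simps)
    finally show "prob (?A i) \<le> 4 * B ^ 4 / K ^ 4" .
  qed
  finally show ?thesis by simp
qed

end

section \<open>From block increments to paths\<close>

context bounded_independent_vectors
begin

text \<open>A path with \<open>m\<close> pieces is a continuous function of \<open>m\<close>
  vectors, so convergence of characteristic functions and tightness of the block increments
  suffice.\<close>

lemma expectation_block_incr_tendsto:
  fixes W :: "(real^'n) path0 measure"
  assumes cov: "\<And>b. (\<lambda>k. (\<Sum>j<k. second_moment b j) / real k) \<longlonglongrightarrow> b \<bullet> b" and m: "m > 0"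
    and W: "wiener_measure W" and g: "\<And>x. 0 \<le> g x \<and> g x \<le> 1" "continuous_on UNIV g"
  shows "(\<lambda>N. expectation (\<lambda>\<omega>. g (poly_path m (\<lambda>i. block_incr m N i \<omega>)))) \<longlonglongrightarrow> (LINT f|W. (g (poly_path m (path_incr m f)) :: real))"
proof -
  let ?J = "{..<m} \<times> (UNIV :: 'n set)"
  let ?v = "\<lambda>y::nat \<times> 'n \<Rightarrow> real. \<lambda>j. \<chi> i. y (j, i)"
  define G where "G y = g (poly_path m (?v y))" for y
  define X where "X N \<omega> = (\<lambda>p. block_incr m N (fst p) \<omega> $ snd p)" for N \<omega>
  define Z where "Z f = (\<lambda>p. path_incr m f (fst p) $ snd p)" for f :: "(real^'n) path0"
  have mg: "g \<in> borel_measurable borel" using g(2) by (rule borel_measurable_continuous_onI)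
  have comp: "(\<lambda>x::real^'n. x $ i) \<in> borel_measurable borel" for i
    by (intro borel_measurable_continuous_onI continuous_intros)
  have phase: "(\<Sum>p\<in>?J. a p * (y (fst p) $ snd p)) = (\<Sum>j<m. (\<chi> i. a (j, i)) \<bullet> (y j :: real^'n))" for a y
    unfolding inner_vec_def sum.cartesian_product by (intro sum.cong) auto
  have "(\<lambda>N. expectation (\<lambda>\<omega>. G (X N \<omega>))) \<longlonglongrightarrow> (LINT f|W. G (Z f))"
  proof (rule tendsto_integral_of_tendsto_char[where J = ?J and C = 1 and g = G and X = X and Z = Z and M = "\<lambda>_. M"])
    show "(\<lambda>N. expectation (\<lambda>\<omega>. iexp (\<Sum>p\<in>?J. a p * X N \<omega> p))) \<longlonglongrightarrow> (LINT f|W. iexp (\<Sum>p\<in>?J. a p * Z f p))" for a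
      unfolding X_def Z_def phase phase[of a "\<lambda>i. block_incr m _ i _"] char_path_incr[OF W m]
      by (rule char_block_incr_tendsto[OF cov m])
    show "\<exists>K>0. \<forall>\<^sub>F N in sequentially. prob {\<omega>\<in>space M. \<exists>p\<in>?J. K < \<bar>X N \<omega> p\<bar>} \<le> e" if "e > 0" for e
    proof -
      \<comment> \<open>Being at least 1, \<open>K\<close> is bounded by its fourth power.\<close>
      define K where "K = max 1 (real m * (4 * B ^ 4) / e)"
      have K: "K \<ge> 1" "real m * (4 * B ^ 4) / e \<le> K" by (auto simp: K_def)
      have "K ^ 1 \<le> K ^ 4" using K by (intro power_increasing) auto
      then have "real m * (4 * B ^ 4) / e \<le> K ^ 4" using K by simp
      then have "real m * (4 * B ^ 4 / K ^ 4) \<le> e"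
        using \<open>e > 0\<close> K by (simp add: divide_le_eq mult_ac)
      moreover have "\<forall>\<^sub>F N in sequentially. prob {\<omega>\<in>space M. \<exists>p\<in>?J. K < \<bar>X N \<omega> p\<bar>} \<le> real m * (4 * B ^ 4 / K ^ 4)"
        using eventually_gt_at_top[of 0]
        by eventually_elim (use K m in \<open>unfold X_def, intro prob_block_exceed, auto\<close>)
      ultimately show ?thesis using K by (intro exI[of _ K]) (auto elim: eventually_mono)
    qed
    have "continuous_on UNIV (\<lambda>y. poly_path m (?v y))"
      by (intro continuous_on_poly_path continuous_on_vec_lambda continuous_on_product_coordinates)
    then show "continuous_on UNIV G"
      unfolding G_def by (rule continuous_on_compose2[OF g(2)]) auto
    show "\<bar>G y\<bar> \<le> 1" for y unfolding G_def using g(1) by simp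
    show "G y = G (\<lambda>p. if p \<in> ?J then y p else 0)" for y
      unfolding G_def by (intro arg_cong[where f = g] poly_path_cong) simp
    show "(\<lambda>\<omega>. X N \<omega> p) \<in> borel_measurable M" for N p
      unfolding X_def by (rule measurable_compose[OF measurable_block_incr comp])
    show "(\<lambda>f. Z f p) \<in> borel_measurable W" if "p \<in> ?J" for p
      unfolding Z_def using that by (intro measurable_compose[OF measurable_path_incr[OF W] comp]) auto
    have "(\<lambda>\<omega>. poly_path m (\<lambda>i. block_incr m N i \<omega>)) \<in> borel_measurable M" for N
      by (rule measurable_poly_path) simp
    from measurable_compose[OF this mg] show "(\<lambda>\<omega>. G (X N \<omega>)) \<in> borel_measurable M" for N
      by (simp add: G_def X_def)
    have "(\<lambda>f. poly_path m (path_incr m f)) \<in> borel_measurable W"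
      by (rule measurable_poly_path) (rule measurable_path_incr[OF W])
    from measurable_compose[OF this mg] show "(\<lambda>f. G (Z f)) \<in> borel_measurable W"
      by (simp add: G_def Z_def)
  qed (auto intro: prob_space_axioms prob_space_wiener[OF W])
  then show ?thesis by (simp add: G_def X_def Z_def)
qed

text \<open>The block count \<open>m\<close> is fixed first, large enough for the Wiener integral of
  \<open>g\<close> to be close to that of the interpolation and for large oscillations within blocks
  to be improbable uniformly in \<open>N \<ge> m\<close>; then \<open>N\<close> tends to infinity
  with only \<open>m\<close> vectors left.\<close>

proposition invariance_principle:
  fixes W :: "(real^'n) path0 measure"
  assumes cov: "\<And>b. (\<lambda>k. (\<Sum>j<k. second_moment b j) / real k) \<longlonglongrightarrow> b \<bullet> b"
    and W: "wiener_measure W" and g: "\<And>x. 0 \<le> g x \<and> g x \<le> 1" "\<And>x y. \<bar>g x - g y\<bar> \<le> K * dist x y"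
  shows "(\<lambda>N. expectation (\<lambda>\<omega>. g (poly_path N (\<lambda>j. (1 / sqrt (real N)) *\<^sub>R Y j \<omega>)))) \<longlonglongrightarrow> (LINT f|W. (g f :: real))"
proof (rule tendstoI)
  fix e :: real assume "e > 0"
  interpret W: prob_space W by (rule prob_space_wiener[OF W])
  have cg: "continuous_on UNIV g"
    by (rule lipschitz_imp_continuous_on[of _ K]) (use g(2) in \<open>simp add: dist_real_def\<close>)
  have mg: "g \<in> borel_measurable borel" using cg by (rule borel_measurable_continuous_onI)
  have norm_g: "norm (g x) \<le> 1" for x using g(1)[of x] by simp
  let ?V = "\<lambda>N \<omega> j. (1 / sqrt (real N)) *\<^sub>R Y j \<omega>"
  define K' where "K' = max K 1"
  have K': "K' > 0" "\<bar>g x - g y\<bar> \<le> K' * dist x y" for x y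
    using g(2)[of x y] mult_right_mono[of K K' "dist x y"] by (auto simp: K'_def)
  \<comment> \<open>Paths within distance \<open>3 * d\<close> then have values of \<open>g\<close>
    within \<open>e / 6\<close>; \<open>K'\<close> is positive, so the division is sound.\<close>
  define d where "d = e / (18 * K')"
  have d: "d > 0" "K' * (3 * d) = e / 6" using \<open>e > 0\<close> K' by (auto simp: d_def)
  have "(\<lambda>m. LINT f|W. g (poly_path m (path_incr m f))) \<longlonglongrightarrow> (LINT f|W. g f)"
  proof (rule integral_dominated_convergence[where w = "\<lambda>_. 1"])
    have "(\<lambda>m. g (poly_path m (path_incr m f))) \<longlonglongrightarrow> g f" for f
      using cg poly_path_incr_tendsto[of f] by (rule continuous_on_tendsto_compose) auto
    then show "AE f in W. (\<lambda>m. g (poly_path m (path_incr m f))) \<longlonglongrightarrow> g f" by simp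
    show "(\<lambda>f. g (poly_path m (path_incr m f))) \<in> borel_measurable W" for m
      by (rule measurable_compose[OF measurable_poly_path mg]) (rule measurable_path_incr[OF W])
    show "g \<in> borel_measurable W" using mg sets_wiener[OF W] by (simp cong: measurable_cong_sets)
  qed (use norm_g in auto)
  then have "\<forall>\<^sub>F m in sequentially. dist (LINT f|W. g (poly_path m (path_incr m f))) (LINT f|W. g f) < e / 6"
    using \<open>e > 0\<close> by (intro tendstoD) auto
  \<comment> \<open>Each of the \<open>m\<close> blocks has at most \<open>2 * N / m\<close> steps,
    and \<open>4 * 2^2 = 16\<close>; the \<open>m\<close> probabilities of order
    \<open>1 / m^2\<close> add up to order \<open>1 / m\<close>.\<close>
  moreover have "\<forall>\<^sub>F m in sequentially. 16 * B ^ 4 / d ^ 4 * (1 / real m) < e / 12"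
  proof (rule order_tendstoD(2))
    show "(\<lambda>m. 16 * B ^ 4 / d ^ 4 * (1 / real m)) \<longlonglongrightarrow> 16 * B ^ 4 / d ^ 4 * 0"
      by (intro tendsto_intros lim_1_over_n)
  qed (use \<open>e > 0\<close> in simp)
  ultimately have "\<forall>\<^sub>F m in sequentially. dist (LINT f|W. g (poly_path m (path_incr m f))) (LINT f|W. g f) < e / 6
     \<and> 16 * B ^ 4 / d ^ 4 * (1 / real m) < e / 12 \<and> m > 0"
    using eventually_gt_at_top[of 0] by eventually_elim auto
  then obtain m where m: "dist (LINT f|W. g (poly_path m (path_incr m f))) (LINT f|W. g f) < e / 6"
    "16 * B ^ 4 / d ^ 4 * (1 / real m) < e / 12" "m > 0"
    by (auto simp: eventually_sequentially)
  have "\<forall>\<^sub>F N in sequentially. dist (expectation (\<lambda>\<omega>. g (poly_path m (\<lambda>i. block_incr m N i \<omega>)))) (LINT f|W. g (poly_path m (path_incr m f))) < e / 6"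
    using expectation_block_incr_tendsto[OF cov m(3) W g(1) cg] \<open>e > 0\<close> by (intro tendstoD) auto
  moreover have "\<forall>\<^sub>F N in sequentially. B * (1 / sqrt (real N)) < d"
  proof (rule order_tendstoD(2))
    have "(\<lambda>N. 1 / sqrt (real N)) \<longlonglongrightarrow> 0"
      using tendsto_real_sqrt[OF lim_1_over_n] by (simp add: real_sqrt_divide)
    then show "(\<lambda>N. B * (1 / sqrt (real N))) \<longlonglongrightarrow> B * 0" by (intro tendsto_intros)
  qed (use d in simp)
  ultimately show "\<forall>\<^sub>F N in sequentially. dist (expectation (\<lambda>\<omega>. g (poly_path N (?V N \<omega>)))) (LINT f|W. g f) < e"
    using eventually_ge_at_top[of m]
  proof eventually_elim
    case (elim N)
    have N: "N > 0" "real m \<le> real N" using elim(3) m(3) by auto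
    let ?n = "\<lambda>i. knot m N (Suc i) - knot m N i"
    define A where "A = (\<Union>i<m. exceed (d * sqrt (real N)) (knot m N i) (?n i))"
    have A: "A \<in> sets M" unfolding A_def by auto
    have "prob A \<le> (\<Sum>i<m. prob (exceed (d * sqrt (real N)) (knot m N i) (?n i)))"
      unfolding A_def by (rule finite_measure_subadditive_finite) auto
    also have "\<dots> \<le> (\<Sum>i<m. 16 * B ^ 4 / d ^ 4 * (1 / (real m)\<^sup>2))"
    proof (rule sum_mono)
      fix i
      have "1 \<le> real N / real m" using N m(3) by simp
      then have n: "real (?n i) \<le> 2 * real N / real m" using knot_block_length[OF m(3), of N i] by simp
      have "prob (exceed (d * sqrt (real N)) (knot m N i) (?n i)) \<le> 4 * (real (?n i))\<^sup>2 * B ^ 4 / (d * sqrt (real N)) ^ 4"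
        using d N by (intro maximal_inequality) auto
      also have "\<dots> \<le> 4 * (2 * real N / real m)\<^sup>2 * B ^ 4 / (d * sqrt (real N)) ^ 4"
        using n B_nonneg d by (intro divide_right_mono mult_right_mono mult_left_mono power_mono) auto
      also have "(d * sqrt (real N)) ^ 4 = d ^ 4 * (real N)\<^sup>2"
        by (simp add: power_mult_distrib power4_eq_xxxx power2_eq_square)
      also have "4 * (2 * real N / real m)\<^sup>2 * B ^ 4 / (d ^ 4 * (real N)\<^sup>2) = 16 * B ^ 4 / d ^ 4 * (1 / (real m)\<^sup>2)"
        using N d by (simp add: power_divide power_mult_distrib)
      finally show "prob (exceed (d * sqrt (real N)) (knot m N i) (?n i)) \<le> 16 * B ^ 4 / d ^ 4 * (1 / (real m)\<^sup>2)" .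
    qed
    also have "\<dots> = 16 * B ^ 4 / d ^ 4 * (1 / real m)" using m(3) by (simp add: power2_eq_square)
    finally have pA: "prob A \<le> e / 12" using m(2) by linarith
    have close: "dist (poly_path N (?V N \<omega>)) (poly_path m (\<lambda>i. block_incr m N i \<omega>)) \<le> 3 * d" if "\<omega> \<in> space M" "\<omega> \<notin> A" for \<omega>
      unfolding block_incr_def
    proof (rule poly_path_blocks_close[OF m(3)])
      show "norm (?V N \<omega> j) \<le> d" for j
      proof -
        have "norm (?V N \<omega> j) = norm (Y j \<omega>) * (1 / sqrt (real N))" by simp
        also have "\<dots> \<le> B * (1 / sqrt (real N))" by (intro mult_right_mono bounded_Y) auto
        finally show ?thesis using elim(2) by simp
      qed
      show "norm (\<Sum>j\<in>{knot m N i..<knot m N i + k}. ?V N \<omega> j) \<le> d" if i: "i < m" "k \<le> ?n i" for i k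
      proof -
        have "\<omega> \<notin> exceed (d * sqrt (real N)) (knot m N i) (?n i)" using \<open>\<omega> \<notin> A\<close> i(1) unfolding A_def by blast
        then have "norm (\<Sum>j\<in>{knot m N i..<knot m N i + k}. Y j \<omega>) \<le> d * sqrt (real N)"
          using \<open>\<omega> \<in> space M\<close> i(2) by (auto simp: exceed_def not_less)
        then have "norm (\<Sum>j\<in>{knot m N i..<knot m N i + k}. Y j \<omega>) / sqrt (real N) \<le> d"
          using N by (simp add: divide_le_eq)
        then show ?thesis using N by (simp flip: scaleR_sum_right)
      qed
    qed
    have "norm (expectation (\<lambda>\<omega>. g (poly_path N (?V N \<omega>))) - expectation (\<lambda>\<omega>. g (poly_path m (\<lambda>i. block_incr m N i \<omega>)))) \<le> K' * (3 * d) + 2 * (e / 12)"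
    proof (rule integral_approx[where C = 1 and C' = 1 and A = A])
      show "(\<lambda>\<omega>. g (poly_path N (?V N \<omega>))) \<in> borel_measurable M"
        by (rule measurable_compose[OF measurable_poly_path mg]) simp
      show "(\<lambda>\<omega>. g (poly_path m (\<lambda>i. block_incr m N i \<omega>))) \<in> borel_measurable M"
        by (rule measurable_compose[OF measurable_poly_path mg]) simp
      show "norm (g (poly_path N (?V N \<omega>)) - g (poly_path m (\<lambda>i. block_incr m N i \<omega>))) \<le> K' * (3 * d)"
        if "\<omega> \<in> space M" "\<omega> \<notin> A" for \<omega>
        using K'(2)[of "poly_path N (?V N \<omega>)" "poly_path m (\<lambda>i. block_incr m N i \<omega>)"] mult_left_mono[OF close[OF that] less_imp_le[OF K'(1)]]
        by simp
    qed (use A pA norm_g d K' in auto)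
    then have "dist (expectation (\<lambda>\<omega>. g (poly_path N (?V N \<omega>)))) (expectation (\<lambda>\<omega>. g (poly_path m (\<lambda>i. block_incr m N i \<omega>)))) \<le> e / 3"
      unfolding d(2) dist_norm by simp
    then show ?case using elim(1) m(1) \<open>e > 0\<close> unfolding dist_real_def by linarith
  qed
qed

end

section \<open>Rotations and the limiting covariance\<close>

lemma matrix_inv_eqI:
  fixes A :: "real^'n^'n"
  assumes "A ** B = mat 1"
  shows "matrix_inv A = B"
proof -
  have BA: "B ** A = mat 1" using assms by (rule matrix_left_right_inverse1)
  have "A' = B" if "A ** A' = mat 1" for A'
    using that BA by (metis matrix_mul_assoc matrix_mul_lid matrix_mul_rid)
  then show ?thesis unfolding matrix_inv_def using assms BA by (intro some_equality conjI) blast+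
qed

lemma matrix_inv_right:
  fixes A :: "real^'n^'n"
  assumes "invertible A"
  shows "A ** matrix_inv A = mat 1"
proof -
  obtain B where B: "A ** B = mat 1" using assms by (auto simp: invertible_def)
  then show ?thesis using matrix_inv_eqI[OF B] by simp
qed

lemma sum_UNIV_prod: "(\<Sum>p\<in>UNIV. f p) = (\<Sum>k\<in>UNIV. \<Sum>j\<in>UNIV. f (k, j))"
  by (simp add: sum.cartesian_product flip: UNIV_Times_UNIV)

text \<open>A geometric sum whose ratio is not 1 stays bounded, so division by \<open>K\<close>
  sends it to 0. The exponent \<open>Suc j\<close> matches increments that begin with the first
  inverse power.\<close>

lemma cesaro_powers:
  fixes \<rho> :: complex
  assumes "cmod \<rho> = 1"
  shows "(\<lambda>K. (\<Sum>j<K. \<rho> ^ Suc j) / of_nat K) \<longlonglongrightarrow> (if \<rho> = 1 then 1 else 0)"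
proof (cases "\<rho> = 1")
  case True
  have "\<forall>\<^sub>F K in sequentially. (\<Sum>j<K. \<rho> ^ Suc j) / of_nat K = 1"
    using eventually_gt_at_top[of 0] by eventually_elim (simp add: True)
  then show ?thesis using True by (simp add: tendsto_eventually)
next
  case False
  have "(\<lambda>K. (\<Sum>j<K. \<rho> ^ Suc j) / of_nat K) \<longlonglongrightarrow> 0"
  proof (rule Lim_null_comparison)
    show "\<forall>\<^sub>F K in sequentially. cmod ((\<Sum>j<K. \<rho> ^ Suc j) / of_nat K) \<le> 2 / cmod (\<rho> - 1) * (1 / real K)"
    proof (rule always_eventually, rule allI)
      fix K
      have "(\<Sum>j<K. \<rho> ^ Suc j) = \<rho> * ((\<rho> ^ K - 1) / (\<rho> - 1))"
        using False by (simp add: geometric_sum sum_distrib_left[symmetric])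
      then have "cmod (\<Sum>j<K. \<rho> ^ Suc j) = cmod (\<rho> ^ K - 1) / cmod (\<rho> - 1)"
        using assms by (simp add: norm_mult norm_divide)
      also have "cmod (\<rho> ^ K - 1) \<le> cmod (\<rho> ^ K) + cmod 1" by (rule norm_triangle_ineq4)
      also have "\<dots> = 2" using assms by (simp add: norm_power)
      finally have "cmod (\<Sum>j<K. \<rho> ^ Suc j) \<le> 2 / cmod (\<rho> - 1)" by (simp add: divide_right_mono)
      then have "cmod (\<Sum>j<K. \<rho> ^ Suc j) / real K \<le> 2 / cmod (\<rho> - 1) / real K" by (rule divide_right_mono) simp
      then show "cmod ((\<Sum>j<K. \<rho> ^ Suc j) / of_nat K) \<le> 2 / cmod (\<rho> - 1) * (1 / real K)"
        by (simp only: norm_divide norm_of_nat times_divide_eq_right mult_1_right)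
    qed
    have "(\<lambda>K. 2 / cmod (\<rho> - 1) * (1 / real K)) \<longlonglongrightarrow> 2 / cmod (\<rho> - 1) * 0"
      by (intro tendsto_intros lim_1_over_n)
    then show "(\<lambda>K. 2 / cmod (\<rho> - 1) * (1 / real K)) \<longlonglongrightarrow> 0" by simp
  qed
  then show ?thesis using False by simp
qed

lemma integrable_cell_continuous:
  fixes f :: "real^'n \<Rightarrow> 'b::euclidean_space"
  assumes R: "quantizer R" and f: "continuous_on UNIV f"
  shows "integrable (cell_measure R) f"
proof -
  obtain K where K: "\<And>u. R u = 0 \<Longrightarrow> norm u \<le> K" using bounded_q_cell[OF R] by blast
  have "compact (f ` cball 0 K)" by (intro compact_continuous_image continuous_on_subset[OF f]) auto
  then obtain C where "\<forall>y\<in>f ` cball 0 K. norm y \<le> C" using compact_imp_bounded bounded_iff by metis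
  then show ?thesis using K
    by (intro integrable_cell_measureI[OF R, of _ C] borel_measurable_continuous_onI[OF f]) auto
qed

lemma matpow_mult_vec_Suc: "matpow A (Suc j) *v x = A *v (matpow A j *v x)"
  by (simp add: matpow_Suc matrix_vector_mul_assoc)

section \<open>Complex coordinates in which \<open>L\<close> is diagonal\<close>

context
  fixes R :: "real^('r::finite \<times> 2) \<Rightarrow> int^('r \<times> 2)"
    and L U :: "real^('r \<times> 2)^('r \<times> 2)"
    and \<theta> :: "'r \<Rightarrow> real"
  assumes R: "quantizer R"
    and U: "invertible U"
    and L: "L = (\<Sum>k\<in>UNIV. col_block U k ** rotation2 (\<theta> k) ** row_block (matrix_inv U) k)"
    and L_inv: "invertible L"
    and nondeg: "nondegenerate_spectrum \<theta>"
begin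

interpretation Q: prob_space "cell_measure R" by (rule prob_space_cell_measure[OF R])

abbreviation (input) P :: "real^('r \<times> 2)^('r \<times> 2)" where "P \<equiv> matrix_inv U"

lemma PU: "P ** U = mat 1" "U ** P = mat 1"
proof -
  show "U ** P = mat 1" using U by (rule matrix_inv_right)
  then show "P ** U = mat 1" by (rule matrix_left_right_inverse1)
qed

text \<open>The \<open>k\<close>-th complex coordinate, in which \<open>L\<close> acts as multiplication by \<open>cis (\<theta> k)\<close>.\<close>

definition cc :: "'r \<Rightarrow> real^('r \<times> 2) \<Rightarrow> complex" where
  "cc k v = Complex ((P *v v) $ (k, 1)) ((P *v v) $ (k, 2))"

text \<open>Since \<open>P ** U\<close> is the identity, \<open>L\<close> acts on the coordinates
  \<open>P *v v\<close> block by block, and a plane rotation is multiplication by a unit complex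
  number.\<close>

lemma cc_L: "cc k (L *v v) = cis (\<theta> k) * cc k v"
proof -
  define z where "z k = rotation2 (\<theta> k) *v (\<chi> i. (P *v v) $ (k, i))" for k
  define Z where "Z = (\<chi> p. z (fst p) $ snd p)"
  have rb: "row_block P k *v v = (\<chi> i. (P *v v) $ (k, i))" for k
    by (simp add: row_block_def matrix_vector_mult_def vec_eq_iff)
  have Lv: "L *v v = (\<Sum>k\<in>UNIV. (col_block U k ** rotation2 (\<theta> k) ** row_block P k) *v v)"
  proof -
    have "(\<Sum>k\<in>S. M k) *v v = (\<Sum>k\<in>S. M k *v v)" if "finite S" for S and M :: "'r \<Rightarrow> real^('r \<times> 2)^('r \<times> 2)"
      using that by induction (simp_all add: matrix_vector_mult_add_rdistrib)
    then show ?thesis unfolding L by simp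
  qed
  also have "\<dots> = (\<Sum>k\<in>UNIV. col_block U k *v z k)"
    by (simp add: z_def rb flip: matrix_vector_mul_assoc)
  also have "\<dots> = U *v Z"
    by (simp add: vec_eq_iff matrix_vector_mult_def col_block_def Z_def sum_UNIV_prod)
  finally have "P *v (L *v v) = Z" using PU(1) by (simp add: matrix_vector_mul_assoc)
  then show ?thesis
    by (simp add: cc_def Z_def z_def matrix_vector_mult_def sum_2 rotation2_def complex_eq_iff)
qed

lemma cc_inv: "cc k (matpow (matrix_inv L) j *v v) = cis (- \<theta> k) ^ j * cc k v"
proof (induction j)
  case (Suc j)
  have LB: "L ** matrix_inv L = mat 1" using L_inv by (rule matrix_inv_right)
  have "cc k w = cis (- \<theta> k) * (cis (\<theta> k) * cc k w)" for w by (simp add: cis_mult flip: mult.assoc)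
  also have "cis (\<theta> k) * cc k (matrix_inv L *v w) = cc k w" for w
    by (simp add: LB matrix_vector_mul_assoc flip: cc_L)
  finally have "cc k (matrix_inv L *v w) = cis (- \<theta> k) * cc k w" for w .
  then show ?case using Suc by (simp add: matpow_mult_vec_Suc)
qed simp

lemma continuous_cc: "continuous_on S f \<Longrightarrow> continuous_on S (\<lambda>u. cc k (f u))"
  unfolding cc_def Complex_eq by (intro continuous_intros continuous_on_matrix_vector_mul)

abbreviation (input) \<mu> :: "real^('r \<times> 2)" where "\<mu> \<equiv> q_mean R"

lemma q_mean_eq: "\<mu> = (LINT u|cell_measure R. u)"
  unfolding q_mean_def by (rule integral_cell_measure[OF R]) simp

lemma q_cov_eq: "q_cov R $ i $ j = (LINT u|cell_measure R. (u - \<mu>) $ i * (u - \<mu>) $ j)"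
  unfolding q_cov_def vec_lambda_beta
  by (rule integral_cell_measure[OF R], rule borel_measurable_continuous_onI) (intro continuous_intros)

text \<open>The trace in \<open>q_sigma\<close> is the expected squared length of the
  \<open>k\<close>-th pair of coordinates of the centred error.\<close>

lemma q_sigma_sqrt: "q_sigma R U k = sqrt (LINT u|cell_measure R. (cmod (cc k (u - \<mu>)))\<^sup>2)"
proof -
  have int: "integrable (cell_measure R) (\<lambda>u. c * ((u - \<mu>) $ i * (u - \<mu>) $ j))" for c i j
    by (intro integrable_cell_continuous[OF R] continuous_intros)
  have diag: "(row_block P k ** q_cov R ** transpose (row_block P k)) $ i $ i = (LINT u|cell_measure R. ((P *v (u - \<mu>)) $ (k, i))\<^sup>2)" for i
  proof -
    have "(row_block P k ** q_cov R ** transpose (row_block P k)) $ i $ i =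
        (\<Sum>l'\<in>UNIV. \<Sum>l\<in>UNIV. P $ (k, i) $ l * P $ (k, i) $ l' * q_cov R $ l $ l')"
      by (simp add: matrix_matrix_mult_def transpose_def row_block_def sum_distrib_left sum_distrib_right mult_ac)
    also have "\<dots> = (LINT u|cell_measure R. (\<Sum>l'\<in>UNIV. \<Sum>l\<in>UNIV. P $ (k, i) $ l * P $ (k, i) $ l' * ((u - \<mu>) $ l * (u - \<mu>) $ l')))"
      unfolding q_cov_eq using int by simp
    also have "(\<lambda>u. \<Sum>l'\<in>UNIV. \<Sum>l\<in>UNIV. P $ (k, i) $ l * P $ (k, i) $ l' * ((u - \<mu>) $ l * (u - \<mu>) $ l')) = (\<lambda>u. ((P *v (u - \<mu>)) $ (k, i))\<^sup>2)"
      by (simp add: fun_eq_iff matrix_vector_mult_def power2_eq_square sum_product sum_distrib_left mult_ac)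
    finally show ?thesis .
  qed
  have int2: "integrable (cell_measure R) (\<lambda>u. ((P *v (u - \<mu>)) $ p)\<^sup>2)" for p
    by (intro integrable_cell_continuous[OF R] continuous_intros continuous_on_matrix_vector_mul)
  have "trace (row_block P k ** q_cov R ** transpose (row_block P k)) =
      (LINT u|cell_measure R. ((P *v (u - \<mu>)) $ (k, 1))\<^sup>2 + ((P *v (u - \<mu>)) $ (k, 2))\<^sup>2)"
    using int2 by (simp add: trace_def sum_2 diag)
  also have "\<dots> = (LINT u|cell_measure R. (cmod (cc k (u - \<mu>)))\<^sup>2)"
    by (simp add: cc_def cmod_power2)
  finally show ?thesis by (simp add: q_sigma_def)
qed

lemma q_sigma_eq: "(q_sigma R U k)\<^sup>2 = (LINT u|cell_measure R. (cmod (cc k (u - \<mu>)))\<^sup>2)"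
  unfolding q_sigma_sqrt by (rule real_sqrt_pow2) simp

text \<open>The uniform distribution on the cell does not charge hyperplanes.\<close>

lemma q_sigma_pos: "0 < q_sigma R U k"
proof (rule ccontr)
  assume "\<not> 0 < q_sigma R U k"
  then have "(LINT u|cell_measure R. (cmod (cc k (u - \<mu>)))\<^sup>2) \<le> 0" by (simp add: q_sigma_sqrt)
  moreover have "0 \<le> (LINT u|cell_measure R. (cmod (cc k (u - \<mu>)))\<^sup>2)" by simp
  ultimately have "(LINT u|cell_measure R. (cmod (cc k (u - \<mu>)))\<^sup>2) = 0" by (rule antisym)
  moreover have "integrable (cell_measure R) (\<lambda>u. (cmod (cc k (u - \<mu>)))\<^sup>2)"
    by (intro integrable_cell_continuous[OF R] continuous_intros continuous_cc)
  ultimately have "AE u in cell_measure R. (cmod (cc k (u - \<mu>)))\<^sup>2 = 0"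
    by (subst (asm) integral_nonneg_eq_0_iff_AE) auto
  then have in_H: "AE u in cell_measure R. u \<in> {u. row (k, 1) P \<bullet> u = row (k, 1) P \<bullet> \<mu>}"
  proof eventually_elim
    case (elim u)
    then have "(P *v (u - \<mu>)) $ (k, 1) = 0" by (simp add: cc_def complex_eq_iff)
    then show ?case by (simp add: matrix_vector_mult_def row_def inner_vec_def algebra_simps sum_subtractf)
  qed
  have "row (k, 1) P \<noteq> 0"
  proof
    assume "row (k, 1) P = 0"
    moreover have "P $ (k, 1) $ l = row (k, 1) P $ l" for l by (simp add: row_def)
    ultimately have "(P ** U) $ (k, 1) $ (k, 1) = 0" by (simp add: matrix_matrix_mult_def)
    then show False unfolding PU(1) by (simp add: mat_def)
  qed
  then have "{u. row (k, 1) P \<bullet> u = row (k, 1) P \<bullet> \<mu>} \<in> null_sets lebesgue"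
    using negligible_hyperplane negligible_iff_null_sets by blast
  moreover have "closed {u. row (k, 1) P \<bullet> u = row (k, 1) P \<bullet> \<mu>}" by (rule closed_hyperplane)
  ultimately have "{u. row (k, 1) P \<bullet> u = row (k, 1) P \<bullet> \<mu>} \<in> null_sets lborel"
    using null_sets_completion_iff[of _ lborel] by (metis borel_closed sets_lborel)
  from AE_not_in[OF this] have "AE u in cell_measure R. u \<notin> {u. row (k, 1) P \<bullet> u = row (k, 1) P \<bullet> \<mu>}"
    unfolding cell_measure_def by (subst AE_density) auto
  with in_H have "AE u in cell_measure R. False" by eventually_elim blast
  then show False by simp
qed

text \<open>The columns of \<open>U\<close> scaled by \<open>q_sigma R U k / sqrt 2\<close> have as
  inverse the rows of \<open>P\<close> scaled by the reciprocals; positivity of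
  \<open>q_sigma\<close> enters here.\<close>

lemma sqrt_Phi_inv: "(matrix_inv (sqrt_Phi R U) *v w) $ p = sqrt 2 / q_sigma R U (fst p) * (P *v w) $ p"
proof -
  define A :: "real^('r \<times> 2)^('r \<times> 2)" where "A = (\<chi> p i. sqrt 2 / q_sigma R U (fst p) * P $ p $ i)"
  have s: "q_sigma R U k \<noteq> 0" for k using q_sigma_pos[of k] by simp
  have "A ** sqrt_Phi R U = mat 1"
  proof -
    have "(A ** sqrt_Phi R U) $ p $ q = (mat 1 :: real^('r \<times> 2)^('r \<times> 2)) $ p $ q" for p q
    proof -
      have "(A ** sqrt_Phi R U) $ p $ q = q_sigma R U (fst q) / q_sigma R U (fst p) * (\<Sum>i\<in>UNIV. P $ p $ i * U $ i $ q)"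
        by (simp add: A_def sqrt_Phi_def col_block_def matrix_matrix_mult_def sum_distrib_left field_simps)
      also have "(\<Sum>i\<in>UNIV. P $ p $ i * U $ i $ q) = (P ** U) $ p $ q" by (simp add: matrix_matrix_mult_def)
      finally show ?thesis using s by (simp add: PU mat_def)
    qed
    then show ?thesis by (simp add: vec_eq_iff)
  qed
  then have "matrix_inv (sqrt_Phi R U) = A" by (rule matrix_inv_eqI[OF matrix_left_right_inverse1])
  then show ?thesis by (simp add: A_def matrix_vector_mult_def sum_distrib_left mult_ac)
qed

text \<open>The linear map applied to the centred error at time \<open>Suc j\<close>, before
  division by \<open>sqrt N\<close>.\<close>

definition incr_map :: "nat \<Rightarrow> real^('r \<times> 2)^('r \<times> 2)" where
  "incr_map j = matrix_inv (sqrt_Phi R U) ** matpow (matrix_inv L) (Suc j)"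

text \<open>Rotations preserve the modulus of the complex coordinates, so the bound does not depend
  on \<open>j\<close> and the increments are uniformly bounded.\<close>

lemma incr_map_component:
  "\<bar>(incr_map j *v x) $ (k, i)\<bar> \<le> sqrt 2 / q_sigma R U k * cmod (cc k x)"
proof -
  let ?w = "matpow (matrix_inv L) (Suc j) *v x"
  have "\<bar>(P *v ?w) $ (k, i)\<bar> \<le> cmod (cc k ?w)"
    using abs_Re_le_cmod[of "cc k ?w"] abs_Im_le_cmod[of "cc k ?w"] exhaust_2[of i] by (auto simp: cc_def)
  also have "\<dots> = cmod (cc k x)" unfolding cc_inv by (simp add: norm_mult norm_power)
  finally have "sqrt 2 / q_sigma R U k * \<bar>(P *v ?w) $ (k, i)\<bar> \<le> sqrt 2 / q_sigma R U k * cmod (cc k x)"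
    using q_sigma_pos[of k] by (intro mult_left_mono) auto
  then show ?thesis using q_sigma_pos[of k]
    by (simp add: incr_map_def sqrt_Phi_inv abs_mult flip: matrix_vector_mul_assoc)
qed

text \<open>With \<open>z = (\<Sum>k. w\<^sub>k \<rho>\<^sub>k\<^sup>t)\<close>, the squared scalar increment is \<open>2 (Re z)\<^sup>2 = Re (z * cnj z + z * z)\<close>.\<close>

lemma inner_incr_map_square:
  defines "\<rho> \<equiv> \<lambda>k. cis (- \<theta> k)"
    and "w \<equiv> \<lambda>b k x. cnj (Complex (b $ (k, 1)) (b $ (k, 2))) / of_real (q_sigma R U k) * cc k x"
  shows "(b \<bullet> (incr_map j *v x))\<^sup>2 =
    Re (\<Sum>k\<in>UNIV. \<Sum>l\<in>UNIV. (w b k x * cnj (w b l x)) * (\<rho> k * cnj (\<rho> l)) ^ Suc j + (w b k x * w b l x) * (\<rho> k * \<rho> l) ^ Suc j)"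
proof -
  let ?v = "matpow (matrix_inv L) (Suc j) *v x"
  define z where "z = (\<Sum>k\<in>UNIV. w b k x * \<rho> k ^ Suc j)"
  have "b \<bullet> (incr_map j *v x) = (\<Sum>k\<in>UNIV. \<Sum>i\<in>UNIV. b $ (k, i) * (sqrt 2 / q_sigma R U k * (P *v ?v) $ (k, i)))"
    by (simp add: inner_vec_def sum_UNIV_prod incr_map_def sqrt_Phi_inv flip: matrix_vector_mul_assoc)
  also have "\<dots> = (\<Sum>k\<in>UNIV. sqrt 2 * Re (cnj (Complex (b $ (k, 1)) (b $ (k, 2))) / of_real (q_sigma R U k) * cc k ?v))"
    by (simp add: sum_2 cc_def Re_divide_of_real Im_divide_of_real add_divide_distrib algebra_simps)
  also have "\<dots> = sqrt 2 * Re z"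
    by (simp only: cc_inv z_def w_def \<rho>_def Re_sum sum_distrib_left mult_ac)
  finally have "(b \<bullet> (incr_map j *v x))\<^sup>2 = 2 * (Re z)\<^sup>2" by (simp add: power_mult_distrib)
  also have "\<dots> = Re (z * cnj z + z * z)" by (simp add: power2_eq_square)
  also have "z * cnj z = (\<Sum>k\<in>UNIV. \<Sum>l\<in>UNIV. (w b k x * cnj (w b l x)) * (\<rho> k * cnj (\<rho> l)) ^ Suc j)"
    unfolding z_def cnj_sum sum_product by (intro sum.cong refl) (simp add: power_mult_distrib mult_ac)
  also have "z * z = (\<Sum>k\<in>UNIV. \<Sum>l\<in>UNIV. (w b k x * w b l x) * (\<rho> k * \<rho> l) ^ Suc j)"
    unfolding z_def sum_product by (intro sum.cong refl) (simp add: power_mult_distrib mult_ac)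
  finally show ?thesis by (simp add: sum.distrib)
qed

text \<open>Nondegeneracy separates the numbers with both signs: equal signs give the first claim,
  opposite signs the second, including \<open>k = l\<close>, where it excludes real
  eigenvalues.\<close>

lemma rotation_resonance:
  "cis (- \<theta> k) * cnj (cis (- \<theta> l)) = 1 \<longleftrightarrow> k = l" "cis (- \<theta> k) * cis (- \<theta> l) \<noteq> 1"
proof -
  have inj: "inj (\<lambda>(k, s :: bool). exp (\<i> * complex_of_real (if s then \<theta> k else - \<theta> k)))"
    using nondeg by (simp add: nondegenerate_spectrum_def)
  have cis_exp: "exp (\<i> * complex_of_real x) = cis x" for x by (simp add: cis_conv_exp)
  have *: "cis x * cis y = 1 \<Longrightarrow> cis x = cis (- y)" for x y
    by (simp add: cis_inverse[symmetric] divide_eq_eq inverse_eq_divide eq_divide_eq)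
  show "cis (- \<theta> k) * cnj (cis (- \<theta> l)) = 1 \<longleftrightarrow> k = l"
  proof
    assume "cis (- \<theta> k) * cnj (cis (- \<theta> l)) = 1"
    then have "cis (- \<theta> k) = cis (- \<theta> l)" using *[of "- \<theta> k" "\<theta> l"] by (simp add: cis_cnj)
    then show "k = l" using injD[OF inj, of "(k, False)" "(l, False)"] by (simp add: cis_exp)
  qed (simp add: cis_cnj cis_mult)
  show "cis (- \<theta> k) * cis (- \<theta> l) \<noteq> 1"
  proof
    assume "cis (- \<theta> k) * cis (- \<theta> l) = 1"
    then have "cis (- \<theta> k) = cis (\<theta> l)" using *[of "- \<theta> k" "- \<theta> l"] by simp
    then show False using injD[OF inj, of "(k, False)" "(l, True)"] by (simp add: cis_exp)
  qed
qed

text \<open>Averaging over time removes every oscillating factor, which leaves only the terms of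
  \<open>z * cnj z\<close> with \<open>k = l\<close>. Division by \<open>q_sigma\<close> normalizes
  each of them to the squared modulus of the coordinate of \<open>b\<close>.\<close>

lemma incr_map_covariance:
  "(\<lambda>K. (\<Sum>j<K. LINT u|cell_measure R. (b \<bullet> (incr_map j *v (u - \<mu>)))\<^sup>2) / real K) \<longlonglongrightarrow> b \<bullet> b"
proof -
  define \<rho> where "\<rho> k = cis (- \<theta> k)" for k
  define \<beta> where "\<beta> k = Complex (b $ (k, 1)) (b $ (k, 2))" for k
  define w where "w k x = cnj (\<beta> k) / of_real (q_sigma R U k) * cc k x" for k x
  define G where "G k l = (LINT u|cell_measure R. w k (u - \<mu>) * cnj (w l (u - \<mu>)))" for k l
  define H where "H k l = (LINT u|cell_measure R. w k (u - \<mu>) * w l (u - \<mu>))" for k l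
  have int: "integrable (cell_measure R) (\<lambda>u. w k (u - \<mu>) * cnj (w l (u - \<mu>)))"
    "integrable (cell_measure R) (\<lambda>u. w k (u - \<mu>) * w l (u - \<mu>))" for k l
    unfolding w_def by (intro integrable_cell_continuous[OF R] continuous_intros continuous_cc)+
  have "(LINT u|cell_measure R. (b \<bullet> (incr_map j *v (u - \<mu>)))\<^sup>2) =
      Re (\<Sum>k\<in>UNIV. \<Sum>l\<in>UNIV. G k l * (\<rho> k * cnj (\<rho> l)) ^ Suc j + H k l * (\<rho> k * \<rho> l) ^ Suc j)" for j
  proof -
    let ?f = "\<lambda>u. \<Sum>k\<in>UNIV. \<Sum>l\<in>UNIV. (w k (u - \<mu>) * cnj (w l (u - \<mu>))) * (\<rho> k * cnj (\<rho> l)) ^ Suc j + (w k (u - \<mu>) * w l (u - \<mu>)) * (\<rho> k * \<rho> l) ^ Suc j"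
    have intf: "integrable (cell_measure R) ?f"
      using int by (intro Bochner_Integration.integrable_sum Bochner_Integration.integrable_add integrable_mult_left) auto
    have "(LINT u|cell_measure R. (b \<bullet> (incr_map j *v (u - \<mu>)))\<^sup>2) = (LINT u|cell_measure R. Re (?f u))"
      unfolding inner_incr_map_square w_def \<rho>_def \<beta>_def ..
    also have "\<dots> = Re (LINT u|cell_measure R. ?f u)" by (rule integral_Re[OF intf])
    also have "(LINT u|cell_measure R. ?f u) = (\<Sum>k\<in>UNIV. \<Sum>l\<in>UNIV. G k l * (\<rho> k * cnj (\<rho> l)) ^ Suc j + H k l * (\<rho> k * \<rho> l) ^ Suc j)"
      unfolding G_def H_def using int
      by (simp only: Bochner_Integration.integral_sum Bochner_Integration.integral_add Bochner_Integration.integrable_sum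
        Bochner_Integration.integrable_add integrable_mult_left integral_mult_left_zero)
    finally show ?thesis .
  qed
  then have eq: "(\<Sum>j<K. LINT u|cell_measure R. (b \<bullet> (incr_map j *v (u - \<mu>)))\<^sup>2) / real K =
      Re (\<Sum>k\<in>UNIV. \<Sum>l\<in>UNIV. G k l * ((\<Sum>j<K. (\<rho> k * cnj (\<rho> l)) ^ Suc j) / of_nat K) + H k l * ((\<Sum>j<K. (\<rho> k * \<rho> l) ^ Suc j) / of_nat K))" for K
  proof -
    assume s: "\<And>j. (LINT u|cell_measure R. (b \<bullet> (incr_map j *v (u - \<mu>)))\<^sup>2) =
      Re (\<Sum>k\<in>UNIV. \<Sum>l\<in>UNIV. G k l * (\<rho> k * cnj (\<rho> l)) ^ Suc j + H k l * (\<rho> k * \<rho> l) ^ Suc j)"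
    have "(\<Sum>j<K. LINT u|cell_measure R. (b \<bullet> (incr_map j *v (u - \<mu>)))\<^sup>2) =
      Re (\<Sum>j<K. \<Sum>k\<in>UNIV. \<Sum>l\<in>UNIV. G k l * (\<rho> k * cnj (\<rho> l)) ^ Suc j + H k l * (\<rho> k * \<rho> l) ^ Suc j)"
      unfolding s by (rule Re_sum[symmetric])
    also have "(\<Sum>j<K. \<Sum>k\<in>UNIV. \<Sum>l\<in>UNIV. G k l * (\<rho> k * cnj (\<rho> l)) ^ Suc j + H k l * (\<rho> k * \<rho> l) ^ Suc j) =
      (\<Sum>k\<in>UNIV. \<Sum>l\<in>UNIV. G k l * (\<Sum>j<K. (\<rho> k * cnj (\<rho> l)) ^ Suc j) + H k l * (\<Sum>j<K. (\<rho> k * \<rho> l) ^ Suc j))"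
      by (subst sum.swap, intro sum.cong refl, subst sum.swap, intro sum.cong refl)
        (simp only: sum.distrib sum_distrib_left)
    finally show ?thesis
      by (simp only: Re_divide_of_nat[symmetric] sum_divide_distrib[where A = "UNIV :: 'r set"] add_divide_distrib times_divide_eq_right)
  qed
  have nrm: "cmod (\<rho> k * cnj (\<rho> l)) = 1" "cmod (\<rho> k * \<rho> l) = 1" for k l by (simp_all add: \<rho>_def norm_mult)
  have "(\<lambda>K. Re (\<Sum>k\<in>UNIV. \<Sum>l\<in>UNIV. G k l * ((\<Sum>j<K. (\<rho> k * cnj (\<rho> l)) ^ Suc j) / of_nat K) + H k l * ((\<Sum>j<K. (\<rho> k * \<rho> l) ^ Suc j) / of_nat K)))
    \<longlonglongrightarrow> Re (\<Sum>k\<in>UNIV. \<Sum>l\<in>UNIV. G k l * (if \<rho> k * cnj (\<rho> l) = 1 then 1 else 0) + H k l * (if \<rho> k * \<rho> l = 1 then 1 else 0))"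
    by (intro tendsto_Re tendsto_sum tendsto_add tendsto_mult tendsto_const cesaro_powers nrm)
  also have "(\<Sum>k\<in>UNIV. \<Sum>l\<in>UNIV. G k l * (if \<rho> k * cnj (\<rho> l) = 1 then 1 else 0) + H k l * (if \<rho> k * \<rho> l = 1 then 1 else 0)) = (\<Sum>k\<in>UNIV. G k k)"
    unfolding \<rho>_def by (simp add: rotation_resonance if_distrib[where f = "(*) _"] cong: if_cong)
  also have "(\<Sum>k\<in>UNIV. G k k) = (\<Sum>k\<in>UNIV. of_real ((cmod (\<beta> k))\<^sup>2))"
  proof (rule sum.cong[OF refl])
    fix k
    have "w k x * cnj (w k x) = of_real ((cmod (\<beta> k))\<^sup>2 / (q_sigma R U k)\<^sup>2 * (cmod (cc k x))\<^sup>2)" for x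
      unfolding complex_norm_square[symmetric] by (simp add: w_def norm_mult norm_divide power_mult_distrib power_divide)
    then have "G k k = of_real (LINT u|cell_measure R. (cmod (\<beta> k))\<^sup>2 / (q_sigma R U k)\<^sup>2 * (cmod (cc k (u - \<mu>)))\<^sup>2)"
      unfolding G_def by (simp only: integral_complex_of_real)
    also have "(LINT u|cell_measure R. (cmod (\<beta> k))\<^sup>2 / (q_sigma R U k)\<^sup>2 * (cmod (cc k (u - \<mu>)))\<^sup>2) = (cmod (\<beta> k))\<^sup>2 / (q_sigma R U k)\<^sup>2 * (q_sigma R U k)\<^sup>2"
      unfolding q_sigma_eq by simp
    also have "\<dots> = (cmod (\<beta> k))\<^sup>2" using q_sigma_pos[of k] by simp
    finally show "G k k = of_real ((cmod (\<beta> k))\<^sup>2)" .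
  qed
  also have "Re (\<Sum>k\<in>UNIV. of_real ((cmod (\<beta> k))\<^sup>2)) = b \<bullet> b"
    unfolding \<beta>_def cmod_power2 by (simp add: inner_vec_def sum_UNIV_prod sum_2 power2_eq_square)
  finally show ?thesis unfolding eq .
qed

text \<open>The errors are replaced by \<open>\<mu>\<close> off the cell, so that the increments are bounded everywhere.\<close>

definition cell_part :: "real^('r \<times> 2) \<Rightarrow> real^('r \<times> 2)" where
  "cell_part u = (if u \<in> interior (q_cell R) then u else \<mu>)"

definition path_step :: "nat \<Rightarrow> (nat \<Rightarrow> real^('r \<times> 2)) \<Rightarrow> real^('r \<times> 2)" where
  "path_step j e = incr_map j *v (cell_part (e j) - \<mu>)"

lemma measurable_incr_cell_part: "(\<lambda>u. incr_map j *v (cell_part u - \<mu>)) \<in> borel_measurable borel"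
proof -
  have "cell_part \<in> borel_measurable borel" unfolding cell_part_def by measurable
  moreover have "(\<lambda>u. incr_map j *v (u - \<mu>)) \<in> borel_measurable borel"
    by (intro borel_measurable_continuous_onI continuous_on_matrix_vector_mul continuous_intros)
  ultimately show ?thesis by (rule measurable_compose)
qed

lemma AE_cell_part: "AE u in cell_measure R. cell_part u = u"
  using AE_cell_measure by eventually_elim (simp add: cell_part_def)

text \<open>Independence comes from the product space, mean zero from centring at
  \<open>q_mean\<close>, and the uniform bound from the bounded cell together with the isometry of
  the rotations.\<close>

lemma path_step_independent: "\<exists>B. bounded_independent_vectors (err_space R) path_step B"
proof -
  interpret prob_space "err_space R" by (rule prob_space_err_space[OF R])
  obtain K where K: "\<And>u. R u = 0 \<Longrightarrow> norm u \<le> K" using bounded_q_cell[OF R] by blast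
  have "\<exists>C. \<forall>v\<in>cball 0 (K + norm \<mu>). cmod (cc k v) \<le> C" for k
  proof -
    have "compact (cc k ` cball 0 (K + norm \<mu>))"
      by (intro compact_continuous_image continuous_cc continuous_intros) auto
    then show ?thesis using compact_imp_bounded bounded_iff by (metis imageI)
  qed
  then obtain C where C: "\<And>k v. norm v \<le> K + norm \<mu> \<Longrightarrow> cmod (cc k v) \<le> C k" by (metis dist_0_norm mem_cball)
  have cc0: "cc k 0 = 0" for k by (simp add: cc_def complex_eq_iff)
  have bd: "cmod (cc k (cell_part u - \<mu>)) \<le> max 0 (C k)" for k u
  proof (cases "u \<in> interior (q_cell R)")
    case True
    then have "R u = 0" using interior_subset by fastforce
    then have "norm (u - \<mu>) \<le> K + norm \<mu>" using K[of u] norm_triangle_ineq4[of u \<mu>] by linarith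
    then show ?thesis using True C[of "u - \<mu>" k] by (simp add: cell_part_def)
  qed (simp add: cell_part_def cc0)
  define B where "B = (\<Sum>p\<in>UNIV. sqrt 2 / q_sigma R U (fst (p :: 'r \<times> 2)) * max 0 (C (fst p)))"
  have "bounded_independent_vectors (err_space R) path_step B"
  proof
    show "indep_vars (\<lambda>_. borel) path_step UNIV"
      unfolding path_step_def
      by (rule indep_vars_compose2[OF indep_vars_err_space[OF R]]) (rule measurable_incr_cell_part)
    show "expectation (path_step j) = 0" for j
    proof -
      have "expectation (path_step j) = (LINT u|cell_measure R. incr_map j *v (cell_part u - \<mu>))"
        unfolding path_step_def by (rule integral_err_space_component[OF R measurable_incr_cell_part])
      also have "\<dots> = (LINT u|cell_measure R. incr_map j *v (u - \<mu>))"
      proof (rule integral_cong_AE)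
        show "(\<lambda>u. incr_map j *v (cell_part u - \<mu>)) \<in> borel_measurable (cell_measure R)"
          using measurable_incr_cell_part by (simp cong: measurable_cong_sets)
        show "(\<lambda>u. incr_map j *v (u - \<mu>)) \<in> borel_measurable (cell_measure R)"
          by (intro borel_measurable_integrable integrable_cell_continuous[OF R] continuous_on_matrix_vector_mul continuous_intros)
      qed (use AE_cell_part in \<open>auto elim!: eventually_mono\<close>)
      also have "\<dots> = incr_map j *v (LINT u|cell_measure R. u - \<mu>)"
        by (intro integral_bounded_linear matrix_vector_mul_bounded_linear integrable_cell_continuous[OF R] continuous_intros)
      also have "(LINT u|cell_measure R. u - \<mu>) = 0"
        using integrable_cell_continuous[OF R, of "\<lambda>u. u"] Q.prob_space by (simp add: q_mean_eq[symmetric] continuous_on_id)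
      finally show ?thesis by simp
    qed
    show "norm (path_step j e) \<le> B" for j e
    proof -
      have "norm (path_step j e) \<le> (\<Sum>p\<in>UNIV. \<bar>path_step j e $ p\<bar>)" by (rule norm_le_l1_cart)
      also have "\<dots> \<le> B" unfolding B_def
      proof (rule sum_mono)
        fix p :: "'r \<times> 2"
        have "\<bar>path_step j e $ p\<bar> \<le> sqrt 2 / q_sigma R U (fst p) * cmod (cc (fst p) (cell_part (e j) - \<mu>))"
          using incr_map_component[of j "cell_part (e j) - \<mu>" "fst p" "snd p"] by (simp add: path_step_def)
        also have "\<dots> \<le> sqrt 2 / q_sigma R U (fst p) * max 0 (C (fst p))"
          using q_sigma_pos[of "fst p"] by (intro mult_left_mono bd) auto
        finally show "\<bar>path_step j e $ p\<bar> \<le> sqrt 2 / q_sigma R U (fst p) * max 0 (C (fst p))" .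
      qed
      finally show ?thesis .
    qed
  qed
  then show ?thesis ..
qed

section \<open>The normalized quantized path\<close>

definition scaled_map :: "nat \<Rightarrow> nat \<Rightarrow> real^('r \<times> 2)^('r \<times> 2)" where
  "scaled_map N j = (1 / sqrt (real N)) *\<^sub>R incr_map j"

text \<open>Almost surely all of the countably many errors lie in the interior of the cell, where
  \<open>cell_part\<close> is the identity.\<close>

lemma AE_lin_path_eq:
  "AE e in err_space R. lin_path N (scaled_map N) \<mu> e = poly_path N (\<lambda>j. (1 / sqrt (real N)) *\<^sub>R path_step j e)"
proof -
  have "AE e in err_space R. \<forall>j. cell_part (e j) = e j"
    unfolding AE_all_countable err_space_def
    by (intro allI AE_PiM_component prob_space_cell_measure R AE_cell_part) auto
  then show ?thesis
    by eventually_elim (simp add: lin_path_def path_step_def scaled_map_def scaleR_matrix_vector_assoc)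
qed

text \<open>Polygonal interpolation commutes with linear maps, so the normalization can be moved
  inside to single increments; time \<open>Suc j\<close> corresponds to coordinate
  \<open>j\<close>.\<close>

lemma W_path_eq_lin_path:
  "W_path R L U N x = lin_path N (scaled_map N) \<mu> (\<lambda>j. q_error_at R L (Suc j) x)"
proof -
  let ?A = "matrix_inv (sqrt_Phi R U)"
  have xi: "q_xi R L x i = (\<Sum>j<i. matpow (matrix_inv L) (Suc j) *v (q_error_at R L (Suc j) x - \<mu>))" for i
    unfolding q_xi_def
    by (rule sum.reindex_bij_witness[of _ Suc "\<lambda>k. k - 1"]) (auto simp: matpowi_def)
  have sums: "(\<Sum>j<i. scaled_map N j *v (q_error_at R L (Suc j) x - \<mu>)) = (1 / sqrt (real N)) *\<^sub>R (?A *v q_xi R L x i)" for i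
    by (simp add: xi scaled_map_def incr_map_def scaleR_sum_right linear_sum[OF matrix_vector_mul_linear] matrix_vector_mul_assoc
      flip: scaleR_matrix_vector_assoc)
  have pol: "polygonal (\<lambda>i. c *\<^sub>R (?A *v s i)) u = c *\<^sub>R (?A *v polygonal s u)" for c s u
    by (simp add: polygonal_def matrix_vector_right_distrib matrix_vector_mult_diff_distrib matrix_vector_mult_scaleR algebra_simps)
  show ?thesis
    unfolding W_path_def lin_path_def poly_path_def sums pol W_at_def ..
qed

lemma freq_distributed_W_path:
  assumes "iteratively_nonresonant L"
  shows "freq_distributed (distr (err_space R) borel (lin_path N (scaled_map N) \<mu>)) (W_path R L U N)"
proof -
  have "W_path R L U N = (\<lambda>x. lin_path N (scaled_map N) \<mu> (\<lambda>j. q_error_at R L (Suc j) x))"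
    by (rule ext) (rule W_path_eq_lin_path)
  then show ?thesis using freq_distributed_lin_path[OF R assms, of N "scaled_map N" \<mu>] by (simp only:)
qed

text \<open>The invariance principle applies to the steps truncated off the cell, and these give the
  same path almost surely; the averaged covariance is the identity by the choice of
  normalization.\<close>

lemma lin_path_weak_convergence:
  fixes W :: "(real^('r \<times> 2)) path0 measure"
  assumes W: "wiener_measure W" and g: "\<And>x. 0 \<le> g x \<and> g x \<le> 1" "\<And>x y. \<bar>g x - g y\<bar> \<le> K * dist x y"
  shows "(\<lambda>N. LINT e|err_space R. g (lin_path N (scaled_map N) \<mu> e)) \<longlonglongrightarrow> (LINT f|W. (g f :: real))"
proof -
  obtain B where "bounded_independent_vectors (err_space R) path_step B" using path_step_independent by blast
  then interpret S: bounded_independent_vectors "err_space R" path_step B .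
  have sm: "S.second_moment b j = (LINT u|cell_measure R. (b \<bullet> (incr_map j *v (u - \<mu>)))\<^sup>2)" for b j
  proof -
    have m: "(\<lambda>u. (b \<bullet> (incr_map j *v (cell_part u - \<mu>)))\<^sup>2) \<in> borel_measurable borel"
      using measurable_incr_cell_part by simp
    have "S.second_moment b j = (LINT u|cell_measure R. (b \<bullet> (incr_map j *v (cell_part u - \<mu>)))\<^sup>2)"
      unfolding S.second_moment_def path_step_def by (rule integral_err_space_component[OF R m])
    also have "\<dots> = (LINT u|cell_measure R. (b \<bullet> (incr_map j *v (u - \<mu>)))\<^sup>2)"
    proof (rule integral_cong_AE)
      show "(\<lambda>u. (b \<bullet> (incr_map j *v (cell_part u - \<mu>)))\<^sup>2) \<in> borel_measurable (cell_measure R)"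
        using m by (simp cong: measurable_cong_sets)
      show "(\<lambda>u. (b \<bullet> (incr_map j *v (u - \<mu>)))\<^sup>2) \<in> borel_measurable (cell_measure R)"
        by (intro borel_measurable_integrable integrable_cell_continuous[OF R] continuous_on_matrix_vector_mul continuous_intros)
    qed (use AE_cell_part in \<open>auto elim!: eventually_mono\<close>)
    finally show ?thesis .
  qed
  have lim: "(\<lambda>N. LINT e|err_space R. g (poly_path N (\<lambda>j. (1 / sqrt (real N)) *\<^sub>R path_step j e))) \<longlonglongrightarrow> (LINT f|W. g f)"
    by (rule S.invariance_principle[OF _ W g]) (simp only: sm incr_map_covariance)
  have mg: "g \<in> borel_measurable borel"
    by (rule borel_measurable_continuous_onI, rule lipschitz_imp_continuous_on[of _ K]) (use g(2) in \<open>simp add: dist_real_def\<close>)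
  have "(LINT e|err_space R. g (lin_path N (scaled_map N) \<mu> e)) = (LINT e|err_space R. g (poly_path N (\<lambda>j. (1 / sqrt (real N)) *\<^sub>R path_step j e)))" for N
  proof (rule integral_cong_AE)
    show "(\<lambda>e. g (lin_path N (scaled_map N) \<mu> e)) \<in> borel_measurable (err_space R)"
      by (rule measurable_compose[OF measurable_lin_path[OF R] mg])
    show "(\<lambda>e. g (poly_path N (\<lambda>j. (1 / sqrt (real N)) *\<^sub>R path_step j e))) \<in> borel_measurable (err_space R)"
      by (rule measurable_compose[OF measurable_poly_path mg]) simp
  qed (use AE_lin_path_eq[of N] in \<open>auto elim!: eventually_mono\<close>)
  with lim show ?thesis by simp
qed

end

text \<open>The null frontier under the law of the \<open>N\<close>-th path turns the frequency into
  a probability for each large \<open>N\<close>; the null frontier under \<open>W\<close> then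
  permits the limit. Frequency measurability is part of the conclusion because \<open>freq\<close>
  is unspecified for other sets.\<close>

theorem theorem16:
  fixes R :: "real^('r::finite \<times> 2) \<Rightarrow> int^('r \<times> 2)"
    and L U :: "real^('r \<times> 2)^('r \<times> 2)"
    and \<theta> :: "'r \<Rightarrow> real"
    and W :: "(real^('r \<times> 2)) path0 measure"
    and B :: "(real^('r \<times> 2)) path0 set"
  assumes "quantizer R"
    and "invertible U"
    and "\<And>k. 0 < \<theta> k \<and> \<theta> k < 2 * pi"
    and "L = (\<Sum>k\<in>UNIV. col_block U k ** rotation2 (\<theta> k) ** row_block (matrix_inv U) k)"
    and "iteratively_nonresonant L"
    and "nondegenerate_spectrum \<theta>"
    and "wiener_measure W"
    and "B \<in> wiener_test_sets W R L U"
  shows "(\<forall>\<^sub>F N in sequentially. freq_measurable {x. W_path R L U N x \<in> B}) \<and>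
    (\<lambda>N. freq {x. W_path R L U N x \<in> B}) \<longlonglongrightarrow> measure W B"
proof -
  have "invertible L" using assms(5) by (simp add: iteratively_nonresonant_def)
  note ctx = assms(1,2,4) this assms(6)
  let ?\<Gamma> = "\<lambda>N. lin_path N (scaled_map R L U N) (q_mean R)"
  let ?D = "\<lambda>N. distr (err_space R) borel (?\<Gamma> N)"
  have dist: "freq_distributed (?D N) (W_path R L U N)" for N
    by (rule freq_distributed_W_path[OF ctx assms(5)])
  have B: "B \<in> sets borel" "measure W (frontier B) = 0"
    and ev: "\<forall>\<^sub>F N in sequentially. measure (?D N) (frontier B) = 0"
    using assms(8) by (auto simp: wiener_test_sets_def freq_law_eq[OF dist])
  have freq: "\<forall>\<^sub>F N in sequentially. freq_measurable {x. W_path R L U N x \<in> B} \<and> freq {x. W_path R L U N x \<in> B} = measure (?D N) B"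
    using ev
  proof eventually_elim
    case (elim N)
    then show ?case using dist[of N] B(1) by (auto simp: freq_distributed_def vimage_def)
  qed
  have "(\<lambda>N. measure (err_space R) {e\<in>space (err_space R). ?\<Gamma> N e \<in> B}) \<longlonglongrightarrow> measure W B"
    by (rule portmanteau[OF prob_space_err_space[OF assms(1)] measurable_lin_path[OF assms(1)]
        prob_space_wiener[OF assms(7)] sets_wiener[OF assms(7)] lin_path_weak_convergence[OF ctx assms(7)] B])
  moreover have "measure (?D N) B = measure (err_space R) {e\<in>space (err_space R). ?\<Gamma> N e \<in> B}" for N
    using B(1) measurable_lin_path[OF assms(1), of N] by (subst measure_distr) (auto intro!: arg_cong[where f = "measure _"])
  ultimately have "(\<lambda>N. measure (?D N) B) \<longlonglongrightarrow> measure W B" by simp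
  then have "(\<lambda>N. freq {x. W_path R L U N x \<in> B}) \<longlonglongrightarrow> measure W B"
    by (rule Lim_transform_eventually) (use freq in eventually_elim, simp)
  then show ?thesis using freq by (auto elim: eventually_mono)
qed

end
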